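(* Let $t$ be an integer and let $Q$ be a type $(1,\dots,1)$ cyclic quiver with $n$ nodes and degree labels $d_1,\dots,d_n$, with $\sum_i d_i$ coprime to $n$. Assume that $Q$ admits stable representations in $\mathrm{Bun}(\mathbb{P}^1,\mathcal{O}(t))$ and is indexed so that $\phi_n$ is the unique map which stability allows to be zero. Then the moduli space $\mathcal{M}_{\mathbb{P}^1,\mathcal{O}(t)}(Q)$ of stable representations of $Q$ in $\mathrm{Bun}(\mathbb{P}^1,\mathcal{O}(t))$ is both: (1) via the Hitchin map $h$, an $\eta(Q)$-sheeted covering of $H^0(\mathbb{P}^1,\mathcal{O}(nt))\setminus\{0\}$, where $$\eta(Q)=\binom{nt}{d_2-d_1+t,\dots,d_n-d_{n-1}+t,\,d_1-d_n+t}$$ is the multinomial coefficient, which branches over points with roots of multiplicity greater than one and whose sheets intersect over $0\in H^0(\mathbb{P}^1,\mathcal{O}(nt))$ as $\prod_{i=1}^{n-1}\mathbb{P}^{d_{i+1}-d_i+t}$; and (2) the total space of the vector bundle $\mathcal{O}_{\prod_{i=1}^{n-1}\mathbb{P}^{d_{i+1}-d_i+t}}(-1,\dots,-1)^{\oplus (d_1-d_n+t+1)}$, where $$\mathcal{O}_{\prod_{i=1}^{n-1}\mathbb{P}^{d_{i+1}-d_i+t}}(-1,\dots,-1)=\bigotimes_{i=1}^{n-1}p_i^*\mathcal{O}_{\mathbb{P}^{d_{i+1}-d_i+t}}(-1)$$ and $p_i$ is the natural projection onto the $i$-th factor.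
   Context: Representations. A type $(1,\dots,1)$ cyclic quiver $Q$ has nodes $1,\dots,n$ ($n\ge2$), arrows $1\to2\to\cdots\to n\to1$, and node $i$ is labelled by rank $1$ and degree $d_i\in\mathbb{Z}$. A representation in $\mathrm{Bun}(\mathbb{P}^1,\mathcal{O}(t))$ consists of $U_i=\mathcal{O}(d_i)$ and maps $\phi_i:U_i\to U_{i+1}\otimes\mathcal{O}(t)$ (indices mod $n$), i.e. $\phi_i\in H^0(\mathbb{P}^1,\mathcal{O}(d_{i+1}-d_i+t))$. It is viewed as the twisted Higgs bundle $(E,\Phi)$ with $E=\bigoplus U_i$ and $\Phi:E\to E\otimes\mathcal{O}(t)$ having components $\phi_i$. Stability. $(E,\Phi)$ is stable if $\mu(F)<\mu(E)$, where $\mu=\deg/\mathrm{rk}$, for all proper nonzero subbundles $F$ with $\Phi(F)\subseteq F\otimes\mathcal{O}(t)$. There is exactly one index $i$ for which no proper sub-sum of cyclically consecutive summands $U_j\oplus\cdots\oplus U_i$ ending at $U_i$ has slope $>\mu(E)$; this $\phi_i$ is the only map allowed by stability to be zero, and nodes are indexed so that $i=n$. With this indexing, $Q$ admits stable representations if and only if $t\ge d_i-d_{i+1}$ for $i=1,\dots,n-1$, and the stable representations are those with $\phi_1,\dots,\phi_{n-1}\ne0$. Moduli. $\mathcal{M}_{\mathbb{P}^1,\mathcal{O}(t)}(Q)$ is the moduli space of stable representations modulo $\prod\mathrm{Aut}(U_i)$, i.e. the quotient of $\prod_{i=1}^{n-1}\big(H^0(\mathbb{P}^1,\mathcal{O}(d_{i+1}-d_i+t))\setminus\{0\}\big)\times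 H^0(\mathbb{P}^1,\mathcal{O}(d_1-d_n+t))$ by the action of $(\mathbb{C}^\times)^{n-1}$ given by $(\lambda_1,\dots,\lambda_{n-1})\cdot(\phi_1,\dots,\phi_n)=(\lambda_1\phi_1,\dots,\lambda_{n-1}\phi_{n-1},\lambda_1^{-1}\cdots\lambda_{n-1}^{-1}\phi_n)$. Hitchin map. $h$ sends a representation to the characteristic polynomial of $\Phi$; on cyclic representations this amounts, up to sign, to $\phi_1\cdots\phi_n\in H^0(\mathbb{P}^1,\mathcal{O}(nt))$. Nonzero elements of $H^0(\mathbb{P}^1,\mathcal{O}(nt))$ are regarded as polynomials, with their $nt$ roots (zeros) on $\mathbb{P}^1$ counted with multiplicity. Statement (1) means: over sections with $nt$ distinct zeros, $h$ is an unramified covering with $\eta(Q)$ sheets; over nonzero sections with repeated zeros this degenerates (branching); the fibre over $0$ is $\prod_{i=1}^{n-1}\mathbb{P}^{d_{i+1}-d_i+t}$, and every point of this fibre is a limit of points of the covering.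
   Formalization: Branching over points with repeated roots is claimed only when η(Q)>1; when η(Q)=1 (e.g. n=2, d=(1,0), t=1) a one-sheeted covering cannot branch, and h is instead shown to be a 1-sheeted covering of all of H^0(P^1,O(nt))\{0}. *)

theory Defs
  imports "HOL-Analysis.Function_Topology" "Jordan_Normal_Form.Char_Poly"
begin

section \<open>Sections of line bundles on the projective line\<close>

text \<open>
  A section of \<open>O(m)\<close> on \<open>P\<^sup>1\<close> is a binary form of degree \<open>m\<close>; it is stored dehomogenised, as a
  polynomial in \<open>z = x / y\<close> of degree at most \<open>m\<close>.  For \<open>m < 0\<close> only the zero section is left.
  Products of sections are products of polynomials, the degrees of the line bundles being added.
\<close>

definition H0 :: "int \<Rightarrow> complex poly set" where
  "H0 m = {s. s = 0 \<or> int (degree s) \<le> m}"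

definition form_eval :: "int \<Rightarrow> complex poly \<Rightarrow> complex \<Rightarrow> complex \<Rightarrow> complex" where
  "form_eval m s x y = (\<Sum>k\<le>nat m. coeff s k * x ^ k * y ^ (nat m - k))"

text \<open>
  Multiplicity of a point of \<open>P\<^sup>1\<close> as a zero of a nonzero section of \<open>O(m)\<close>; the point
  \<open>None\<close> is the point at infinity.
\<close>

definition zero_mult :: "int \<Rightarrow> complex poly \<Rightarrow> complex option \<Rightarrow> nat" where
  "zero_mult m s p = (case p of Some z \<Rightarrow> Polynomial.order z s | None \<Rightarrow> nat m - degree s)"

definition distinct_zeros :: "int \<Rightarrow> complex poly set" where
  "distinct_zeros m = {s \<in> H0 m. s \<noteq> 0 \<and> (\<forall>p. zero_mult m s p \<le> 1)}"

definition repeated_zeros :: "int \<Rightarrow> complex poly set" where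
  "repeated_zeros m = {s \<in> H0 m. s \<noteq> 0 \<and> (\<exists>p. zero_mult m s p > 1)}"

section \<open>Representations of cyclic quivers and stability\<close>

definition nxt :: "nat \<Rightarrow> nat \<Rightarrow> nat" where
  "nxt n i = (if i = n then 1 else i + 1)"

definition map_degree :: "nat \<Rightarrow> (nat \<Rightarrow> int) \<Rightarrow> int \<Rightarrow> nat \<Rightarrow> int" where
  "map_degree n d t i = d (nxt n i) - d i + t"

definition reps :: "nat \<Rightarrow> (nat \<Rightarrow> int) \<Rightarrow> int \<Rightarrow> (nat \<Rightarrow> complex poly) set" where
  "reps n d t = {\<phi>. (\<forall>i\<in>{1..n}. \<phi> i \<in> H0 (map_degree n d t i)) \<and> (\<forall>i. i \<notin> {1..n} \<longrightarrow> \<phi> i = 0)}"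

text \<open>Matrices are indexed from \<open>0\<close>: row and column \<open>j\<close> belong to the node \<open>j + 1\<close>.\<close>

definition higgs_field :: "nat \<Rightarrow> (nat \<Rightarrow> complex poly) \<Rightarrow> complex poly mat" where
  "higgs_field n \<phi> = mat n n (\<lambda>(k, j). if k = (j + 1) mod n then \<phi> (j + 1) else 0)"

text \<open>
  Rank \<open>r\<close> subbundles of \<open>E = O(d\<^sub>1) \<oplus> \<dots> \<oplus> O(d\<^sub>n)\<close>.  Every vector bundle on \<open>P\<^sup>1\<close> splits, so a
  subbundle is the image of a map \<open>O(a\<^sub>0) \<oplus> \<dots> \<oplus> O(a\<^sub>r\<^sub>-\<^sub>1) \<rightarrow> E\<close> that is injective on every fibre.
  Such a map is a matrix of sections \<open>S\<^sub>k\<^sub>j\<close> of the bundles \<open>O(d\<^sub>k\<^sub>+\<^sub>1 - a\<^sub>j)\<close>, and the degree of the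
  subbundle is the sum of the \<open>a\<^sub>j\<close>.
\<close>

definition is_subbundle ::
  "nat \<Rightarrow> (nat \<Rightarrow> int) \<Rightarrow> nat \<Rightarrow> (nat \<Rightarrow> int) \<Rightarrow> complex poly mat \<Rightarrow> bool" where
  "is_subbundle n d r a S \<longleftrightarrow>
     S \<in> carrier_mat n r \<and>
     (\<forall>k<n. \<forall>j<r. S $$ (k, j) \<in> H0 (d (k + 1) - a j)) \<and>
     (\<forall>x y. (x, y) \<noteq> (0, 0) \<longrightarrow>
        (\<forall>v \<in> carrier_vec r.
           mat n r (\<lambda>(k, j). form_eval (d (k + 1) - a j) (S $$ (k, j)) x y) *\<^sub>v v = 0\<^sub>v n
           \<longrightarrow> v = 0\<^sub>v r))"

text \<open>\<open>\<Phi>(F) \<subseteq> F \<otimes> O(t)\<close>: the restriction of \<open>\<Phi>\<close> to \<open>F\<close> is a map \<open>\<Psi> : F \<rightarrow> F \<otimes> O(t)\<close>.\<close>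

definition higgs_invariant ::
  "nat \<Rightarrow> int \<Rightarrow> (nat \<Rightarrow> complex poly) \<Rightarrow> nat \<Rightarrow> (nat \<Rightarrow> int) \<Rightarrow> complex poly mat \<Rightarrow> bool" where
  "higgs_invariant n t \<phi> r a S \<longleftrightarrow>
     (\<exists>\<Psi> \<in> carrier_mat r r.
        (\<forall>k<r. \<forall>j<r. \<Psi> $$ (k, j) \<in> H0 (a k - a j + t)) \<and> higgs_field n \<phi> * S = S * \<Psi>)"

definition stable_reps :: "nat \<Rightarrow> (nat \<Rightarrow> int) \<Rightarrow> int \<Rightarrow> (nat \<Rightarrow> complex poly) set" where
  "stable_reps n d t =
     {\<phi> \<in> reps n d t. \<forall>r a S. 0 < r \<and> r < n \<and> is_subbundle n d r a S \<and> higgs_invariant n t \<phi> r a S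
        \<longrightarrow> real_of_int (\<Sum>j<r. a j) / real r < real_of_int (\<Sum>i=1..n. d i) / real n}"

text \<open>
  The proper sub-sums of cyclically consecutive summands ending at \<open>U\<^sub>n\<close> are \<open>U\<^sub>k \<oplus> \<dots> \<oplus> U\<^sub>n\<close> with
  \<open>2 \<le> k \<le> n\<close>.  That none of them has slope larger than that of \<open>E\<close> singles out \<open>\<phi>\<^sub>n\<close> as the map
  which stability allows to be zero.
\<close>

definition indexed_to_vanish_last :: "nat \<Rightarrow> (nat \<Rightarrow> int) \<Rightarrow> bool" where
  "indexed_to_vanish_last n d \<longleftrightarrow>
     (\<forall>k\<in>{2..n}. \<not> real_of_int (\<Sum>j=k..n. d j) / real (n - k + 1)
                    > real_of_int (\<Sum>i=1..n. d i) / real n)"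

text \<open>The group \<open>Aut(U\<^sub>1) \<times> \<dots> \<times> Aut(U\<^sub>n)\<close> consists of tuples \<open>g\<close> of nonzero scalars.\<close>

definition rep_iso :: "nat \<Rightarrow> (nat \<Rightarrow> int) \<Rightarrow> int \<Rightarrow> (nat \<Rightarrow> complex poly) rel" where
  "rep_iso n d t =
     {(\<phi>, \<psi>). \<phi> \<in> stable_reps n d t \<and> \<psi> \<in> stable_reps n d t \<and>
        (\<exists>g. \<forall>i\<in>{1..n}. g i \<noteq> 0 \<and> \<psi> i = Polynomial.smult (g (nxt n i) / g i) (\<phi> i))}"

section \<open>Complex varieties as spaces with functions\<close>

text \<open>
  A variety is given by its analytic topology, its Zariski topology (on the same points) and the
  regular functions on each Zariski open set.  Functions are total in HOL; membership in
  \<open>reg X W\<close> only depends on the values on \<open>W\<close>.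
\<close>

record 'a variety =
  an :: "'a topology"
  zar :: "'a topology"
  reg :: "'a set \<Rightarrow> ('a \<Rightarrow> complex) set"

abbreviation points :: "'a variety \<Rightarrow> 'a set" where
  "points X \<equiv> topspace (zar X)"

definition variety_morphism :: "'a variety \<Rightarrow> 'b variety \<Rightarrow> ('a \<Rightarrow> 'b) \<Rightarrow> bool" where
  "variety_morphism X Y f \<longleftrightarrow>
     continuous_map (an X) (an Y) f \<and> continuous_map (zar X) (zar Y) f \<and>
     (\<forall>V. openin (zar Y) V \<longrightarrow> (\<forall>u \<in> reg Y V. u \<circ> f \<in> reg X {x \<in> points X. f x \<in> V}))"

definition variety_iso :: "'a variety \<Rightarrow> 'b variety \<Rightarrow> ('a \<Rightarrow> 'b) \<Rightarrow> bool" where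
  "variety_iso X Y f \<longleftrightarrow>
     variety_morphism X Y f \<and>
     (\<exists>g. variety_morphism Y X g \<and> (\<forall>x \<in> points X. g (f x) = x) \<and> (\<forall>y \<in> points Y. f (g y) = y))"

inductive_set polyfun :: "(('i \<Rightarrow> complex) \<Rightarrow> complex) set" where
  const: "(\<lambda>_. a) \<in> polyfun"
| coord: "(\<lambda>x. x i) \<in> polyfun"
| add: "P \<in> polyfun \<Longrightarrow> Q \<in> polyfun \<Longrightarrow> (\<lambda>x. P x + Q x) \<in> polyfun"
| mult: "P \<in> polyfun \<Longrightarrow> Q \<in> polyfun \<Longrightarrow> (\<lambda>x. P x * Q x) \<in> polyfun"

definition zariski :: "'a set \<Rightarrow> ('a \<Rightarrow> 'i \<Rightarrow> complex) \<Rightarrow> 'a topology" where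
  "zariski Z c = topology_generated_by {{z \<in> Z. P (c z) \<noteq> 0} | P. P \<in> polyfun}"

text \<open>
  The subvariety of an affine space whose points form the set \<open>Z\<close>, with coordinates \<open>c\<close>; here \<open>c\<close>
  is injective on \<open>Z\<close> and all but finitely many coordinates vanish identically on \<open>Z\<close>.
\<close>

definition embedded_variety :: "'a set \<Rightarrow> ('a \<Rightarrow> 'i \<Rightarrow> complex) \<Rightarrow> 'a variety" where
  "embedded_variety Z c =
     \<lparr> an = pullback_topology Z c euclidean,
       zar = zariski Z c,
       reg = (\<lambda>W. {u. \<forall>w\<in>W. \<exists>V P Q. openin (zariski Z c) V \<and> w \<in> V \<and> V \<subseteq> W \<and>
                P \<in> polyfun \<and> Q \<in> polyfun \<and> (\<forall>z\<in>V. Q (c z) \<noteq> 0 \<and> u z = P (c z) / Q (c z))}) \<rparr>"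

definition quotient_topology :: "'a topology \<Rightarrow> 'a rel \<Rightarrow> 'a set topology" where
  "quotient_topology T R =
     topology (\<lambda>W. W \<subseteq> topspace T // R \<and> openin T {z \<in> topspace T. R `` {z} \<in> W})"

text \<open>Quotient by an equivalence relation \<open>R\<close> (the orbits of a group): invariant functions.\<close>

definition quotient_variety :: "'a variety \<Rightarrow> 'a rel \<Rightarrow> 'a set variety" where
  "quotient_variety X R =
     \<lparr> an = quotient_topology (an X) R,
       zar = quotient_topology (zar X) R,
       reg = (\<lambda>W. {u. (\<lambda>z. u (R `` {z})) \<in> reg X {z \<in> points X. R `` {z} \<in> W}}) \<rparr>"

definition subvariety :: "'a variety \<Rightarrow> 'a set \<Rightarrow> 'a variety" where
  "subvariety X S =
     \<lparr> an = subtopology (an X) S,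
       zar = subtopology (zar X) S,
       reg = (\<lambda>W. {u. \<forall>w\<in>W. \<exists>V v. openin (zar X) V \<and> w \<in> V \<and> v \<in> reg X V \<and>
                (\<forall>x\<in>V \<inter> W. u x = v x)}) \<rparr>"

text \<open>The map on equivalence classes induced by a function that is constant on each class.\<close>

definition descend :: "('a \<Rightarrow> 'b) \<Rightarrow> 'a set \<Rightarrow> 'b" where
  "descend f C = the_elem (f ` C)"

section \<open>The moduli space and the Hitchin map\<close>

definition moduli :: "nat \<Rightarrow> (nat \<Rightarrow> int) \<Rightarrow> int \<Rightarrow> (nat \<Rightarrow> complex poly) set variety" where
  "moduli n d t =
     quotient_variety (embedded_variety (stable_reps n d t) (\<lambda>\<phi> (i, k). coeff (\<phi> i) k)) (rep_iso n d t)"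

definition H0_variety :: "int \<Rightarrow> complex poly variety" where
  "H0_variety m = embedded_variety (H0 m) coeff"

text \<open>
  The characteristic polynomial of a cyclic \<open>\<Phi>\<close> is \<open>y\<^sup>n - \<phi>\<^sub>1 \<cdots> \<phi>\<^sub>n\<close> (lemma \<open>char_poly_higgs_field\<close>
  below), so only its constant coefficient carries information; the sign is chosen to give
  \<open>\<phi>\<^sub>1 \<cdots> \<phi>\<^sub>n\<close>.
\<close>

definition hitchin :: "nat \<Rightarrow> (nat \<Rightarrow> complex poly) \<Rightarrow> complex poly" where
  "hitchin n \<phi> = - coeff (char_poly (higgs_field n \<phi>)) 0"

definition hitchin_map :: "nat \<Rightarrow> (nat \<Rightarrow> complex poly) set \<Rightarrow> complex poly" where
  "hitchin_map n = descend (hitchin n)"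

definition eta :: "nat \<Rightarrow> (nat \<Rightarrow> int) \<Rightarrow> int \<Rightarrow> nat" where
  "eta n d t = fact (nat (int n * t)) div (\<Prod>i=1..n. fact (nat (map_degree n d t i)))"

section \<open>Products of projective spaces and the bundle O(-1,...,-1)\<close>

text \<open>
  Tuples of nonzero vectors \<open>x i \<in> \<complex>\<^bsup>m i + 1\<^esup>\<close>, \<open>i \<in> I\<close>.  A point of the product of the projective
  spaces \<open>P\<^bsup>m i\<^esup>\<close> is such a tuple up to rescaling each \<open>x i\<close> separately.
\<close>

definition multicone :: "nat set \<Rightarrow> (nat \<Rightarrow> nat) \<Rightarrow> (nat \<Rightarrow> nat \<Rightarrow> complex) set" where
  "multicone I m =
     {x. (\<forall>i\<in>I. (\<exists>k. x i k \<noteq> 0) \<and> (\<forall>k>m i. x i k = 0)) \<and> (\<forall>i. i \<notin> I \<longrightarrow> x i = (\<lambda>_. 0))}"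

definition rescaling :: "nat set \<Rightarrow> (nat \<Rightarrow> nat) \<Rightarrow> (nat \<Rightarrow> nat \<Rightarrow> complex) rel" where
  "rescaling I m =
     {(x, y). x \<in> multicone I m \<and> y \<in> multicone I m \<and>
        (\<exists>a. \<forall>i\<in>I. a i \<noteq> 0 \<and> y i = (\<lambda>k. a i * x i k))}"

definition proj_product :: "nat set \<Rightarrow> (nat \<Rightarrow> nat) \<Rightarrow> (nat \<Rightarrow> nat \<Rightarrow> complex) set variety" where
  "proj_product I m =
     quotient_variety (embedded_variety (multicone I m) (\<lambda>x (i, k). x i k)) (rescaling I m)"

text \<open>
  Tensors in \<open>\<Otimes>\<^bsub>i\<in>I\<^esub> \<complex>\<^bsup>m i + 1\<^esup>\<close> are arrays indexed by the multi-indices \<open>\<alpha>\<close> with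
  \<open>\<alpha> i \<le> m i\<close>.  The bundle \<open>O(-1)\<close> is the tautological line bundle, so the fibre of
  \<open>O(-1,\<dots>,-1) = \<Otimes>\<^bsub>i\<in>I\<^esub> p\<^sub>i\<^sup>* O(-1)\<close> over the tuple of lines \<open>\<complex> x i\<close> is the tensor product of these
  lines, which is spanned by the tensor product of the \<open>x i\<close>.
\<close>

definition pure_tensor ::
  "nat set \<Rightarrow> (nat \<Rightarrow> nat) \<Rightarrow> (nat \<Rightarrow> nat \<Rightarrow> complex) \<Rightarrow> (nat \<Rightarrow> nat) \<Rightarrow> complex" where
  "pure_tensor I m x \<alpha> = (if \<alpha> \<in> (\<Pi>\<^sub>E i\<in>I. {..m i}) then \<Prod>i\<in>I. x i (\<alpha> i) else 0)"

definition taut_fibre ::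
  "nat set \<Rightarrow> (nat \<Rightarrow> nat) \<Rightarrow> (nat \<Rightarrow> nat \<Rightarrow> complex) \<Rightarrow> ((nat \<Rightarrow> nat) \<Rightarrow> complex) set" where
  "taut_fibre I m x = {T. \<exists>a. T = (\<lambda>\<alpha>. a * pure_tensor I m x \<alpha>)}"

text \<open>
  The total space of \<open>O(-1,\<dots>,-1)\<^bsup>\<oplus>q\<^esup>\<close>, as the subbundle of the trivial bundle with fibre
  \<open>(\<Otimes>\<^bsub>i\<in>I\<^esub> \<complex>\<^bsup>m i + 1\<^esup>)\<^bsup>\<oplus>q\<^esup>\<close>: pairs of a point of the base and a vector in the fibre over it.
\<close>

definition taut_pairs ::
  "nat set \<Rightarrow> (nat \<Rightarrow> nat) \<Rightarrow> nat
    \<Rightarrow> ((nat \<Rightarrow> nat \<Rightarrow> complex) \<times> (nat \<Rightarrow> (nat \<Rightarrow> nat) \<Rightarrow> complex)) set" where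
  "taut_pairs I m q =
     {(x, T). x \<in> multicone I m \<and> (\<forall>j<q. T j \<in> taut_fibre I m x) \<and> (\<forall>j\<ge>q. T j = (\<lambda>_. 0))}"

definition taut_rescaling ::
  "nat set \<Rightarrow> (nat \<Rightarrow> nat) \<Rightarrow> nat
    \<Rightarrow> ((nat \<Rightarrow> nat \<Rightarrow> complex) \<times> (nat \<Rightarrow> (nat \<Rightarrow> nat) \<Rightarrow> complex)) rel" where
  "taut_rescaling I m q =
     {((x, T), (y, S)). (x, T) \<in> taut_pairs I m q \<and> (y, S) \<in> taut_pairs I m q \<and>
        (x, y) \<in> rescaling I m \<and> S = T}"

definition taut_coords ::
  "(nat \<Rightarrow> nat \<Rightarrow> complex) \<times> (nat \<Rightarrow> (nat \<Rightarrow> nat) \<Rightarrow> complex)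
    \<Rightarrow> (nat \<times> nat) + (nat \<times> (nat \<Rightarrow> nat)) \<Rightarrow> complex" where
  "taut_coords = (\<lambda>(x, T). case_sum (\<lambda>(i, k). x i k) (\<lambda>(j, \<alpha>). T j \<alpha>))"

definition taut_total ::
  "nat set \<Rightarrow> (nat \<Rightarrow> nat) \<Rightarrow> nat
    \<Rightarrow> ((nat \<Rightarrow> nat \<Rightarrow> complex) \<times> (nat \<Rightarrow> (nat \<Rightarrow> nat) \<Rightarrow> complex)) set variety" where
  "taut_total I m q =
     quotient_variety (embedded_variety (taut_pairs I m q) taut_coords) (taut_rescaling I m q)"

definition taut_projection ::
  "nat set \<Rightarrow> (nat \<Rightarrow> nat)
    \<Rightarrow> ((nat \<Rightarrow> nat \<Rightarrow> complex) \<times> (nat \<Rightarrow> (nat \<Rightarrow> nat) \<Rightarrow> complex)) set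
    \<Rightarrow> (nat \<Rightarrow> nat \<Rightarrow> complex) set" where
  "taut_projection I m = descend (\<lambda>(x, T). rescaling I m `` {x})"

text \<open>
  The map from the moduli space sending the class of \<open>\<phi>\<close> to \<open>([\<phi>\<^sub>1], \<dots>, [\<phi>\<^sub>n\<^sub>-\<^sub>1])\<close>, a section of
  \<open>O(m)\<close> being identified with its coefficient vector in \<open>\<complex>\<^bsup>m + 1\<^esup>\<close>.
\<close>

definition moduli_projection ::
  "nat \<Rightarrow> (nat \<Rightarrow> int) \<Rightarrow> int \<Rightarrow> (nat \<Rightarrow> complex poly) set \<Rightarrow> (nat \<Rightarrow> nat \<Rightarrow> complex) set" where
  "moduli_projection n d t =
     descend (\<lambda>\<phi>. rescaling {1..<n} (\<lambda>i. nat (map_degree n d t i)) ``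
                     {\<lambda>i. if i \<in> {1..<n} then coeff (\<phi> i) else (\<lambda>_. 0)})"

section \<open>Coverings and branching\<close>

definition sheeted_covering :: "nat \<Rightarrow> 'a topology \<Rightarrow> 'b topology \<Rightarrow> ('a \<Rightarrow> 'b) \<Rightarrow> bool" where
  "sheeted_covering N X Y p \<longleftrightarrow>
     continuous_map X Y p \<and>
     (\<forall>y \<in> topspace Y. \<exists>V. openin Y V \<and> y \<in> V \<and>
        (\<exists>\<U>. finite \<U> \<and> card \<U> = N \<and> pairwise disjnt \<U> \<and> \<Union>\<U> = {x \<in> topspace X. p x \<in> V} \<and>
           (\<forall>U\<in>\<U>. openin X U \<and> homeomorphic_map (subtopology X U) (subtopology Y V) p)))"

definition covering_over :: "nat \<Rightarrow> 'a topology \<Rightarrow> 'b topology \<Rightarrow> ('a \<Rightarrow> 'b) \<Rightarrow> 'b set \<Rightarrow> bool" where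
  "covering_over N X Y p B \<longleftrightarrow>
     sheeted_covering N (subtopology X {x \<in> topspace X. p x \<in> B}) (subtopology Y B) p"

text \<open>
  A generically \<open>N\<close>-sheeted map branches over \<open>y\<close>: the finite fibre over \<open>y\<close> has fewer than \<open>N\<close>
  points because sheets come together, that is, \<open>p\<close> is not locally injective at some point of it.
\<close>

definition branches_over :: "nat \<Rightarrow> 'a topology \<Rightarrow> ('a \<Rightarrow> 'b) \<Rightarrow> 'b \<Rightarrow> bool" where
  "branches_over N X p y \<longleftrightarrow>
     (let F = {x \<in> topspace X. p x = y} in
        finite F \<and> F \<noteq> {} \<and> card F < N \<and>
        (\<exists>x\<in>F. \<forall>U. openin X U \<and> x \<in> U \<longrightarrow> \<not> inj_on p U))"

section \<open>Consistency checks\<close>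

lemma char_poly_higgs_field:
  assumes "n \<ge> 2"
  shows "char_poly (higgs_field n \<phi>) = monom 1 n - [:\<Prod>i=1..n. \<phi> i:]"
proof -
  obtain m where n: "n = Suc m" and m: "m \<ge> 1"
    using assms by (cases n) auto
  define A where "A = char_poly_matrix (higgs_field n \<phi>)"
  have A: "A \<in> carrier_mat n n"
    by (simp add: A_def higgs_field_def char_poly_matrix_def)
  have succ: "(j + 1) mod n = (if j = m then 0 else j + 1)" if "j < n" for j
    using that n by auto
  have entry: "A $$ (k, j) = (if k = j then [:0, 1:] else 0)
      - (if k = (if j = m then 0 else j + 1) then [:\<phi> (j + 1):] else 0)" if "k < n" "j < n" for k j
    unfolding succ[OF that(2), symmetric]
    using that by (auto simp: A_def higgs_field_def char_poly_matrix_def)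
  have dA: "mat_delete A 0 j \<in> carrier_mat m m" for j
    using A n by (metis diff_Suc_1 mat_delete_carrier)
  have del: "mat_delete A 0 j $$ (i, l) = A $$ (Suc i, if l < j then l else Suc l)"
    if "i < m" "l < m" for i j l
    using that A n by (simp add: mat_delete_def)
  have minor0: "det (mat_delete A 0 0) = [:0, 1:] ^ m"
  proof -
    have "det (mat_delete A 0 0) = prod_list (diag_mat (mat_delete A 0 0))"
      by (rule det_lower_triangular[OF _ dA]) (use n in \<open>auto simp: del entry\<close>)
    also have "\<dots> = (\<Prod>i = 0..<m. [:0, 1:])"
      unfolding prod_list_diag_prod
      by (rule prod.cong) (use n dA[of 0] in \<open>auto simp: del entry\<close>)
    finally show ?thesis by simp
  qed
  have minorm: "det (mat_delete A 0 m) = (\<Prod>i = 0..<m. - [:\<phi> (i + 1):])"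
  proof -
    have "det (mat_delete A 0 m) = prod_list (diag_mat (mat_delete A 0 m))"
      by (rule det_upper_triangular[OF _ dA])
        (use n dA[of m] in \<open>auto simp: upper_triangular_def del entry\<close>)
    also have "\<dots> = (\<Prod>i = 0..<m. - [:\<phi> (i + 1):])"
      unfolding prod_list_diag_prod
      by (rule prod.cong) (use n dA[of m] in \<open>auto simp: del entry\<close>)
    finally show ?thesis .
  qed
  have zero: "A $$ (0, j) = 0" if "j \<in> {..<n} - {0, m}" for j
    using that n by (auto simp: entry)
  have "char_poly (higgs_field n \<phi>) = det A"
    by (simp add: A_def char_poly_def)
  also have "\<dots> = (\<Sum>j<n. A $$ (0, j) * cofactor A 0 j)"
    by (rule laplace_expansion_row[OF A]) (use n in simp)
  also have "\<dots> = (\<Sum>j\<in>{0, m}. A $$ (0, j) * cofactor A 0 j)"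
    by (rule sum.mono_neutral_right) (use n zero in auto)
  also have "\<dots> = [:0, 1:] * [:0, 1:] ^ m + (- [:\<phi> n:]) * ((- 1) ^ m * (\<Prod>i = 0..<m. - [:\<phi> (i + 1):]))"
    using m n by (simp add: cofactor_def minor0 minorm entry)
  also have "(\<Prod>i = 0..<m. - [:\<phi> (i + 1):]) = (- 1) ^ m * [:\<Prod>i = 0..<m. \<phi> (i + 1):]"
  proof -
    have "(\<Prod>i = 0..<m. - [:\<phi> (i + 1):]) = (\<Prod>i = 0..<m. (- 1) * [:\<phi> (i + 1):])"
      by simp
    also have "\<dots> = (- 1) ^ m * (\<Prod>i = 0..<m. [:\<phi> (i + 1):])"
      unfolding prod.distrib by simp
    also have "(\<Prod>i = 0..<m. [:\<phi> (i + 1):]) = [:\<Prod>i = 0..<m. \<phi> (i + 1):]"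
      by (induction m) simp_all
    finally show ?thesis .
  qed
  also have "(\<Prod>i = 0..<m. \<phi> (i + 1)) = (\<Prod>i = 1..m. \<phi> i)"
    by (rule prod.reindex_bij_witness[of _ "\<lambda>i. i - 1" Suc]) auto
  also have "[:0, 1:] * [:0, 1:] ^ m
      + (- [:\<phi> n:]) * ((- 1) ^ m * ((- 1) ^ m * [:\<Prod>i = 1..m. \<phi> i:]))
      = monom 1 n - [:(\<Prod>i = 1..m. \<phi> i) * \<phi> n:]"
  proof -
    have "(- 1) ^ m * ((- 1) ^ m * p) = p" for p :: "complex poly poly"
      by simp
    moreover have "[:0, 1:] ^ n = (monom 1 n :: complex poly poly)"
      by (simp add: monom_altdef)
    ultimately show ?thesis
      using n by (simp add: mult.commute)
  qed
  also have "(\<Prod>i = 1..m. \<phi> i) * \<phi> n = (\<Prod>i=1..n. \<phi> i)"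
    using n by simp
  finally show ?thesis .
qed

lemma hitchin_eq_prod: "n \<ge> 2 \<Longrightarrow> hitchin n \<phi> = (\<Prod>i=1..n. \<phi> i)"
  by (simp add: hitchin_def char_poly_higgs_field)

lemma openin_quotient_topology:
  "openin (quotient_topology T R) W \<longleftrightarrow>
     W \<subseteq> topspace T // R \<and> openin T {z \<in> topspace T. R `` {z} \<in> W}"
proof -
  have "istopology (\<lambda>W. W \<subseteq> topspace T // R \<and> openin T {z \<in> topspace T. R `` {z} \<in> W})"
    unfolding istopology_def
  proof (intro conjI allI impI)
    fix \<K> assume K: "\<forall>W\<in>\<K>. W \<subseteq> topspace T // R \<and> openin T {z \<in> topspace T. R `` {z} \<in> W}"
    have "{z \<in> topspace T. R `` {z} \<in> \<Union>\<K>} = (\<Union>W\<in>\<K>. {z \<in> topspace T. R `` {z} \<in> W})"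
      by auto
    then show "openin T {z \<in> topspace T. R `` {z} \<in> \<Union>\<K>}"
      using K by auto
  next
    fix S W
    assume "S \<subseteq> topspace T // R \<and> openin T {z \<in> topspace T. R `` {z} \<in> S}"
      and "W \<subseteq> topspace T // R \<and> openin T {z \<in> topspace T. R `` {z} \<in> W}"
    moreover have "{z \<in> topspace T. R `` {z} \<in> S \<inter> W} =
        {z \<in> topspace T. R `` {z} \<in> S} \<inter> {z \<in> topspace T. R `` {z} \<in> W}"
      by auto
    ultimately show "openin T {z \<in> topspace T. R `` {z} \<in> S \<inter> W}"
      by auto
  qed auto
  then show ?thesis
    by (simp add: quotient_topology_def)
qed

lemma topspace_quotient_topology [simp]:
  "topspace (quotient_topology T R) = topspace T // R"
proof -
  have "openin (quotient_topology T R) (topspace T // R)"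
    unfolding openin_quotient_topology by (simp add: quotientI cong: conj_cong)
  then show ?thesis
    by (metis openin_quotient_topology openin_subset openin_topspace subset_antisym)
qed

lemma topspace_zariski [simp]: "topspace (zariski Z c) = Z"
proof -
  have "Z \<in> {{z \<in> Z. P (c z) \<noteq> 0} | P. P \<in> polyfun}"
    by (rule CollectI, rule exI[of _ "\<lambda>_. 1"]) (simp add: polyfun.const)
  then have "\<Union>{{z \<in> Z. P (c z) \<noteq> 0} | P. P \<in> polyfun} = Z"
    by blast
  then show ?thesis
    unfolding zariski_def topology_generated_by_topspace .
qed

lemma topspace_embedded_variety [simp]:
  "topspace (an (embedded_variety Z c)) = Z" "topspace (zar (embedded_variety Z c)) = Z"
  by (simp_all add: embedded_variety_def topspace_pullback_topology)

lemma topspace_quotient_variety [simp]: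
  "topspace (an (quotient_variety X R)) = topspace (an X) // R"
  "topspace (zar (quotient_variety X R)) = topspace (zar X) // R"
  by (simp_all add: quotient_variety_def)

lemma equiv_rescaling: "equiv (multicone I m) (rescaling I m)"
proof (rule equivI)
  show "refl_on (multicone I m) (rescaling I m)"
    by (auto simp: refl_on_def rescaling_def intro!: exI[of _ "\<lambda>_. 1"])
  show "sym (rescaling I m)"
  proof (rule symI)
    fix x y assume "(x, y) \<in> rescaling I m"
    then obtain a where "x \<in> multicone I m" "y \<in> multicone I m"
      "\<forall>i\<in>I. a i \<noteq> 0 \<and> y i = (\<lambda>k. a i * x i k)"
      by (auto simp: rescaling_def)
    then show "(y, x) \<in> rescaling I m"
      by (auto simp: rescaling_def intro!: exI[of _ "\<lambda>i. 1 / a i"])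
  qed
  show "trans (rescaling I m)"
  proof (rule transI)
    fix x y z assume "(x, y) \<in> rescaling I m" "(y, z) \<in> rescaling I m"
    then obtain a b where "x \<in> multicone I m" "z \<in> multicone I m"
      "\<forall>i\<in>I. a i \<noteq> 0 \<and> y i = (\<lambda>k. a i * x i k)" "\<forall>i\<in>I. b i \<noteq> 0 \<and> z i = (\<lambda>k. b i * y i k)"
      unfolding rescaling_def by blast
    then show "(x, z) \<in> rescaling I m"
      by (auto simp: rescaling_def mult.assoc intro!: exI[of _ "\<lambda>i. b i * a i"])
  qed
qed (auto simp: rescaling_def)

lemma equiv_taut_rescaling: "equiv (taut_pairs I m q) (taut_rescaling I m q)"
proof (rule equivI)
  note eq = equiv_rescaling[of I m, unfolded equiv_def]
  show "refl_on (taut_pairs I m q) (taut_rescaling I m q)"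
    using eq by (auto simp: refl_on_def taut_rescaling_def taut_pairs_def)
  show "sym (taut_rescaling I m q)"
    using eq by (auto simp: taut_rescaling_def sym_def)
  have "trans (rescaling I m)"
    using eq by blast
  then show "trans (taut_rescaling I m q)"
    unfolding trans_def taut_rescaling_def by blast
qed (auto simp: taut_rescaling_def)

lemma equiv_rep_iso: "equiv (stable_reps n d t) (rep_iso n d t)"
proof (rule equivI)
  have nxt: "nxt n i \<in> {1..n}" if "i \<in> {1..n}" for i
    using that by (auto simp: nxt_def)
  show "refl_on (stable_reps n d t) (rep_iso n d t)"
    by (auto simp: refl_on_def rep_iso_def intro!: exI[of _ "\<lambda>_. 1"])
  show "sym (rep_iso n d t)"
  proof (rule symI)
    fix \<phi> \<psi> assume "(\<phi>, \<psi>) \<in> rep_iso n d t"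
    then obtain g where st: "\<phi> \<in> stable_reps n d t" "\<psi> \<in> stable_reps n d t"
      and g: "\<forall>i\<in>{1..n}. g i \<noteq> 0 \<and> \<psi> i = Polynomial.smult (g (nxt n i) / g i) (\<phi> i)"
      by (auto simp: rep_iso_def)
    have "inverse (g i) \<noteq> 0 \<and> \<phi> i = Polynomial.smult (inverse (g (nxt n i)) / inverse (g i)) (\<psi> i)"
      if "i \<in> {1..n}" for i
      using g nxt[OF that] that by (simp add: field_simps)
    then show "(\<psi>, \<phi>) \<in> rep_iso n d t"
      using st unfolding rep_iso_def by (auto intro!: exI[of _ "\<lambda>i. inverse (g i)"])
  qed
  show "trans (rep_iso n d t)"
  proof (rule transI)
    fix \<phi> \<psi> \<chi> assume "(\<phi>, \<psi>) \<in> rep_iso n d t" "(\<psi>, \<chi>) \<in> rep_iso n d t"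
    then obtain g k where st: "\<phi> \<in> stable_reps n d t" "\<chi> \<in> stable_reps n d t"
      and g: "\<forall>i\<in>{1..n}. g i \<noteq> 0 \<and> \<psi> i = Polynomial.smult (g (nxt n i) / g i) (\<phi> i)"
      and k: "\<forall>i\<in>{1..n}. k i \<noteq> 0 \<and> \<chi> i = Polynomial.smult (k (nxt n i) / k i) (\<psi> i)"
      unfolding rep_iso_def by blast
    have "k i * g i \<noteq> 0 \<and> \<chi> i = Polynomial.smult ((k (nxt n i) * g (nxt n i)) / (k i * g i)) (\<phi> i)"
      if "i \<in> {1..n}" for i
      using g k that by simp
    then show "(\<phi>, \<chi>) \<in> rep_iso n d t"
      using st unfolding rep_iso_def by (auto intro!: exI[of _ "\<lambda>i. k i * g i"])
  qed
qed (auto simp: rep_iso_def)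

end

theory Submission
  imports Defs "HOL-Combinatorics.Multiset_Permutations" "HOL-Analysis.Product_Topology"
    "HOL-Analysis.Elementary_Metric_Spaces"
begin

text \<open>
  Let \<open>F\<close> be a \<open>\<Phi>\<close>-invariant subbundle of rank \<open>r\<close>. As \<open>\<Phi>\<close> raises the filtration by the
  \<open>U\<^sub>1 \<oplus> \<dots> \<oplus> U\<^sub>k\<close> by exactly one step below \<open>k = n\<close>, the last \<open>r\<close> rows of a matrix of \<open>F\<close> have nonzero
  determinant if \<open>\<phi>\<^sub>1, \<dots>, \<phi>\<^sub>n\<^sub>-\<^sub>1\<close> are nonzero; hence \<open>deg F\<close> is at most the degree of the sum of the
  last \<open>r\<close> summands, and the indexing together with coprimality gives stability.

  A point over \<open>s \<noteq> 0\<close> is a distribution of the zeros of \<open>s\<close> among the \<open>\<phi>\<^sub>i\<close>, since the scalars are absorbed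
  by the torus. Simple zeros depend continuously on \<open>s\<close>, so each distribution extends to a local
  section of \<open>h\<close>; if two zeros coincide, exchanging them identifies two distributions and destroys local
  injectivity. Finally \<open>\<phi> \<mapsto> ([\<phi>\<^sub>1], \<dots>, [\<phi>\<^sub>n\<^sub>-\<^sub>1], (coeff \<phi>\<^sub>n j \<cdot> \<phi>\<^sub>1 \<otimes> \<dots> \<otimes> \<phi>\<^sub>n\<^sub>-\<^sub>1)\<^sub>j)\<close> is invariant under the torus,
  and its inverse divides a coordinate of a tensor by a nonzero coordinate of the pure tensor.
\<close>

section \<open>Morphisms of varieties\<close>

hide_const (open) Module.smult

text \<open>A morphism of varieties carries three conditions here: analytic continuity, Zariski
  continuity and the pullback of regular functions. All three follow at once when the map is lifted
  to representatives and its coordinates are locally quotients of polynomials; the map is then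
  pushed down to classes by the universal property of the quotient.

  The multinomial coefficient may equal 1. Then all but one of the bundles in which the \<phi>_i
  take their values have degree 0, no two zeros can be given to different nodes, and there is no
  branching even at repeated zeros. Hence two cases: for \<eta> > 1 some distribution separates two
  given zeros, and for \<eta> = 1 there is a global inverse over all nonzero sections.

  Over 0 the last map vanishes, so its zeros may be prescribed at will. A representation there is
  approached along a one-parameter family that gives \<phi>_n a small nonzero value and moves all
  zeros apart; only finitely many parameters fail.

  Zeros at infinity are handled throughout by binary forms: a factor vanishing at infinity is a
  nonzero constant that still uses up one degree.\<close>

lemma continuous_map_localI:
  assumes "\<And>x. x \<in> topspace X \<Longrightarrow> \<exists>V. openin X V \<and> x \<in> V \<and> continuous_map (subtopology X V) Y f"
  shows "continuous_map X Y f"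
proof -
  obtain V where V: "\<And>x. x \<in> topspace X \<Longrightarrow> openin X (V x) \<and> x \<in> V x \<and> continuous_map (subtopology X (V x)) Y f"
    using assms by metis
  have "continuous_map X Y f"
    unfolding continuous_map_def
  proof (intro conjI allI impI)
    show "f \<in> topspace X \<rightarrow> topspace Y"
      using V by (fastforce simp: continuous_map_def Pi_iff)
    fix U assume U: "openin Y U"
    show "openin X {x \<in> topspace X. f x \<in> U}"
    proof (subst openin_subopen, intro ballI)
      fix x assume "x \<in> {x \<in> topspace X. f x \<in> U}"
      then have x: "x \<in> topspace X" "f x \<in> U" by auto
      have "openin (subtopology X (V x)) {y \<in> topspace (subtopology X (V x)). f y \<in> U}"
        using V[OF x(1)] U by (auto simp: continuous_map)
      then have "openin X {y \<in> topspace (subtopology X (V x)). f y \<in> U}"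
        using V[OF x(1)] openin_trans_full by blast
      then show "\<exists>T. openin X T \<and> x \<in> T \<and> T \<subseteq> {x \<in> topspace X. f x \<in> U}"
        using x V[OF x(1)] by (intro exI[of _ "{y \<in> topspace (subtopology X (V x)). f y \<in> U}"]) auto
    qed
  qed
  then show ?thesis .
qed

abbreviation cts :: "'a topology \<Rightarrow> ('a \<Rightarrow> 'b :: topological_space) \<Rightarrow> bool" where
  "cts X f \<equiv> continuous_map X euclidean f"

lemma subtopology_nested: "T \<subseteq> S \<Longrightarrow> subtopology (subtopology X S) T = subtopology X T"
  unfolding subtopology_subtopology by (simp add: Int_absorb1)

lemma continuous_map_mult:
  fixes f g :: "'a \<Rightarrow> 'b :: real_normed_algebra"
  shows "cts X f \<Longrightarrow> cts X g \<Longrightarrow>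
    cts X (\<lambda>x. f x * g x)"
  by (simp add: continuous_map_atin tendsto_mult)

lemma continuous_map_divide:
  fixes f g :: "'a \<Rightarrow> 'b :: real_normed_field"
  shows "cts X f \<Longrightarrow> cts X g \<Longrightarrow>
    (\<And>x. x \<in> topspace X \<Longrightarrow> g x \<noteq> 0) \<Longrightarrow> cts X (\<lambda>x. f x / g x)"
  by (simp add: continuous_map_atin tendsto_divide)

lemma continuous_map_product:
  fixes f :: "'i \<Rightarrow> 'a \<Rightarrow> 'b :: real_normed_field"
  assumes "\<And>i. i \<in> I \<Longrightarrow> cts X (f i)"
  shows "cts X (\<lambda>x. \<Prod>i\<in>I. f i x)"
  using assms by (induction I rule: infinite_finite_induct) (simp_all add: continuous_map_mult)

lemma continuous_map_coordinatewise:
  "cts X (f :: 'a \<Rightarrow> 'i \<Rightarrow> complex) \<longleftrightarrow> (\<forall>i. cts X (\<lambda>x. f x i))"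
  by (simp flip: euclidean_product_topology add: continuous_map_componentwise_UNIV)

lemma an_embedded: "an (embedded_variety Z c) = pullback_topology Z c euclidean"
  and zar_embedded: "zar (embedded_variety Z c) = zariski Z c"
  by (simp_all add: embedded_variety_def)

text \<open>The analytic topology is pulled back from the product topology along the coordinates, so
  continuity into the variety can be tested one coordinate at a time.\<close>

lemma continuous_map_into_embedded:
  "continuous_map X (an (embedded_variety Z c)) f \<longleftrightarrow>
    f ` topspace X \<subseteq> Z \<and> (\<forall>i. cts X (\<lambda>x. c (f x) i))" (is "?l = ?r")
proof
  assume l: ?l
  then have "f ` topspace X \<subseteq> Z"
    by (auto simp: an_embedded continuous_map_def topspace_pullback_topology)
  moreover have "cts (an (embedded_variety Z c)) c"
    unfolding an_embedded continuous_map by (auto simp: topspace_pullback_topology openin_pullback_topology)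
  then have "cts X (c \<circ> f)"
    using l continuous_map_compose by blast
  ultimately show ?r
    by (simp add: continuous_map_coordinatewise)
next
  assume r: ?r
  show ?l
    unfolding an_embedded
    by (rule continuous_map_pullback') (use r in \<open>auto simp: continuous_map_coordinatewise\<close>)
qed

lemma continuous_map_coord_embedded:
  "cts (an (embedded_variety Z c)) (\<lambda>z. c z i)"
  using continuous_map_into_embedded[of "an (embedded_variety Z c)" Z c id] by simp

lemma continuous_map_polyfun:
  assumes "P \<in> polyfun" "\<And>i. cts X (\<lambda>x. g x i)"
  shows "cts X (\<lambda>x. P (g x))"
  using assms(1) by induction (auto intro!: continuous_map_const[THEN iffD2] continuous_map_add continuous_map_mult assms(2))

section \<open>Zariski-local rational functions and the morphisms they define\<close>

lemma openin_zariski_basic: "P \<in> polyfun \<Longrightarrow> openin (zariski Z c) {z \<in> Z. P (c z) \<noteq> 0}"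
  unfolding zariski_def by (rule topology_generated_by_Basis) auto

text \<open>Polynomials are continuous, so the analytic topology refines the Zariski topology. This
  lets a formula valid on a Zariski-open chart prove analytic continuity near a point.\<close>

lemma openin_an_of_zariski:
  assumes "openin (zariski Z c) V"
  shows "openin (an (embedded_variety Z c)) V"
proof -
  have "continuous_map (an (embedded_variety Z c)) (zariski Z c) id"
    unfolding zariski_def continuous_on_generated_topo_iff
  proof (intro conjI allI impI)
    fix U assume "U \<in> {{z \<in> Z. P (c z) \<noteq> 0} | P. P \<in> polyfun}"
    then obtain P where P: "P \<in> polyfun" "U = {z \<in> Z. P (c z) \<noteq> 0}" by auto
    have "openin (an (embedded_variety Z c)) {z \<in> topspace (an (embedded_variety Z c)). P (c z) \<in> - {0}}"
      by (rule openin_continuous_map_preimage[OF continuous_map_polyfun[OF P(1) continuous_map_coord_embedded]])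
        auto
    then show "openin (an (embedded_variety Z c)) (id -` U \<inter> topspace (an (embedded_variety Z c)))"
      by (rule back_subst[of "openin _"]) (auto simp: P)
  next
    show "id ` topspace (an (embedded_variety Z c)) \<subseteq> \<Union> {{z \<in> Z. P (c z) \<noteq> 0} | P. P \<in> polyfun}"
      using topspace_zariski[of Z c] unfolding zariski_def topology_generated_by_topspace by simp
  qed
  from openin_continuous_map_preimage[OF this assms] show ?thesis
    by (rule back_subst[of "openin _"]) (use openin_subset[OF assms] in auto)
qed

text \<open>One quotient of polynomials serves the whole of \<open>V\<close>; regular functions are
  those for which this holds near each point.\<close>

definition rational_on :: "'a set \<Rightarrow> ('a \<Rightarrow> 'i \<Rightarrow> complex) \<Rightarrow> ('a \<Rightarrow> complex) \<Rightarrow> bool" where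
  "rational_on V c u \<longleftrightarrow>
     (\<exists>P\<in>polyfun. \<exists>Q\<in>polyfun. \<forall>z\<in>V. Q (c z) \<noteq> 0 \<and> u z = P (c z) / Q (c z))"

lemma rational_onI:
  assumes "P \<in> polyfun" "Q \<in> polyfun" "\<And>z. z \<in> V \<Longrightarrow> Q (c z) \<noteq> 0"
    "\<And>z. z \<in> V \<Longrightarrow> u z = P (c z) / Q (c z)"
  shows "rational_on V c u"
  unfolding rational_on_def by (rule bexI[OF _ assms(1)], rule bexI[OF _ assms(2)]) (simp add: assms)

lemma rational_onE:
  assumes "rational_on V c u"
  obtains P Q where "P \<in> polyfun" "Q \<in> polyfun" "\<And>z. z \<in> V \<Longrightarrow> Q (c z) \<noteq> 0"
    "\<And>z. z \<in> V \<Longrightarrow> u z = P (c z) / Q (c z)"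
  using assms unfolding rational_on_def by metis

lemma rational_on_polyfun: "P \<in> polyfun \<Longrightarrow> rational_on V c (\<lambda>z. P (c z))"
  by (rule rational_onI[OF _ polyfun.const[of 1]]) auto

lemma rational_on_const: "rational_on V c (\<lambda>_. a)"
  using rational_on_polyfun[OF polyfun.const] .

lemma rational_on_coord: "rational_on V c (\<lambda>z. c z i)"
  using rational_on_polyfun[OF polyfun.coord] .

lemma rational_on_subset: "rational_on V c u \<Longrightarrow> W \<subseteq> V \<Longrightarrow> rational_on W c u"
  unfolding rational_on_def by blast

lemma rational_on_cong: "(\<And>z. z \<in> V \<Longrightarrow> u z = v z) \<Longrightarrow> rational_on V c u \<longleftrightarrow> rational_on V c v"
  unfolding rational_on_def by auto

lemma
  assumes "rational_on V c u" "rational_on V c v"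
  shows rational_on_add: "rational_on V c (\<lambda>z. u z + v z)"
    and rational_on_mult: "rational_on V c (\<lambda>z. u z * v z)"
proof -
  obtain P Q where u: "P \<in> polyfun" "Q \<in> polyfun" "\<And>z. z \<in> V \<Longrightarrow> Q (c z) \<noteq> 0"
    "\<And>z. z \<in> V \<Longrightarrow> u z = P (c z) / Q (c z)" using assms(1) by (rule rational_onE) (rule that; assumption)
  obtain P' Q' where v: "P' \<in> polyfun" "Q' \<in> polyfun" "\<And>z. z \<in> V \<Longrightarrow> Q' (c z) \<noteq> 0"
    "\<And>z. z \<in> V \<Longrightarrow> v z = P' (c z) / Q' (c z)" using assms(2) by (rule rational_onE) (rule that; assumption)
  show "rational_on V c (\<lambda>z. u z + v z)"
    by (rule rational_onI[of "\<lambda>x. P x * Q' x + P' x * Q x" "\<lambda>x. Q x * Q' x"])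
      (simp_all add: polyfun.intros u v add_frac_eq)
  show "rational_on V c (\<lambda>z. u z * v z)"
    by (rule rational_onI[of "\<lambda>x. P x * P' x" "\<lambda>x. Q x * Q' x"])
      (simp_all add: polyfun.intros u v)
qed

lemma rational_on_divide:
  assumes "rational_on V c u" "rational_on V c v" and nz: "\<And>z. z \<in> V \<Longrightarrow> v z \<noteq> 0"
  shows "rational_on V c (\<lambda>z. u z / v z)"
proof -
  obtain P Q where v: "P \<in> polyfun" "Q \<in> polyfun" "\<And>z. z \<in> V \<Longrightarrow> Q (c z) \<noteq> 0"
    "\<And>z. z \<in> V \<Longrightarrow> v z = P (c z) / Q (c z)" using assms(2) by (rule rational_onE) (rule that; assumption)
  have "P (c z) \<noteq> 0" if "z \<in> V" for z using nz[OF that] v(4)[OF that] by auto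
  then have "rational_on V c (\<lambda>z. 1 / v z)"
    by (intro rational_onI[of Q P]) (simp_all add: v)
  from rational_on_mult[OF assms(1) this] show ?thesis by simp
qed

lemma rational_on_prod:
  "(\<And>i. i \<in> A \<Longrightarrow> rational_on V c (u i)) \<Longrightarrow> rational_on V c (\<lambda>z. \<Prod>i\<in>A. u i z)"
  by (induction A rule: infinite_finite_induct) (auto intro: rational_on_const rational_on_mult)

lemma rational_on_sum:
  "(\<And>i. i \<in> A \<Longrightarrow> rational_on V c (u i)) \<Longrightarrow> rational_on V c (\<lambda>z. \<Sum>i\<in>A. u i z)"
  by (induction A rule: infinite_finite_induct) (auto intro: rational_on_const rational_on_add)

lemma rational_on_compose:
  assumes "P \<in> polyfun" "\<And>i. rational_on V c (\<lambda>z. c' (f z) i)"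
  shows "rational_on V c (\<lambda>z. P (c' (f z)))"
  using assms(1)
proof induction
  case (const a)
  show ?case by (rule rational_on_const)
next
  case (coord i)
  show ?case by (rule assms(2))
next
  case (add P Q)
  then show ?case by (intro rational_on_add)
next
  case (mult P Q)
  then show ?case by (intro rational_on_mult)
qed

text \<open>On \<open>V\<close> the denominator has no zeros, so the locus is cut out by the
  numerator alone.\<close>

lemma openin_rational_nonzero:
  assumes "openin (zariski Z c) V" "rational_on V c u"
  shows "openin (zariski Z c) {z \<in> V. u z \<noteq> 0}"
proof -
  obtain P Q where PQ: "P \<in> polyfun" "Q \<in> polyfun" "\<And>z. z \<in> V \<Longrightarrow> Q (c z) \<noteq> 0"
    "\<And>z. z \<in> V \<Longrightarrow> u z = P (c z) / Q (c z)"
    using assms(2) by (rule rational_onE) (rule that; assumption)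
  have "{z \<in> V. u z \<noteq> 0} = V \<inter> {z \<in> Z. P (c z) \<noteq> 0}"
    using openin_subset[OF assms(1)] by (auto simp: PQ(3,4))
  then show ?thesis
    using openin_Int[OF assms(1) openin_zariski_basic[OF PQ(1)]] by simp
qed

lemma continuous_map_rational:
  assumes "rational_on V c u" "V \<subseteq> Z"
  shows "continuous_map (subtopology (an (embedded_variety Z c)) V) euclidean u"
proof -
  obtain P Q where PQ: "P \<in> polyfun" "Q \<in> polyfun" "\<And>z. z \<in> V \<Longrightarrow> Q (c z) \<noteq> 0"
    "\<And>z. z \<in> V \<Longrightarrow> u z = P (c z) / Q (c z)"
    using assms(1) by (rule rational_onE) (rule that; assumption)
  have "continuous_map (subtopology (an (embedded_variety Z c)) V) euclidean (\<lambda>z. P (c z) / Q (c z))"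
    by (rule continuous_map_divide[OF
          continuous_map_polyfun[OF PQ(1) continuous_map_from_subtopology[OF continuous_map_coord_embedded]]
          continuous_map_polyfun[OF PQ(2) continuous_map_from_subtopology[OF continuous_map_coord_embedded]]])
      (use PQ(3) in auto)
  then show ?thesis
    by (rule continuous_map_eq) (use PQ in auto)
qed

lemma reg_embedded:
  "u \<in> reg (embedded_variety Z c) W \<longleftrightarrow>
    (\<forall>w\<in>W. \<exists>V. openin (zariski Z c) V \<and> w \<in> V \<and> V \<subseteq> W \<and> rational_on V c u)"
  by (simp add: embedded_variety_def rational_on_def Bex_def)

text \<open>Substituting rational coordinates into a polynomial, or into a quotient with
  nonvanishing denominator, gives a rational function again. Zariski continuity and the pullback of
  regular functions follow from this, and analytic continuity from the continuity of
  quotients.\<close>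

lemma variety_morphism_embeddedI:
  assumes f: "f ` Z \<subseteq> Z'"
    and loc: "\<And>z. z \<in> Z \<Longrightarrow> \<exists>V. openin (zariski Z c) V \<and> z \<in> V \<and> (\<forall>i. rational_on V c (\<lambda>z. c' (f z) i))"
  shows "variety_morphism (embedded_variety Z c) (embedded_variety Z' c') f"
proof -
  have zc: "continuous_map (zariski Z c) (zariski Z' c') f"
    unfolding zariski_def[of Z'] continuous_on_generated_topo_iff
  proof (intro conjI allI impI)
    fix U assume "U \<in> {{z \<in> Z'. P (c' z) \<noteq> 0} | P. P \<in> polyfun}"
    then obtain P where P: "P \<in> polyfun" "U = {z \<in> Z'. P (c' z) \<noteq> 0}" by auto
    show "openin (zariski Z c) (f -` U \<inter> topspace (zariski Z c))"
    proof (subst openin_subopen, intro ballI)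
      fix z assume z: "z \<in> f -` U \<inter> topspace (zariski Z c)"
      then obtain V where V: "openin (zariski Z c) V" "z \<in> V" "\<forall>i. rational_on V c (\<lambda>z. c' (f z) i)"
        using loc by auto
      have "openin (zariski Z c) {z \<in> V. P (c' (f z)) \<noteq> 0}"
        using V by (intro openin_rational_nonzero rational_on_compose[of P V c c' f] P(1)) auto
      then show "\<exists>T. openin (zariski Z c) T \<and> z \<in> T \<and> T \<subseteq> f -` U \<inter> topspace (zariski Z c)"
        using z V(2) P(2) f openin_subset[OF V(1)] by (intro exI[of _ "{z \<in> V. P (c' (f z)) \<noteq> 0}"]) auto
    qed
  next
    show "f ` topspace (zariski Z c) \<subseteq> \<Union> {{z \<in> Z'. P (c' z) \<noteq> 0} | P. P \<in> polyfun}"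
      using f topspace_zariski[of Z' c'] unfolding zariski_def[of Z'] topology_generated_by_topspace by simp
  qed
  have ac: "continuous_map (an (embedded_variety Z c)) (an (embedded_variety Z' c')) f"
    unfolding continuous_map_into_embedded
  proof (intro conjI allI)
    show "f ` topspace (an (embedded_variety Z c)) \<subseteq> Z'" using f by simp
    fix i
    show "cts (an (embedded_variety Z c)) (\<lambda>x. c' (f x) i)"
    proof (rule continuous_map_localI)
      fix x assume "x \<in> topspace (an (embedded_variety Z c))"
      then obtain V where V: "openin (zariski Z c) V" "x \<in> V" "\<forall>i. rational_on V c (\<lambda>z. c' (f z) i)"
        using loc by auto
      have "continuous_map (subtopology (an (embedded_variety Z c)) V) euclidean (\<lambda>x. c' (f x) i)"
        using V(3) openin_subset[OF V(1)] by (intro continuous_map_rational) auto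
      then show "\<exists>V. openin (an (embedded_variety Z c)) V \<and> x \<in> V \<and>
          continuous_map (subtopology (an (embedded_variety Z c)) V) euclidean (\<lambda>x. c' (f x) i)"
        using openin_an_of_zariski[OF V(1)] V(2) by blast
    qed
  qed
  show ?thesis
    unfolding variety_morphism_def
  proof (intro conjI allI impI ballI ac)
    show "continuous_map (zar (embedded_variety Z c)) (zar (embedded_variety Z' c')) f"
      using zc by (simp add: zar_embedded)
    fix V u assume V: "openin (zar (embedded_variety Z' c')) V" and u: "u \<in> reg (embedded_variety Z' c') V"
    show "u \<circ> f \<in> reg (embedded_variety Z c) {x \<in> points (embedded_variety Z c). f x \<in> V}"
      unfolding reg_embedded
    proof
      fix w assume w: "w \<in> {x \<in> points (embedded_variety Z c). f x \<in> V}"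
      then obtain V1 where V1: "openin (zariski Z' c') V1" "f w \<in> V1" "V1 \<subseteq> V" "rational_on V1 c' u"
        using u unfolding reg_embedded by auto
      obtain P Q where PQ: "P \<in> polyfun" "Q \<in> polyfun" "\<And>z. z \<in> V1 \<Longrightarrow> Q (c' z) \<noteq> 0"
        "\<And>z. z \<in> V1 \<Longrightarrow> u z = P (c' z) / Q (c' z)"
        using V1(4) by (rule rational_onE) (rule that; assumption)
      obtain V2 where V2: "openin (zariski Z c) V2" "w \<in> V2" "\<forall>i. rational_on V2 c (\<lambda>z. c' (f z) i)"
        using loc w by auto
      define V3 where "V3 = V2 \<inter> {z \<in> Z. f z \<in> V1}"
      have o: "openin (zariski Z c) V3"
        unfolding V3_def using V2 openin_continuous_map_preimage[OF zc V1(1)] by (intro openin_Int) auto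
      have r: "rational_on V3 c (\<lambda>z. c' (f z) i)" for i
        using V2(3) by (rule_tac rational_on_subset[of V2]) (auto simp: V3_def)
      have "rational_on V3 c (\<lambda>z. P (c' (f z)) / Q (c' (f z)))"
        by (rule rational_on_divide[OF rational_on_compose[of P V3 c c' f, OF PQ(1) r]
              rational_on_compose[of Q V3 c c' f, OF PQ(2) r]]) (auto simp: V3_def PQ(3))
      also have "?this \<longleftrightarrow> rational_on V3 c (u \<circ> f)"
        by (rule rational_on_cong) (auto simp: V3_def PQ(4))
      finally have "rational_on V3 c (u \<circ> f)" .
      then show "\<exists>V'. openin (zariski Z c) V' \<and> w \<in> V' \<and>
            V' \<subseteq> {x \<in> points (embedded_variety Z c). f x \<in> V} \<and> rational_on V' c (u \<circ> f)"
        using o V1(2,3) V2(2) w by (intro exI[of _ V3]) (auto simp: V3_def)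
    qed
  qed
qed

lemma variety_morphism_rationalI:
  assumes "f ` Z \<subseteq> Z'" "\<And>i. rational_on Z c (\<lambda>z. c' (f z) i)"
  shows "variety_morphism (embedded_variety Z c) (embedded_variety Z' c') f"
  using assms openin_topspace[of "zariski Z c"]
  by (intro variety_morphism_embeddedI) (auto intro!: exI[of _ Z])

section \<open>Gluing of regular functions, quotients and subvarieties\<close>

lemma reg_embedded_cong:
  assumes "\<And>z. z \<in> W \<Longrightarrow> u z = v z"
  shows "u \<in> reg (embedded_variety Z c) W \<longleftrightarrow> v \<in> reg (embedded_variety Z c) W"
proof -
  have "rational_on V c u \<longleftrightarrow> rational_on V c v" if "V \<subseteq> W" for V
    using that assms by (intro rational_on_cong) auto
  then show ?thesis
    unfolding reg_embedded by (simp cong: conj_cong)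
qed

text \<open>The gluing part of the sheaf axiom. It serves maps into a \<open>subvariety\<close>,
  whose regular functions are only locally restrictions of ambient ones.\<close>

definition local_functions :: "'a variety \<Rightarrow> bool" where
  "local_functions X \<longleftrightarrow> (\<forall>W u. openin (zar X) W \<longrightarrow>
     (\<forall>w\<in>W. \<exists>V v. openin (zar X) V \<and> w \<in> V \<and> v \<in> reg X V \<and> (\<forall>x\<in>V \<inter> W. u x = v x)) \<longrightarrow> u \<in> reg X W)"

lemma local_functions_embedded: "local_functions (embedded_variety Z c)"
  unfolding local_functions_def
proof (intro allI impI)
  fix W u assume W: "openin (zar (embedded_variety Z c)) W"
    and *: "\<forall>w\<in>W. \<exists>V v. openin (zar (embedded_variety Z c)) V \<and> w \<in> V \<and> v \<in> reg (embedded_variety Z c) V \<and> (\<forall>x\<in>V \<inter> W. u x = v x)"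
  show "u \<in> reg (embedded_variety Z c) W"
    unfolding reg_embedded
  proof
    fix w assume w: "w \<in> W"
    then obtain V v where V: "w \<in> V" "v \<in> reg (embedded_variety Z c) V" "\<forall>x\<in>V \<inter> W. u x = v x"
      using * by blast
    then obtain V' where V': "openin (zariski Z c) V'" "w \<in> V'" "V' \<subseteq> V" "rational_on V' c v"
      unfolding reg_embedded by blast
    have "rational_on (V' \<inter> W) c v"
      using V'(4) by (rule rational_on_subset) auto
    then have "rational_on (V' \<inter> W) c u"
      using V V' by (subst rational_on_cong[of _ _ v]) auto
    then show "\<exists>V. openin (zariski Z c) V \<and> w \<in> V \<and> V \<subseteq> W \<and> rational_on V c u"
      using V' W w by (intro exI[of _ "V' \<inter> W"]) (auto simp: zar_embedded)
  qed
qed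

lemma zar_quotient: "zar (quotient_variety X R) = quotient_topology (zar X) R"
  and an_quotient: "an (quotient_variety X R) = quotient_topology (an X) R"
  and reg_quotient: "u \<in> reg (quotient_variety X R) W \<longleftrightarrow>
    (\<lambda>z. u (R `` {z})) \<in> reg X {z \<in> points X. R `` {z} \<in> W}"
  by (simp_all add: quotient_variety_def)

lemma local_functions_quotient:
  assumes "local_functions X"
  shows "local_functions (quotient_variety X R)"
  unfolding local_functions_def
proof (intro allI impI)
  fix W u assume W: "openin (zar (quotient_variety X R)) W"
    and *: "\<forall>w\<in>W. \<exists>V v. openin (zar (quotient_variety X R)) V \<and> w \<in> V \<and> v \<in> reg (quotient_variety X R) V \<and> (\<forall>x\<in>V \<inter> W. u x = v x)"
  let ?pre = "\<lambda>W. {z \<in> points X. R `` {z} \<in> W}"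
  have "(\<lambda>z. u (R `` {z})) \<in> reg X (?pre W)"
  proof (rule assms[unfolded local_functions_def, rule_format])
    show "openin (zar X) (?pre W)"
      using W by (simp add: zar_quotient openin_quotient_topology)
    fix w assume "w \<in> ?pre W"
    then obtain V v where V: "openin (zar (quotient_variety X R)) V" "R `` {w} \<in> V" "v \<in> reg (quotient_variety X R) V"
       "\<forall>x\<in>V \<inter> W. u x = v x" "w \<in> points X"
      using * by blast
    then show "\<exists>V v. openin (zar X) V \<and> w \<in> V \<and> v \<in> reg X V \<and> (\<forall>x\<in>V \<inter> ?pre W. u (R `` {x}) = v x)"
      by (intro exI[of _ "?pre V"] exI[of _ "\<lambda>z. v (R `` {z})"])
        (auto simp: zar_quotient openin_quotient_topology reg_quotient)
  qed
  then show "u \<in> reg (quotient_variety X R) W"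
    by (simp add: reg_quotient)
qed

lemma continuous_map_to_quotient:
  assumes "continuous_map X T f"
  shows "continuous_map X (quotient_topology T R) (\<lambda>x. R `` {f x})"
  unfolding continuous_map_def
proof (intro conjI allI impI)
  show "(\<lambda>x. R `` {f x}) \<in> topspace X \<rightarrow> topspace (quotient_topology T R)"
    using assms by (auto simp: continuous_map_def intro: quotientI)
  fix U assume "openin (quotient_topology T R) U"
  then have "openin X {x \<in> topspace X. f x \<in> {z \<in> topspace T. R `` {z} \<in> U}}"
    using assms unfolding openin_quotient_topology by (intro openin_continuous_map_preimage[OF assms]) auto
  then show "openin X {x \<in> topspace X. R `` {f x} \<in> U}"
    by (rule back_subst[of "openin X"]) (use assms in \<open>auto simp: continuous_map_def Pi_iff\<close>)
qed

lemma continuous_map_from_quotient: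
  assumes "continuous_map T Y f" "\<And>z. z \<in> topspace T \<Longrightarrow> F (R `` {z}) = f z"
  shows "continuous_map (quotient_topology T R) Y F"
  unfolding continuous_map_def
proof (intro conjI allI impI)
  show "F \<in> topspace (quotient_topology T R) \<rightarrow> topspace Y"
    using assms by (auto simp: continuous_map_def quotient_def Pi_iff)
  fix U assume "openin Y U"
  then have "openin T {z \<in> topspace T. f z \<in> U}"
    using assms(1) openin_continuous_map_preimage by blast
  moreover have "{z \<in> topspace T. R `` {z} \<in> {C \<in> topspace T // R. F C \<in> U}} = {z \<in> topspace T. f z \<in> U}"
    using assms(2) by (auto simp: quotientI)
  ultimately show "openin (quotient_topology T R) {x \<in> topspace (quotient_topology T R). F x \<in> U}"
    unfolding openin_quotient_topology by auto
qed

text \<open>Open sets and regular functions of the quotient are defined through their pullbacks to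
  representatives, so each condition on \<open>F\<close> becomes the same condition on
  \<open>f\<close>.\<close>

lemma variety_morphism_from_quotient:
  assumes f: "variety_morphism (embedded_variety Z c) Y f"
    and F: "\<And>z. z \<in> Z \<Longrightarrow> F (R `` {z}) = f z"
  shows "variety_morphism (quotient_variety (embedded_variety Z c) R) Y F"
  unfolding variety_morphism_def
proof (intro conjI allI impI ballI)
  show "continuous_map (an (quotient_variety (embedded_variety Z c) R)) (an Y) F"
    unfolding an_quotient using f F
    by (intro continuous_map_from_quotient[where f = f]) (auto simp: variety_morphism_def)
  show "continuous_map (zar (quotient_variety (embedded_variety Z c) R)) (zar Y) F"
    unfolding zar_quotient using f F
    by (intro continuous_map_from_quotient[where f = f]) (auto simp: variety_morphism_def)
  fix V u assume V: "openin (zar Y) V" "u \<in> reg Y V"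
  have eq: "{z \<in> Z. R `` {z} \<in> Z // R \<and> F (R `` {z}) \<in> V} = {x \<in> Z. f x \<in> V}"
    using F by (auto simp: quotientI)
  have "u \<circ> f \<in> reg (embedded_variety Z c) {x \<in> Z. f x \<in> V}"
    using f V by (simp add: variety_morphism_def)
  then have "(\<lambda>z. (u \<circ> F) (R `` {z})) \<in> reg (embedded_variety Z c) {x \<in> Z. f x \<in> V}"
    by (subst reg_embedded_cong[of _ _ "u \<circ> f"]) (auto simp: F)
  then show "u \<circ> F \<in> reg (quotient_variety (embedded_variety Z c) R)
      {x \<in> points (quotient_variety (embedded_variety Z c) R). F x \<in> V}"
    by (simp add: reg_quotient eq)
qed

lemma variety_morphism_to_quotient:
  assumes f: "variety_morphism X Y f"
  shows "variety_morphism X (quotient_variety Y R) (\<lambda>x. R `` {f x})"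
  unfolding variety_morphism_def
proof (intro conjI allI impI ballI)
  show "continuous_map (an X) (an (quotient_variety Y R)) (\<lambda>x. R `` {f x})"
    "continuous_map (zar X) (zar (quotient_variety Y R)) (\<lambda>x. R `` {f x})"
    using f unfolding an_quotient zar_quotient
    by (auto intro!: continuous_map_to_quotient simp: variety_morphism_def)
  have fp: "f x \<in> points Y" if "x \<in> points X" for x
    using f that by (auto simp: variety_morphism_def continuous_map_def)
  fix V u assume V: "openin (zar (quotient_variety Y R)) V" "u \<in> reg (quotient_variety Y R) V"
  then have "openin (zar Y) {z \<in> points Y. R `` {z} \<in> V}"
      "(\<lambda>z. u (R `` {z})) \<in> reg Y {z \<in> points Y. R `` {z} \<in> V}"
    by (auto simp: zar_quotient openin_quotient_topology reg_quotient)
  then have "(\<lambda>z. u (R `` {z})) \<circ> f \<in> reg X {x \<in> points X. f x \<in> {z \<in> points Y. R `` {z} \<in> V}}"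
    using f unfolding variety_morphism_def by blast
  moreover have "{x \<in> points X. f x \<in> {z \<in> points Y. R `` {z} \<in> V}} = {x \<in> points X. R `` {f x} \<in> V}"
    using fp by auto
  ultimately show "u \<circ> (\<lambda>x. R `` {f x}) \<in> reg X {x \<in> points X. R `` {f x} \<in> V}"
    by (simp add: comp_def)
qed

lemma variety_morphism_quotientI:
  assumes "variety_morphism (embedded_variety Z c) Y f" "\<And>z. z \<in> Z \<Longrightarrow> F (R `` {z}) = S `` {f z}"
  shows "variety_morphism (quotient_variety (embedded_variety Z c) R) (quotient_variety Y S) F"
  by (rule variety_morphism_from_quotient[OF variety_morphism_to_quotient[OF assms(1)]]) (rule assms(2))

lemma variety_morphism_from_subvariety:
  assumes "variety_morphism X Y f"
  shows "variety_morphism (subvariety X A) Y f"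
  unfolding variety_morphism_def
proof (intro conjI allI impI ballI)
  show "continuous_map (an (subvariety X A)) (an Y) f" "continuous_map (zar (subvariety X A)) (zar Y) f"
    using assms by (auto simp: variety_morphism_def subvariety_def intro: continuous_map_from_subtopology)
  fix V u assume V: "openin (zar Y) V" "u \<in> reg Y V"
  have "openin (zar X) {x \<in> points X. f x \<in> V}" "u \<circ> f \<in> reg X {x \<in> points X. f x \<in> V}"
    using assms V by (auto simp: variety_morphism_def intro: openin_continuous_map_preimage)
  then show "u \<circ> f \<in> reg (subvariety X A) {x \<in> points (subvariety X A). f x \<in> V}"
    by (fastforce simp: subvariety_def)
qed

text \<open>A regular function on the subvariety is near each point the restriction of an ambient
  one; the local pullbacks are regular by \<open>f\<close> and are glued by
  \<open>sheaf\<close>.\<close>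

lemma variety_morphism_into_subvariety:
  assumes f: "variety_morphism Y X f" and A: "f ` points Y \<subseteq> A" "f ` topspace (an Y) \<subseteq> A"
    and sheaf: "local_functions Y"
  shows "variety_morphism Y (subvariety X A) f"
  unfolding variety_morphism_def
proof (intro conjI allI impI ballI)
  show "continuous_map (an Y) (an (subvariety X A)) f"
    and zc: "continuous_map (zar Y) (zar (subvariety X A)) f"
    using f A by (auto simp: variety_morphism_def subvariety_def continuous_map_in_subtopology)
  fix V u assume V: "openin (zar (subvariety X A)) V" "u \<in> reg (subvariety X A) V"
  show "u \<circ> f \<in> reg Y {y \<in> points Y. f y \<in> V}"
  proof (rule sheaf[unfolded local_functions_def, rule_format])
    show "openin (zar Y) {y \<in> points Y. f y \<in> V}"
      using zc V(1) by (rule openin_continuous_map_preimage)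
    fix w assume "w \<in> {y \<in> points Y. f y \<in> V}"
    then obtain V1 v where V1: "openin (zar X) V1" "f w \<in> V1" "v \<in> reg X V1" "\<forall>x\<in>V1 \<inter> V. u x = v x" "w \<in> points Y"
      using V(2) by (auto simp: subvariety_def)
    then show "\<exists>V' v'. openin (zar Y) V' \<and> w \<in> V' \<and> v' \<in> reg Y V' \<and>
        (\<forall>x\<in>V' \<inter> {y \<in> points Y. f y \<in> V}. (u \<circ> f) x = v' x)"
      using f
      by (intro exI[of _ "{y \<in> points Y. f y \<in> V1}"] exI[of _ "v \<circ> f"])
        (auto simp: variety_morphism_def intro: openin_continuous_map_preimage)
  qed
qed

section \<open>Stability\<close>

lemma mult_delta:
  fixes q :: "'a :: semiring_1"
  shows "q * (if P then 1 else 0) = (if P then q else 0)" "(if P then 1 else 0) * q = (if P then q else 0)"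
  by simp_all

lemma H0_0 [simp]: "0 \<in> H0 m"
  by (simp add: H0_def)

lemma form_eval_affine:
  assumes "s \<in> H0 m"
  shows "form_eval m s x 1 = poly s x"
proof (cases "s = 0")
  case False
  then have "degree s \<le> nat m" using assms by (auto simp: H0_def)
  then show ?thesis
    unfolding form_eval_def poly_altdef
    by (simp, intro sum.mono_neutral_right) (auto simp: coeff_eq_0)
qed (simp add: form_eval_def)

lemma higgs_field_carrier: "higgs_field n \<phi> \<in> carrier_mat n n"
  by (simp add: higgs_field_def)

text \<open>Entry 0, left out by \<open>k \<ge> 1\<close>, is the only one that involves the arrow
  from node \<open>n\<close> back to node 1. All other entries are shifted by one place.\<close>

lemma higgs_field_mult_vec:
  assumes "n \<ge> 2" "w \<in> carrier_vec n" "k < n" "k \<ge> 1"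
  shows "(higgs_field n \<phi> *\<^sub>v w) $ k = \<phi> k * w $ (k - 1)"
proof -
  have "(higgs_field n \<phi> *\<^sub>v w) $ k = (\<Sum>j<n. (if k = (j + 1) mod n then \<phi> (j + 1) else 0) * w $ j)"
    using assms by (simp add: higgs_field_def scalar_prod_def lessThan_atLeast0)
  also have "\<dots> = (\<Sum>j\<in>{k - 1}. (if k = (j + 1) mod n then \<phi> (j + 1) else 0) * w $ j)"
  proof (rule sum.mono_neutral_right)
    show "\<forall>j\<in>{..<n} - {k - 1}. (if k = (j + 1) mod n then \<phi> (j + 1) else 0) * w $ j = 0"
    proof
      fix j assume j: "j \<in> {..<n} - {k - 1}"
      then have "j + 1 \<le> n" by auto
      then have "(j + 1) mod n = j + 1 \<or> (j + 1) mod n = 0" by (cases "j + 1 = n") auto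
      then show "(if k = (j + 1) mod n then \<phi> (j + 1) else 0) * w $ j = 0"
        using assms j by auto
    qed
  qed (use assms in auto)
  also have "\<dots> = \<phi> k * w $ (k - 1)"
    using assms by simp
  finally show ?thesis .
qed

text \<open>If \<open>\<phi> i\<close> vanishes, no arrow leaves the first \<open>i\<close>
  summands, so their sum is invariant: \<open>S\<close> is its inclusion and \<open>\<Psi>\<close>
  the restricted field. Stability makes its slope smaller than that of the whole bundle, while the
  indexing bounds the slope of the complementary tail from above by the same value. Adding degrees
  gives a total degree smaller than itself.\<close>

lemma stable_reps_nonzero:
  assumes n: "n \<ge> 2" and ind: "indexed_to_vanish_last n d"
    and st: "\<phi> \<in> stable_reps n d t" and i: "i \<in> {1..<n}"
  shows "\<phi> i \<noteq> 0"
proof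
  assume z: "\<phi> i = 0"
  define S :: "complex poly mat" where "S = mat n i (\<lambda>(k, j). if k = j then 1 else 0)"
  define a where "a = (\<lambda>j. d (j + 1))"
  define \<Psi> where "\<Psi> = mat i i (\<lambda>(k, j). if k = j + 1 then \<phi> (j + 1) else 0)"
  have rep: "\<phi> j \<in> H0 (map_degree n d t j)" if "j \<in> {1..n}" for j
    using st that by (auto simp: stable_reps_def reps_def)
  have sub: "is_subbundle n d i a S"
    unfolding is_subbundle_def
  proof (intro conjI allI impI ballI)
    show "S \<in> carrier_mat n i" by (simp add: S_def)
    fix k j assume "k < n" "j < i"
    then show "S $$ (k, j) \<in> H0 (d (k + 1) - a j)"
      by (auto simp: S_def a_def H0_def)
  next
    fix x y :: complex and v :: "complex vec"
    assume v: "v \<in> carrier_vec i"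
    let ?M = "mat n i (\<lambda>(k, j). form_eval (d (k + 1) - a j) (S $$ (k, j)) x y)"
    assume 0: "?M *\<^sub>v v = 0\<^sub>v n"
    show "v = 0\<^sub>v i"
    proof (rule eq_vecI)
      fix k assume "k < dim_vec (0\<^sub>v i :: complex vec)"
      then have k: "k < i" by simp
      have "(?M *\<^sub>v v) $ k = (\<Sum>j<i. (if k = j then 1 else 0) * v $ j)"
        using k i v
        by (auto simp: scalar_prod_def lessThan_atLeast0 S_def form_eval_def a_def intro!: sum.cong)
      also have "\<dots> = (\<Sum>j<i. if k = j then v $ j else 0)"
        by (rule sum.cong) auto
      also have "\<dots> = v $ k" using k by simp
      finally show "v $ k = 0\<^sub>v i $ k" using 0 k i by simp
    qed (use v in simp)
  qed
  have inv: "higgs_invariant n t \<phi> i a S"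
    unfolding higgs_invariant_def
  proof (intro bexI conjI allI impI)
    show "\<Psi> \<in> carrier_mat i i" by (simp add: \<Psi>_def)
    fix k j assume kj: "k < i" "j < i"
    show "\<Psi> $$ (k, j) \<in> H0 (a k - a j + t)"
      using rep[of "j + 1"] kj i by (auto simp: \<Psi>_def a_def map_degree_def nxt_def)
  next
    show "higgs_field n \<phi> * S = S * \<Psi>"
    proof (rule eq_matI)
      fix k j assume "k < dim_row (S * \<Psi>)" "j < dim_col (S * \<Psi>)"
      then have kj: "k < n" "j < i" by (auto simp: S_def \<Psi>_def)
      have l: "(higgs_field n \<phi> * S) $$ (k, j) = (\<Sum>l<n. if l = j then higgs_field n \<phi> $$ (k, l) else 0)"
        using kj i by (simp add: scalar_prod_def higgs_field_def S_def lessThan_atLeast0 mult_delta)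
      have r: "(S * \<Psi>) $$ (k, j) = (\<Sum>l<i. if l = k then \<Psi> $$ (l, j) else 0)"
        using kj i by (simp add: scalar_prod_def \<Psi>_def S_def lessThan_atLeast0 mult_delta)
      show "(higgs_field n \<phi> * S) $$ (k, j) = (S * \<Psi>) $$ (k, j)"
        unfolding l r using kj i z
        by (auto simp: higgs_field_def \<Psi>_def not_less le_Suc_eq)
    qed (auto simp: higgs_field_def S_def \<Psi>_def)
  qed
  have A: "real_of_int (\<Sum>j<i. a j) / real i < real_of_int (\<Sum>i=1..n. d i) / real n"
  proof -
    have "0 < i" "i < n" using i by auto
    then show ?thesis
      using st sub inv unfolding stable_reps_def mem_Collect_eq by blast
  qed
  have B: "real_of_int (\<Sum>j=i+1..n. d j) / real (n - i) \<le> real_of_int (\<Sum>i=1..n. d i) / real n"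
    using ind i unfolding indexed_to_vanish_last_def by (auto dest!: bspec[of _ _ "i + 1"])
  have "(\<Sum>j<i. a j) = (\<Sum>j=1..i. d j)"
    unfolding a_def by (rule sum.reindex_bij_witness[of _ "\<lambda>j. j - 1" Suc]) auto
  moreover have "(\<Sum>j=1..n. d j) = (\<Sum>j=1..i. d j) + (\<Sum>j=i+1..n. d j)"
    using i by (subst sum.union_disjoint[symmetric]) (auto intro!: sum.cong)
  ultimately have C: "real_of_int (\<Sum>j=1..n. d j) = real_of_int (\<Sum>j<i. a j) + real_of_int (\<Sum>j=i+1..n. d j)"
    by simp
  define \<mu> where "\<mu> = real_of_int (\<Sum>i=1..n. d i) / real n"
  have "real_of_int (\<Sum>j<i. a j) < \<mu> * real i" "real_of_int (\<Sum>j=i+1..n. d j) \<le> \<mu> * real (n - i)"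
    using A B i unfolding \<mu>_def[symmetric]
    by (simp_all add: pos_divide_less_eq pos_divide_le_eq del: of_int_sum of_nat_diff)
  then have "real_of_int (\<Sum>j=1..n. d j) < \<mu> * real n"
    unfolding C using i by (simp add: of_nat_diff algebra_simps del: of_int_sum)
  then show False
    using n by (simp add: \<mu>_def)
qed

text \<open>A nonzero polynomial vector is nonzero at some finite point \<open>z\<close>, and its
  value there would lie in the kernel of the map on the fibre at \<open>(z, 1)\<close>.\<close>

lemma subbundle_generically_injective:
  assumes sub: "is_subbundle n d r a S" and v: "v \<in> carrier_vec r" "S *\<^sub>v v = 0\<^sub>v n"
  shows "v = 0\<^sub>v r"
proof (rule ccontr)
  assume "v \<noteq> 0\<^sub>v r"
  then obtain l where l: "l < r" "v $ l \<noteq> 0"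
    using v by (metis carrier_vecD eq_vecI index_zero_vec)
  then obtain z where z: "poly (v $ l) z \<noteq> 0"
    by (metis poly_all_0_iff_0)
  have S: "S \<in> carrier_mat n r" and h: "\<And>k j. k < n \<Longrightarrow> j < r \<Longrightarrow> S $$ (k, j) \<in> H0 (d (k + 1) - a j)"
    using sub by (auto simp: is_subbundle_def)
  let ?M = "mat n r (\<lambda>(k, j). form_eval (d (k + 1) - a j) (S $$ (k, j)) z 1)"
  let ?u = "vec r (\<lambda>j. poly (v $ j) z)"
  have "?M *\<^sub>v ?u = 0\<^sub>v n"
  proof (rule eq_vecI)
    fix k assume "k < dim_vec (0\<^sub>v n :: complex vec)"
    then have k: "k < n" by simp
    have "(?M *\<^sub>v ?u) $ k = (\<Sum>j<r. poly (S $$ (k, j)) z * poly (v $ j) z)"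
      using k form_eval_affine[OF h[OF k]] by (simp add: scalar_prod_def lessThan_atLeast0)
    also have "\<dots> = poly ((S *\<^sub>v v) $ k) z"
      using k S v(1) by (simp add: scalar_prod_def poly_sum lessThan_atLeast0)
    finally show "(?M *\<^sub>v ?u) $ k = 0\<^sub>v n $ k" using v k by simp
  qed simp
  moreover have "\<forall>x y. (x, y) \<noteq> (0, 0) \<longrightarrow> (\<forall>v \<in> carrier_vec r.
      mat n r (\<lambda>(k, j). form_eval (d (k + 1) - a j) (S $$ (k, j)) x y) *\<^sub>v v = 0\<^sub>v n \<longrightarrow> v = 0\<^sub>v r)"
    using sub unfolding is_subbundle_def by (elim conjE)
  ultimately have "?u = 0\<^sub>v r"
    by (elim allE[of _ z] allE[of _ "1::complex"]) auto
  then show False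
    using l z by (metis index_vec index_zero_vec(1))
qed

text \<open>
  The filtration by \<open>U\<^sub>1 \<oplus> \<dots> \<oplus> U\<^sub>k\<close> is moved up by exactly one step by \<open>\<Phi>\<close> as long as \<open>k < n\<close>, so
  a vector of \<open>F\<close> whose last \<open>r\<close> entries vanish would have \<open>r + 1\<close> linearly independent iterates.
\<close>

lemma bottom_minor_nonzero:
  assumes n: "n \<ge> 2" and nz: "\<And>i. i \<in> {1..<n} \<Longrightarrow> \<phi> i \<noteq> 0"
    and r: "0 < r" "r < n" and sub: "is_subbundle n d r a S" and inv: "higgs_invariant n t \<phi> r a S"
  shows "det (mat r r (\<lambda>(k, j). S $$ (n - r + k, j))) \<noteq> 0"
proof
  let ?B = "mat r r (\<lambda>(k, j). S $$ (n - r + k, j))"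
  assume "det ?B = 0"
  then obtain v where v: "v \<in> carrier_vec r" "v \<noteq> 0\<^sub>v r" "?B *\<^sub>v v = 0\<^sub>v r"
    using det_0_iff_vec_prod_zero[of ?B r] by auto
  have S: "S \<in> carrier_mat n r" using sub by (simp add: is_subbundle_def)
  obtain \<Psi> where \<Psi>: "\<Psi> \<in> carrier_mat r r" "higgs_field n \<phi> * S = S * \<Psi>"
    using inv by (auto simp: higgs_invariant_def)
  define vs where "vs = rec_nat v (\<lambda>_ u. \<Psi> *\<^sub>v u)"
  have vs0: "vs 0 = v" and vsS: "vs (Suc j) = \<Psi> *\<^sub>v vs j" for j
    by (simp_all add: vs_def)
  have vsc: "vs j \<in> carrier_vec r" for j
    by (induction j) (use v \<Psi> in \<open>auto simp: vs0 vsS\<close>)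
  define ws where "ws j = S *\<^sub>v vs j" for j
  have wsc: "ws j \<in> carrier_vec n" for j
    using S vsc by (simp add: ws_def)
  have wsS: "ws (Suc j) = higgs_field n \<phi> *\<^sub>v ws j" for j
    unfolding ws_def vsS using S \<Psi> vsc[of j] higgs_field_carrier
    by (metis assoc_mult_mat_vec)
  have w0: "ws 0 \<noteq> 0\<^sub>v n"
    using subbundle_generically_injective[OF sub v(1)] v(2) by (auto simp: ws_def vs0)
  have ne: "{k. k < n \<and> ws 0 $ k \<noteq> 0} \<noteq> {}"
  proof
    assume "{k. k < n \<and> ws 0 $ k \<noteq> 0} = {}"
    then have "ws 0 = 0\<^sub>v n"
      using wsc[of 0] by (intro eq_vecI) auto
    with w0 show False by simp
  qed
  \<comment> \<open>\<open>K\<close> is the position of the last nonzero entry of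
    \<open>ws 0\<close>. Since the last \<open>r\<close> entries vanish, \<open>K + r < n\<close>,
    so this entry can be pushed on \<open>r\<close> times without leaving the vector.\<close>
  define K where "K = Max {k. k < n \<and> ws 0 $ k \<noteq> 0}"
  have K: "K < n" "ws 0 $ K \<noteq> 0"
    using Max_in[OF _ ne] by (auto simp: K_def)
  have Kmax: "ws 0 $ k = 0" if "K < k" "k < n" for k
  proof (rule ccontr)
    assume "ws 0 $ k \<noteq> 0"
    then have "k \<le> K" unfolding K_def using that by (intro Max_ge) auto
    with that show False by simp
  qed
  have "ws 0 $ (n - r + k) = 0" if "k < r" for k
  proof -
    have "(?B *\<^sub>v v) $ k = ws 0 $ (n - r + k)"
      using that S v(1) r by (simp add: ws_def vs0 scalar_prod_def)
    then show ?thesis using v(3) that by (metis index_zero_vec(1))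
  qed
  note bottom = this
  have Kr: "K < n - r"
  proof (rule ccontr)
    assume "\<not> K < n - r"
    then have "K - (n - r) < r" "n - r + (K - (n - r)) = K" using K r by linarith+
    then show False using bottom K(2) by metis
  qed
  have tri: "j \<le> r \<Longrightarrow> ws j $ (K + j) \<noteq> 0 \<and> (\<forall>k. K + j < k \<and> k < n \<longrightarrow> ws j $ k = 0)" for j
  proof (induction j)
    case 0
    then show ?case using K Kmax by auto
  next
    case (Suc j)
    have "ws (Suc j) $ (K + Suc j) = \<phi> (K + Suc j) * ws j $ (K + j)"
      unfolding wsS using Suc Kr r by (subst higgs_field_mult_vec[OF n wsc]) auto
    moreover have "\<phi> (K + Suc j) \<noteq> 0"
      using Suc Kr by (intro nz) auto
    moreover have "ws (Suc j) $ k = 0" if "K + Suc j < k" "k < n" for k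
    proof -
      have "K + j < k - 1" "k - 1 < n" using that by auto
      then have "ws j $ (k - 1) = 0" using Suc by simp
      then show ?thesis
        unfolding wsS using that by (subst higgs_field_mult_vec[OF n wsc]) auto
    qed
    ultimately show ?case using Suc by simp
  qed
  \<comment> \<open>Rows \<open>K\<close> to \<open>K + r\<close> of the first \<open>r + 1\<close>
    iterates form an upper triangular matrix with nonzero diagonal. All iterates lie in the span of
    the \<open>r\<close> columns of \<open>S\<close>, so the same matrix factors through rank
    \<open>r\<close>; padding with a zero column and a zero row makes the factors square.\<close>
  define M where "M = mat (r + 1) (r + 1) (\<lambda>(i, j). ws j $ (K + i))"
  define S' where "S' = mat (r + 1) (r + 1) (\<lambda>(i, l). if l < r then S $$ (K + i, l) else 0)"
  define V' where "V' = mat (r + 1) (r + 1) (\<lambda>(l, j). if l < r then vs j $ l else 0)"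
  have M: "M = S' * V'"
  proof (rule eq_matI)
    fix i j assume "i < dim_row (S' * V')" "j < dim_col (S' * V')"
    then have ij: "i < r + 1" "j < r + 1" by (auto simp: S'_def V'_def)
    then have "M $$ (i, j) = (\<Sum>l<r. S $$ (K + i, l) * vs j $ l)"
      using S vsc[of j] Kr by (simp add: M_def ws_def scalar_prod_def lessThan_atLeast0)
    also have "\<dots> = (\<Sum>l<r + 1. S' $$ (i, l) * V' $$ (l, j))"
      using ij by (simp add: S'_def V'_def)
    also have "\<dots> = (S' * V') $$ (i, j)"
      using ij unfolding S'_def V'_def by (simp add: scalar_prod_def lessThan_atLeast0)
    finally show "M $$ (i, j) = (S' * V') $$ (i, j)" .
  qed (auto simp: M_def S'_def V'_def)
  have "det S' = 0"
  proof (subst det_0_iff_vec_prod_zero)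
    show "S' \<in> carrier_mat (r + 1) (r + 1)" by (simp add: S'_def)
    show "\<exists>v. v \<in> carrier_vec (r + 1) \<and> v \<noteq> 0\<^sub>v (r + 1) \<and> S' *\<^sub>v v = 0\<^sub>v (r + 1)"
    proof (intro exI[of _ "unit_vec (r + 1) r"] conjI)
      show "S' *\<^sub>v unit_vec (r + 1) r = 0\<^sub>v (r + 1)"
        by (rule eq_vecI) (auto simp: S'_def)
    qed auto
  qed
  then have "det M = 0"
    unfolding M by (subst det_mult[of _ "r + 1"]) (auto simp: S'_def V'_def)
  moreover have "det M = prod_list (diag_mat M)"
  proof (rule det_upper_triangular)
    show "upper_triangular M"
      using tri Kr by (auto simp: upper_triangular_def M_def)
    show "M \<in> carrier_mat (r + 1) (r + 1)" by (simp add: M_def)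
  qed
  moreover have "prod_list (diag_mat M) \<noteq> 0"
    using tri by (auto simp: prod_list_zero_iff diag_mat_def M_def)
  ultimately show False by simp
qed

text \<open>Some term of the Leibniz expansion is nonzero. Each of its entries is a nonzero section
  of degree \<open>b i - a (p i)\<close>, which must therefore be nonnegative; summing over
  \<open>i\<close> removes the permutation.\<close>

lemma det_H0_nonzero_degree:
  assumes "A \<in> carrier_mat r r" "\<And>k j. k < r \<Longrightarrow> j < r \<Longrightarrow> A $$ (k, j) \<in> H0 (b k - a j)" "det A \<noteq> 0"
  shows "(\<Sum>j<r. a j) \<le> (\<Sum>k<r. b k)"
proof -
  obtain p where p: "p permutes {0..<r}" "(\<Prod>i=0..<r. A $$ (i, p i)) \<noteq> 0"
    using assms(3) unfolding det_def'[OF assms(1)] by (metis (no_types, lifting) mem_Collect_eq mult_zero_right sum.neutral)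
  have "a (p i) \<le> b i" if "i \<in> {0..<r}" for i
  proof -
    have "p i < r" using p(1) that by (metis atLeastLessThan_iff permutes_in_image)
    moreover have "A $$ (i, p i) \<noteq> 0"
      using p(2) that by auto
    ultimately show ?thesis using assms(2)[of i "p i"] that by (auto simp: H0_def)
  qed
  then have "(\<Sum>i=0..<r. a (p i)) \<le> (\<Sum>i=0..<r. b i)" by (rule sum_mono)
  moreover have "(\<Sum>i=0..<r. a (p i)) = (\<Sum>i=0..<r. a i)"
    using sum.permute[OF p(1), of a] by (simp add: o_def)
  ultimately show ?thesis by (simp add: lessThan_atLeast0)
qed

lemma nonzero_reps_stable:
  assumes n: "n \<ge> 2" and coprime: "coprime (\<Sum>i=1..n. d i) (int n)"
    and ind: "indexed_to_vanish_last n d"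
    and rep: "\<phi> \<in> reps n d t" and nz: "\<And>i. i \<in> {1..<n} \<Longrightarrow> \<phi> i \<noteq> 0"
  shows "\<phi> \<in> stable_reps n d t"
  unfolding stable_reps_def
proof (intro CollectI conjI rep allI impI)
  fix r a S
  assume *: "0 < r \<and> r < n \<and> is_subbundle n d r a S \<and> higgs_invariant n t \<phi> r a S"
  then have r: "0 < r" "r < n" by auto
  have "(\<Sum>j<r. a j) \<le> (\<Sum>k<r. d (n - r + k + 1))"
    by (rule det_H0_nonzero_degree[of "mat r r (\<lambda>(k, j). S $$ (n - r + k, j))"])
      (use * bottom_minor_nonzero[of n \<phi> r d a S t] n nz in \<open>auto simp: is_subbundle_def\<close>)
  also have "\<dots> = (\<Sum>k=n-r+1..n. d k)"
    by (rule sum.reindex_bij_witness[of _ "\<lambda>k. k - (n - r + 1)" "\<lambda>k. n - r + k + 1"]) (use r in auto)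
  finally have le: "(\<Sum>j<r. a j) \<le> (\<Sum>k=n-r+1..n. d k)" .
  have slope: "\<not> real_of_int (\<Sum>j=n-r+1..n. d j) / real (n - (n - r + 1) + 1) > real_of_int (\<Sum>i=1..n. d i) / real n"
    using ind r unfolding indexed_to_vanish_last_def by (elim ballE[of _ _ "n - r + 1"]) auto
  have "n - (n - r + 1) + 1 = r" using r by simp
  note slope[unfolded this not_less]
  then have "real_of_int (\<Sum>j<r. a j) / real r \<le> real_of_int (\<Sum>i=1..n. d i) / real n"
    using le r by (meson divide_right_mono of_int_le_iff of_nat_0_le_iff order_trans)
  \<comment> \<open>Here the weak inequality becomes strict: equal slopes would make
    \<open>n\<close> divide \<open>r\<close> times the total degree, hence by coprimality
    \<open>r\<close> itself, although \<open>0 < r < n\<close>.\<close>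
  moreover have "real_of_int (\<Sum>j<r. a j) / real r \<noteq> real_of_int (\<Sum>i=1..n. d i) / real n"
  proof
    assume "real_of_int (\<Sum>j<r. a j) / real r = real_of_int (\<Sum>i=1..n. d i) / real n"
    then have "real_of_int ((\<Sum>j<r. a j) * int n) = real_of_int ((\<Sum>i=1..n. d i) * int r)"
      using r by (simp add: frac_eq_eq del: of_int_sum)
    then have "(\<Sum>j<r. a j) * int n = (\<Sum>i=1..n. d i) * int r"
      by (simp only: of_int_eq_iff)
    then have "int n dvd (\<Sum>i=1..n. d i) * int r"
      by (metis dvd_triv_right)
    then have "int n dvd int r"
      using coprime by (metis coprime_commute coprime_dvd_mult_right_iff)
    then show False
      using r by (auto dest: dvd_imp_le)
  qed
  ultimately show "real_of_int (\<Sum>j<r. a j) / real r < real_of_int (\<Sum>i=1..n. d i) / real n"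
    by simp
qed

lemma sum_map_degree: "(\<Sum>i=1..n. map_degree n d t i) = int n * t" if "n \<ge> 1"
proof -
  have "(\<Sum>i=1..n. d (nxt n i)) = (\<Sum>i=1..n. d i)"
    by (rule sum.reindex_bij_witness[of _ "\<lambda>i. if i = 1 then n else i - 1" "nxt n"])
      (use that in \<open>auto simp: nxt_def\<close>)
  then show ?thesis by (simp add: map_degree_def sum.distrib sum_subtractf)
qed

text \<open>Below \<open>n\<close> a stable representation supplies a nonzero section. For the last
  arrow the indexing at \<open>k = n\<close> says that \<open>d n\<close> is at most the mean degree
  and at \<open>k = 2\<close> that \<open>d 1\<close> is at least the mean, so
  \<open>d n \<le> d 1\<close>. The degrees of all arrows add up to \<open>n * t\<close>; comparing
  this with the nonnegative degrees of the others gives \<open>(n - 1) * t \<ge> 0\<close>, so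
  \<open>t\<close> is nonnegative too.\<close>

lemma map_degree_nonneg:
  assumes n: "n \<ge> 2" and ind: "indexed_to_vanish_last n d" and ne: "stable_reps n d t \<noteq> {}"
    and i: "i \<in> {1..n}"
  shows "map_degree n d t i \<ge> 0"
proof -
  have lt: "map_degree n d t j \<ge> 0" if "j \<in> {1..<n}" for j
  proof -
    obtain \<phi> where \<phi>: "\<phi> \<in> stable_reps n d t" using ne by auto
    then have "\<phi> j \<in> H0 (map_degree n d t j)"
      using that by (auto simp: stable_reps_def reps_def)
    then show ?thesis
      using stable_reps_nonzero[OF n ind \<phi> that] by (auto simp: H0_def)
  qed
  have last: "map_degree n d t n \<ge> 0"
  proof -
    define D where "D = (\<Sum>i=1..n. d i)"
    have "real_of_int (d n) \<le> D / real n"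
      using ind n unfolding indexed_to_vanish_last_def D_def by (elim ballE[of _ _ n]) auto
    moreover have "real_of_int (\<Sum>j=2..n. d j) / real (n - 1) \<le> D / real n"
      using ind n unfolding indexed_to_vanish_last_def D_def
      by (elim ballE[of _ _ 2]) (auto simp: numeral_2_eq_2 Suc_diff_Suc)
    then have "real_of_int (\<Sum>j=2..n. d j) \<le> D / real n * real (n - 1)"
      using n by (simp add: pos_divide_le_eq del: of_int_sum)
    moreover have "D = d 1 + (\<Sum>j=2..n. d j)"
      unfolding D_def using n by (subst sum.atLeast_Suc_atMost) (auto simp: numeral_2_eq_2)
    then have "real_of_int D = real_of_int (d 1) + real_of_int (\<Sum>j=2..n. d j)" by simp
    moreover have "D / real n * real (n - 1) = D - D / real n"
      using n by (simp add: of_nat_diff field_simps)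
    ultimately have dd: "d n \<le> d 1" by linarith
    have "(\<Sum>i=1..n. map_degree n d t i) = (\<Sum>i\<in>{1..<n}. map_degree n d t i) + map_degree n d t n"
      using n by (simp add: sum.last_plus atLeastLessThanSuc_atLeastAtMost[symmetric] del: sum.op_ivl_Suc)
        (metis One_nat_def Suc_le_lessD add.commute le_eq_less_or_eq atLeastLessThanSuc_atLeastAtMost numeral_2_eq_2 Suc_leD sum.atLeastLessThan_Suc)
    then have "int n * t = (\<Sum>i\<in>{1..<n}. map_degree n d t i) + (d 1 - d n + t)"
      using sum_map_degree[of n d t] n by (simp add: map_degree_def nxt_def)
    moreover have "(\<Sum>i\<in>{1..<n}. map_degree n d t i) \<ge> 0"
      by (rule sum_nonneg) (use lt in auto)
    ultimately have "(int n - 1) * t \<ge> 0"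
      using dd by (simp add: algebra_simps)
    then have "t \<ge> 0"
      using n by (simp add: zero_le_mult_iff)
    then show ?thesis
      using dd by (simp add: map_degree_def nxt_def)
  qed
  show ?thesis
    using lt last i by (cases "i = n") auto
qed

section \<open>Binary forms and their zeros\<close>

text \<open>
  A point \<open>(x : y)\<close> of \<open>P\<^sup>1\<close> is given by a nonzero vector \<open>v = (x, y)\<close>: \<open>lin v\<close> is the linear form
  vanishing there, and \<open>pt v\<close> is the same point in the encoding used by \<open>zero_mult\<close>.
\<close>

definition lin :: "complex \<times> complex \<Rightarrow> complex poly" where
  "lin v = [:- fst v, snd v:]"

definition ev :: "nat \<Rightarrow> complex poly \<Rightarrow> complex \<times> complex \<Rightarrow> complex" where
  "ev k s v = form_eval (int k) s (fst v) (snd v)"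

definition pt :: "complex \<times> complex \<Rightarrow> complex option" where
  "pt v = (if snd v = 0 then None else Some (fst v / snd v))"

lemma ev_altdef: "ev k s v = (\<Sum>j\<le>k. coeff s j * fst v ^ j * snd v ^ (k - j))"
  by (simp add: ev_def form_eval_def)

lemma ev_eq:
  assumes "degree s \<le> k"
  shows "ev k s v = (if snd v = 0 then fst v ^ k * coeff s k else snd v ^ k * poly s (fst v / snd v))"
proof (cases "snd v = 0")
  case True
  have "(\<Sum>j\<le>k. coeff s j * fst v ^ j * snd v ^ (k - j)) = (\<Sum>j\<in>{k}. coeff s j * fst v ^ j * snd v ^ (k - j))"
    by (rule sum.mono_neutral_right) (use True in auto)
  with True show ?thesis by (simp add: ev_altdef)
next
  case False
  have "poly s (fst v / snd v) = (\<Sum>j\<le>k. coeff s j * (fst v / snd v) ^ j)"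
    unfolding poly_altdef using assms by (intro sum.mono_neutral_left) (auto simp: coeff_eq_0)
  then have "snd v ^ k * poly s (fst v / snd v) = (\<Sum>j\<le>k. snd v ^ k * (coeff s j * (fst v / snd v) ^ j))"
    by (simp add: sum_distrib_left)
  also have "\<dots> = (\<Sum>j\<le>k. coeff s j * fst v ^ j * snd v ^ (k - j))"
    using False by (intro sum.cong) (auto simp: power_divide power_diff)
  finally show ?thesis using False by (simp add: ev_altdef)
qed

lemma coeff_mult_top:
  fixes p q :: "'a :: comm_semiring_0 poly"
  assumes "degree p \<le> a" "degree q \<le> b"
  shows "coeff (p * q) (a + b) = coeff p a * coeff q b"
proof -
  have "(\<Sum>i\<le>a + b. coeff p i * coeff q (a + b - i)) = (\<Sum>i\<in>{a}. coeff p i * coeff q (a + b - i))"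
  proof (rule sum.mono_neutral_right)
    show "\<forall>i\<in>{..a + b} - {a}. coeff p i * coeff q (a + b - i) = 0"
    proof
      fix i assume "i \<in> {..a + b} - {a}"
      then consider "i > a" | "a + b - i > b" by force
      then show "coeff p i * coeff q (a + b - i) = 0"
        using assms by cases (auto simp: coeff_eq_0)
    qed
  qed auto
  then show ?thesis by (simp add: coeff_mult)
qed

lemma ev_mult:
  assumes "degree p \<le> a" "degree q \<le> b"
  shows "ev (a + b) (p * q) v = ev a p v * ev b q v"
proof -
  have "degree (p * q) \<le> a + b"
    using degree_mult_le[of p q] assms by linarith
  then show ?thesis
    using assms by (simp add: ev_eq coeff_mult_top power_add)
qed

lemma degree_prod_le_sum:
  assumes "\<And>i. i \<in> A \<Longrightarrow> degree (f i :: complex poly) \<le> m i"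
  shows "degree (prod f A) \<le> sum m A"
  using assms
proof (induction A rule: infinite_finite_induct)
  case (insert x A)
  then have "degree (f x) + degree (prod f A) \<le> m x + sum m A" by (intro add_mono) auto
  then show ?case
    using insert(1,2) order_trans[OF degree_mult_le[of "f x" "prod f A"]] by simp
qed auto

lemma ev_prod:
  assumes "finite A" "\<And>i. i \<in> A \<Longrightarrow> degree (f i) \<le> m i"
  shows "ev (sum m A) (prod f A) v = (\<Prod>i\<in>A. ev (m i) (f i) v)"
  using assms
proof (induction A rule: finite_induct)
  case empty
  then show ?case by (simp add: ev_altdef)
next
  case (insert x A)
  then show ?case by (simp add: ev_mult degree_prod_le_sum)
qed

lemma ev_smult: "ev k (smult c s) v = c * ev k s v"
  by (simp add: ev_altdef sum_distrib_left mult.assoc)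

lemma degree_lin: "degree (lin v) = (if snd v = 0 then 0 else 1)"
  by (simp add: lin_def)

lemma degree_lin_le: "degree (lin v) \<le> Suc 0"
  by (simp add: degree_lin)

lemma lin_eq_0_iff [simp]: "lin v = 0 \<longleftrightarrow> v = 0"
  by (cases v) (auto simp: lin_def zero_prod_def)

lemma ev_lin: "ev (Suc 0) (lin v) w = snd v * fst w - fst v * snd w"
  by (simp add: ev_altdef lin_def)

lemma pt_eq_iff:
  assumes "v \<noteq> 0" "w \<noteq> 0"
  shows "pt v = pt w \<longleftrightarrow> ev (Suc 0) (lin v) w = 0"
  using assms by (cases v; cases w) (auto simp: ev_lin pt_def zero_prod_def field_simps)

text \<open>For a point at infinity \<open>lin v\<close> is a nonzero constant. Division by it
  leaves the polynomial unchanged up to a scalar but lowers the degree of the form by one, which is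
  possible because vanishing at infinity means that the top coefficient is zero.\<close>

lemma ev_zero_lin_dvd:
  assumes v: "v \<noteq> 0" and s: "degree s \<le> k" "s \<noteq> 0" and 0: "ev k s v = 0"
  shows "\<exists>j \<psi>. k = Suc j \<and> degree \<psi> \<le> j \<and> \<psi> \<noteq> 0 \<and> s = lin v * \<psi>"
proof (cases "snd v = 0")
  case True
  with v have x: "fst v \<noteq> 0" by (cases v) (auto simp: zero_prod_def)
  then have "coeff s k = 0"
    using 0 True s by (simp add: ev_eq)
  then have "degree s \<noteq> k"
    using s by (metis leading_coeff_0_iff)
  then obtain j where j: "k = Suc j" "degree s \<le> j"
    using s by (cases k) auto
  have "s = lin v * smult (- 1 / fst v) s"
    using x True by (simp add: lin_def)
  then show ?thesis
    using j x s by (intro exI[of _ j] exI[of _ "smult (- 1 / fst v) s"]) auto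
next
  case False
  let ?z = "fst v / snd v"
  have "poly s ?z = 0"
    using 0 False s by (simp add: ev_eq)
  then obtain q where q: "s = [:- ?z, 1:] * q"
    by (auto simp: poly_eq_0_iff_dvd dvd_def)
  with s have "q \<noteq> 0" by auto
  then have d: "degree s = Suc (degree q)"
    unfolding q by (subst degree_mult_eq) auto
  then obtain j where j: "k = Suc j" "degree q \<le> j"
    using s by (cases k) auto
  have "s = lin v * smult (1 / snd v) q"
    using False by (simp add: q lin_def algebra_simps)
  then show ?thesis
    using j False \<open>q \<noteq> 0\<close> by (intro exI[of _ j] exI[of _ "smult (1 / snd v) q"]) auto
qed

text \<open>Either the polynomial has full degree and a finite root, or the missing top coefficient
  is a zero at infinity.\<close>

lemma ex_ev_zero:
  assumes "degree s \<le> Suc k" "s \<noteq> 0"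
  shows "\<exists>v. v \<noteq> 0 \<and> ev (Suc k) s v = 0"
proof (cases "degree s = Suc k")
  case True
  then have "\<not> constant (poly s)"
    by (simp add: constant_degree)
  then obtain z where "poly s z = 0"
    using fundamental_theorem_of_algebra by blast
  then show ?thesis
    using True by (intro exI[of _ "(z, 1)"]) (auto simp: ev_eq zero_prod_def)
next
  case False
  then have "coeff s (Suc k) = 0"
    using assms by (intro coeff_eq_0) auto
  then show ?thesis
    using assms by (intro exI[of _ "(1, 0)"]) (auto simp: ev_eq zero_prod_def)
qed

text \<open>The fundamental theorem of algebra for binary forms. Zeros at infinity are counted, so
  there are exactly \<open>k\<close> factors whatever the degree of the polynomial.\<close>

lemma form_factorization:
  assumes "degree s \<le> k" "s \<noteq> 0"
  shows "\<exists>c p. c \<noteq> 0 \<and> (\<forall>j<k. p j \<noteq> 0) \<and> s = smult c (\<Prod>j<k. lin (p j))"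
  using assms
proof (induction k arbitrary: s)
  case 0
  then obtain c where "s = [:c:]"
    by (metis degree_eq_zeroE le_zero_eq)
  with 0 show ?case
    by (intro exI[of _ c]) auto
next
  case (Suc k)
  then obtain v where v: "v \<noteq> 0" "ev (Suc k) s v = 0"
    using ex_ev_zero by blast
  then obtain \<psi> where \<psi>: "degree \<psi> \<le> k" "\<psi> \<noteq> 0" "s = lin v * \<psi>"
    using ev_zero_lin_dvd[OF v(1) Suc.prems v(2)] by auto
  obtain c p where cp: "c \<noteq> 0" "\<forall>j<k. p j \<noteq> 0" "\<psi> = smult c (\<Prod>j<k. lin (p j))"
    using Suc.IH[OF \<psi>(1,2)] by blast
  have "s = smult c (\<Prod>j<Suc k. lin ((p(k := v)) j))"
    unfolding \<psi>(3) cp(3) by (simp add: mult.commute)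
  then show ?case
    using cp v by (intro exI[of _ c] exI[of _ "p(k := v)"]) (auto simp: less_Suc_eq)
qed

lemma order_lin: "v \<noteq> 0 \<Longrightarrow> Polynomial.order z (lin v) = (if pt v = Some z then 1 else 0)"
proof -
  assume v: "v \<noteq> 0"
  show ?thesis
  proof (cases "pt v = Some z")
    case True
    then have "snd v \<noteq> 0" "z = fst v / snd v" by (auto simp: pt_def split: if_splits)
    then have *: "lin v = smult (snd v) [:- z, 1:]" by (simp add: lin_def)
    have "Polynomial.order z (lin v) = Polynomial.order z [:- z, 1:]"
      unfolding * by (rule order_smult) fact
    then show ?thesis
      using True order_power_n_n[of z 1] by simp
  next
    case False
    then have "poly (lin v) z \<noteq> 0"
      using v by (cases v) (auto simp: pt_def lin_def zero_prod_def field_simps split: if_splits)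
    then show ?thesis
      using False by (simp add: order_0I)
  qed
qed

lemma zero_mult_lin_mult:
  assumes "v \<noteq> 0" "\<psi> \<noteq> 0" "degree \<psi> \<le> k"
  shows "zero_mult (int (Suc k)) (lin v * \<psi>) q = (if pt v = q then 1 else 0) + zero_mult (int k) \<psi> q"
proof (cases q)
  case None
  then show ?thesis
    using assms by (auto simp: zero_mult_def degree_mult_eq degree_lin pt_def)
next
  case (Some z)
  then show ?thesis
    using assms by (simp add: zero_mult_def order_mult order_lin)
qed

lemma degree_prod_lin_le: "degree (\<Prod>j\<in>J. lin (p j)) \<le> card J"
  using degree_prod_le_sum[of J "\<lambda>j. lin (p j)" "\<lambda>_. 1"] by (simp add: degree_lin_le)

lemma prod_lin_nonzero: "finite J \<Longrightarrow> (\<And>j. j \<in> J \<Longrightarrow> p j \<noteq> 0) \<Longrightarrow> (\<Prod>j\<in>J. lin (p j)) \<noteq> 0"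
  by simp

lemma zero_mult_prod:
  assumes "finite J" "\<And>j. j \<in> J \<Longrightarrow> p j \<noteq> 0" "c \<noteq> 0"
  shows "zero_mult (int (card J)) (smult c (\<Prod>j\<in>J. lin (p j))) q = card {j \<in> J. pt (p j) = q}"
  using assms(1,2)
proof (induction J rule: finite_induct)
  case empty
  then show ?case
    using assms(3) by (auto simp: zero_mult_def order_0I split: option.split)
next
  case (insert x J)
  have "smult c (\<Prod>j\<in>insert x J. lin (p j)) = lin (p x) * smult c (\<Prod>j\<in>J. lin (p j))"
    using insert by simp
  moreover have "zero_mult (int (Suc (card J))) (lin (p x) * smult c (\<Prod>j\<in>J. lin (p j))) q =
      (if pt (p x) = q then 1 else 0) + zero_mult (int (card J)) (smult c (\<Prod>j\<in>J. lin (p j))) q"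
    using insert assms(3) degree_prod_lin_le[of p J] by (intro zero_mult_lin_mult) auto
  moreover have "{j \<in> insert x J. pt (p j) = q} =
      (if pt (p x) = q then insert x {j \<in> J. pt (p j) = q} else {j \<in> J. pt (p j) = q})"
    by auto
  ultimately show ?case
    using insert by simp
qed

lemma prod_lin_in_H0: "smult c (\<Prod>j\<in>J. lin (p j)) \<in> H0 (int (card J))"
  using degree_prod_lin_le[of p J] degree_smult_le[of c "\<Prod>j\<in>J. lin (p j)"] by (auto simp: H0_def)

lemma distinct_zeros_prod_iff:
  assumes "finite J" "\<And>j. j \<in> J \<Longrightarrow> p j \<noteq> 0" "c \<noteq> 0"
  shows "smult c (\<Prod>j\<in>J. lin (p j)) \<in> distinct_zeros (int (card J)) \<longleftrightarrow> inj_on (pt \<circ> p) J"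
proof -
  have "smult c (\<Prod>j\<in>J. lin (p j)) \<in> distinct_zeros (int (card J)) \<longleftrightarrow>
      (\<forall>q. card {j \<in> J. pt (p j) = q} \<le> 1)"
    using assms prod_lin_nonzero[of J p] zero_mult_prod[of J p c] prod_lin_in_H0[of c p J]
    by (simp add: distinct_zeros_def)
  also have "\<dots> \<longleftrightarrow> inj_on (pt \<circ> p) J"
    using assms(1) by (auto simp: inj_on_def card_le_Suc0_iff_eq)
  finally show ?thesis .
qed

lemma repeated_zeros_iff: "s \<in> repeated_zeros m \<longleftrightarrow> s \<in> H0 m \<and> s \<noteq> 0 \<and> s \<notin> distinct_zeros m"
  by (auto simp: repeated_zeros_def distinct_zeros_def not_le)

text \<open>After one linear factor is divided out, the quotient still vanishes at the other points,
  since the removed factor does not. The scalar may be 0, which covers \<open>s = 0\<close>.\<close>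

lemma form_eq_prod_of_zeros:
  assumes "degree s \<le> k" "\<And>j. j < k \<Longrightarrow> v j \<noteq> 0" "\<And>j. j < k \<Longrightarrow> ev k s (v j) = 0"
    and "inj_on (pt \<circ> v) {..<k}"
  shows "\<exists>c. s = smult c (\<Prod>j<k. lin (v j))"
  using assms
proof (induction k arbitrary: s)
  case 0
  then show ?case
    by (metis degree_eq_zeroE le_zero_eq lessThan_0 mult.right_neutral prod.empty smult_one)
next
  case (Suc k)
  show ?case
  proof (cases "s = 0")
    case False
    obtain \<psi> where \<psi>: "degree \<psi> \<le> k" "s = lin (v k) * \<psi>"
      using ev_zero_lin_dvd[of "v k" s "Suc k"] Suc.prems False by auto
    have "ev k \<psi> (v j) = 0" if j: "j < k" for j
    proof -
      have "pt (v k) \<noteq> pt (v j)"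
        using inj_onD[OF Suc.prems(4), of k j] j by auto
      then have "ev (Suc 0) (lin (v k)) (v j) \<noteq> 0"
        using Suc.prems(2) j by (simp add: pt_eq_iff)
      moreover have "ev (Suc 0 + k) s (v j) = ev (Suc 0) (lin (v k)) (v j) * ev k \<psi> (v j)"
        unfolding \<psi>(2) by (rule ev_mult[OF degree_lin_le \<psi>(1)])
      ultimately show ?thesis
        using Suc.prems(3)[of j] j by simp
    qed
    then obtain c where "\<psi> = smult c (\<Prod>j<k. lin (v j))"
      using Suc.IH[OF \<psi>(1)] Suc.prems(2,4) by (auto simp: inj_on_def)
    then show ?thesis
      using \<psi>(2) by (intro exI[of _ c]) (simp add: mult.commute)
  qed (auto intro: exI[of _ 0])
qed

text \<open>The product vanishes at \<open>p k\<close>, so some factor \<open>\<phi> i0\<close>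
  does. Dividing both sides by \<open>lin (p k)\<close> lowers \<open>m i0\<close> by one, and
  appending \<open>i0\<close> to the list found for the quotient records which factor received the
  zero.\<close>

lemma factor_assignment:
  assumes I: "finite I" and "\<And>i. i \<in> I \<Longrightarrow> degree (\<phi> i) \<le> m i" "\<And>i. i \<in> I \<Longrightarrow> \<phi> i \<noteq> 0"
    and "(\<Prod>i\<in>I. \<phi> i) = smult c (\<Prod>j<k. lin (p j))" "\<And>j. j < k \<Longrightarrow> p j \<noteq> 0"
    and "sum m I = k"
  shows "\<exists>\<sigma> e. length \<sigma> = k \<and> set \<sigma> \<subseteq> I \<and> (\<forall>i\<in>I. count (mset \<sigma>) i = m i) \<and>
    (\<forall>i\<in>I. e i \<noteq> 0 \<and> \<phi> i = smult (e i) (\<Prod>j\<in>{j. j < k \<and> \<sigma> ! j = i}. lin (p j)))"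
  using assms(2-)
proof (induction k arbitrary: m \<phi>)
  case 0
  then have m: "m i = 0" if "i \<in> I" for i using that I by simp
  have "\<phi> i = [:coeff (\<phi> i) 0:]" if "i \<in> I" for i
    using 0(1)[OF that] m[OF that] by (metis coeff_pCons_0 degree_eq_zeroE le_zero_eq)
  then have "coeff (\<phi> i) 0 \<noteq> 0 \<and> \<phi> i = smult (coeff (\<phi> i) 0) 1" if "i \<in> I" for i
    using 0(2)[OF that] that by (metis mult.right_neutral pCons_0_0 smult_one)
  then show ?case
    using m by (intro exI[of _ "[]"] exI[of _ "\<lambda>i. coeff (\<phi> i) 0"]) auto
next
  case (Suc k)
  have "ev (Suc k) (\<Prod>j<Suc k. lin (p j)) (p k) =
      ev (\<Sum>j<Suc k. 1) (\<Prod>j<Suc k. lin (p j)) (p k)" by simp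
  also have "\<dots> = (\<Prod>j<Suc k. ev 1 (lin (p j)) (p k))"
    by (rule ev_prod) (auto simp: degree_lin)
  also have "\<dots> = 0" by (simp add: ev_lin)
  finally have "ev (sum m I) (\<Prod>i\<in>I. \<phi> i) (p k) = 0"
    using Suc.prems by (simp add: ev_smult)
  then obtain i0 where i0: "i0 \<in> I" "ev (m i0) (\<phi> i0) (p k) = 0"
    using ev_prod[OF I, of \<phi> m] Suc.prems I by auto
  obtain l \<psi> where \<psi>: "m i0 = Suc l" "degree \<psi> \<le> l" "\<psi> \<noteq> 0" "\<phi> i0 = lin (p k) * \<psi>"
    using ev_zero_lin_dvd[OF _ _ _ i0(2)] Suc.prems i0 by blast
  have eqI: "(\<Prod>i\<in>I. \<phi> i) = lin (p k) * (\<Prod>i\<in>I. (\<phi>(i0 := \<psi>)) i)"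
    using I i0 by (simp add: prod.remove[of I i0] \<psi> algebra_simps)
  have "\<exists>\<sigma> e. length \<sigma> = k \<and> set \<sigma> \<subseteq> I \<and> (\<forall>i\<in>I. count (mset \<sigma>) i = (m(i0 := l)) i) \<and>
    (\<forall>i\<in>I. e i \<noteq> 0 \<and> (\<phi>(i0 := \<psi>)) i = smult (e i) (\<Prod>j\<in>{j. j < k \<and> \<sigma> ! j = i}. lin (p j)))"
  proof (rule Suc.IH)
    have "lin (p k) * (\<Prod>i\<in>I. (\<phi>(i0 := \<psi>)) i) = lin (p k) * smult c (\<Prod>j<k. lin (p j))"
      using Suc.prems(3) eqI by (simp add: mult.commute)
    then show "(\<Prod>i\<in>I. (\<phi>(i0 := \<psi>)) i) = smult c (\<Prod>j<k. lin (p j))"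
      using Suc.prems(4)[of k] by (subst (asm) mult_cancel_left) auto
    show "sum (m(i0 := l)) I = k"
      using Suc.prems(5) I i0 \<psi>(1) by (simp add: sum.remove[of I i0])
  qed (use Suc.prems \<psi> in auto)
  then obtain \<sigma> e where *: "length \<sigma> = k" "set \<sigma> \<subseteq> I" "\<And>i. i \<in> I \<Longrightarrow> count (mset \<sigma>) i = (m(i0 := l)) i"
    "\<And>i. i \<in> I \<Longrightarrow> e i \<noteq> 0"
    "\<And>i. i \<in> I \<Longrightarrow> (\<phi>(i0 := \<psi>)) i = smult (e i) (\<Prod>j\<in>{j. j < k \<and> \<sigma> ! j = i}. lin (p j))"
    by blast
  have set: "{j. j < Suc k \<and> (\<sigma> @ [i0]) ! j = i} =
      (if i = i0 then insert k {j. j < k \<and> \<sigma> ! j = i} else {j. j < k \<and> \<sigma> ! j = i})" for i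
    using *(1) by (auto simp: nth_append less_Suc_eq)
  have "\<phi> i = smult (e i) (\<Prod>j\<in>{j. j < Suc k \<and> (\<sigma> @ [i0]) ! j = i}. lin (p j))" if "i \<in> I" for i
    using *(5)[OF that] \<psi>(4) unfolding set by (cases "i = i0") auto
  moreover have "count (mset (\<sigma> @ [i0])) i = m i" if "i \<in> I" for i
    using *(3)[OF that] \<psi>(1) by auto
  ultimately show ?case
    using * i0 by (intro exI[of _ "\<sigma> @ [i0]"] exI[of _ e]) auto
qed

text \<open>
  A list \<open>\<sigma>\<close> with this multiset of entries distributes the zeros of a product among its factors, the
  \<open>j\<close>-th zero going to the factor \<open>\<sigma> ! j\<close>; such lists are counted by the multinomial coefficient.
\<close>

definition type_mset :: "nat \<Rightarrow> (nat \<Rightarrow> nat) \<Rightarrow> nat multiset" where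
  "type_mset n m = (\<Sum>i=1..n. replicate_mset (m i) i)"

lemma count_type_mset: "count (type_mset n m) i = (if i \<in> {1..n} then m i else 0)"
  by (simp add: type_mset_def count_sum)

lemma size_type_mset: "size (type_mset n m) = (\<Sum>i=1..n. m i)"
  by (simp add: type_mset_def)

lemma permutations_type_mset_iff:
  "\<sigma> \<in> permutations_of_multiset (type_mset n m) \<longleftrightarrow>
    set \<sigma> \<subseteq> {1..n} \<and> (\<forall>i\<in>{1..n}. count (mset \<sigma>) i = m i)"
proof -
  have "mset \<sigma> = type_mset n m \<longleftrightarrow> (\<forall>i. count (mset \<sigma>) i = (if i \<in> {1..n} then m i else 0))"
    by (simp add: multiset_eq_iff count_type_mset)
  also have "\<dots> \<longleftrightarrow> set \<sigma> \<subseteq> {1..n} \<and> (\<forall>i\<in>{1..n}. count (mset \<sigma>) i = m i)"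
    by (auto simp: count_mset_0_iff subset_iff split: if_splits)
  finally show ?thesis by (simp add: permutations_of_multiset_def)
qed

text \<open>Nodes with \<open>m i = 0\<close> do not occur in the multiset, but they contribute only
  \<open>fact 0 = 1\<close> to the product over all nodes.\<close>

lemma card_permutations_type_mset:
  "card (permutations_of_multiset (type_mset n m)) = fact (\<Sum>i=1..n. m i) div (\<Prod>i=1..n. fact (m i))"
proof -
  have "(\<Prod>x\<in>set_mset (type_mset n m). fact (count (type_mset n m) x)) =
      (\<Prod>i=1..n. fact (m i) :: nat)"
    by (rule prod.mono_neutral_cong_left)
      (auto simp: count_type_mset simp flip: count_greater_zero_iff split: if_splits)
  then show ?thesis
    by (simp add: card_permutations_of_multiset size_type_mset)
qed

lemma card_positions: "card {j. j < length \<sigma> \<and> \<sigma> ! j = i} = count (mset \<sigma>) i"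
  by (simp add: count_mset count_list_eq_length_filter length_filter_conv_card eq_commute conj_commute)

section \<open>Continuity of simple zeros\<close>

text \<open>This is \<open>p' / p = \<Sum> 1 / (z - \<rho>)\<close>, summed over the roots \<open>\<rho>\<close> of \<open>p\<close>.\<close>

lemma derivative_bound_of_distant_roots:
  fixes p :: "complex poly"
  assumes "B \<ge> 0" "\<And>\<rho>. poly p \<rho> = 0 \<Longrightarrow> B \<le> norm (\<rho> - z)"
  shows "norm (poly (pderiv p) z) * B \<le> real (degree p) * norm (poly p z)"
  using assms(2)
proof (induction "degree p" arbitrary: p)
  case 0
  then have "pderiv p = 0" by (simp add: pderiv_eq_0_iff)
  then show ?case by simp
next
  case (Suc l)
  then have "\<not> constant (poly p)"
    by (simp add: constant_degree)
  then obtain \<rho> where \<rho>: "poly p \<rho> = 0"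
    using fundamental_theorem_of_algebra by blast
  then obtain q where q: "p = [:- \<rho>, 1:] * q"
    by (auto simp: poly_eq_0_iff_dvd dvd_def)
  have "q \<noteq> 0" using Suc(2) q by auto
  then have d: "degree p = Suc (degree q)"
    unfolding q by (subst degree_mult_eq) auto
  have IH: "norm (poly (pderiv q) z) * B \<le> real (degree q) * norm (poly q z)"
    using Suc.hyps(1)[of q] Suc.hyps(2) Suc.prems d q by auto
  have B: "B \<le> norm (z - \<rho>)"
    using Suc.prems[OF \<rho>] by (simp add: norm_minus_commute)
  have "poly (pderiv p) z = poly q z + (z - \<rho>) * poly (pderiv q) z"
    unfolding q pderiv_mult by (simp add: pderiv_pCons algebra_simps)
  then have "norm (poly (pderiv p) z) * B \<le> (norm (poly q z) + norm (z - \<rho>) * norm (poly (pderiv q) z)) * B"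
    using assms(1) by (intro mult_right_mono) (auto intro: norm_triangle_le simp: norm_mult)
  also have "\<dots> = norm (poly q z) * B + norm (z - \<rho>) * (norm (poly (pderiv q) z) * B)"
    by (simp add: algebra_simps)
  also have "\<dots> \<le> norm (poly q z) * norm (z - \<rho>) + norm (z - \<rho>) * (real (degree q) * norm (poly q z))"
    using B IH by (intro add_mono mult_left_mono) auto
  also have "\<dots> = real (degree p) * norm (poly p z)"
  proof -
    have "norm (poly p z) = norm (z - \<rho>) * norm (poly q z)"
      by (simp add: q norm_mult flip: left_diff_distrib)
    then show ?thesis by (simp add: d algebra_simps)
  qed
  finally show ?case .
qed

text \<open>The preceding bound is applied with \<open>B\<close> the distance from \<open>z\<close>
  to the nearest root. The estimate depends on the polynomial only through its value and derivative
  at \<open>z\<close> and the degree bound \<open>k\<close>, so it holds uniformly in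
  families.\<close>

lemma root_near:
  fixes p :: "complex poly"
  assumes k: "degree p \<le> k" and nz: "poly (pderiv p) z \<noteq> 0"
  shows "\<exists>\<rho>. poly p \<rho> = 0 \<and> norm (poly (pderiv p) z) * norm (\<rho> - z) \<le> real k * norm (poly p z)"
proof -
  have p: "p \<noteq> 0" "degree p \<noteq> 0"
    using nz by (auto simp: pderiv_eq_0_iff[symmetric])
  have ne: "{\<rho>. poly p \<rho> = 0} \<noteq> {}"
    using fundamental_theorem_of_algebra[of p] p by (auto simp: constant_degree)
  have fin: "finite {\<rho>. poly p \<rho> = 0}"
    using p poly_roots_finite by blast
  define \<rho> where "\<rho> = arg_min_on (\<lambda>\<rho>. norm (\<rho> - z)) {\<rho>. poly p \<rho> = 0}"
  have "poly p \<rho> = 0" "\<And>\<rho>'. poly p \<rho>' = 0 \<Longrightarrow> norm (\<rho> - z) \<le> norm (\<rho>' - z)"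
    using arg_min_if_finite(1)[OF fin ne] arg_min_least[OF fin ne] unfolding \<rho>_def by fastforce+
  then have "poly p \<rho> = 0" "norm (poly (pderiv p) z) * norm (\<rho> - z) \<le> real (degree p) * norm (poly p z)"
    using derivative_bound_of_distant_roots[of "norm (\<rho> - z)" p z] by auto
  moreover have "real (degree p) * norm (poly p z) \<le> real k * norm (poly p z)"
    using k by (intro mult_right_mono) auto
  ultimately show ?thesis
    using order_trans by blast
qed

text \<open>The quotient of \<open>poly p x - poly p y\<close> by \<open>x - y\<close>, written as a
  polynomial so that it also makes sense on the diagonal. The summation bound \<open>k\<close> is
  kept apart from the degree so that it can be constant in a family.\<close>

definition divided_difference :: "nat \<Rightarrow> complex poly \<Rightarrow> complex \<Rightarrow> complex \<Rightarrow> complex" where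
  "divided_difference k p x y = (\<Sum>j\<le>k. coeff p j * (\<Sum>i<j. y ^ (j - Suc i) * x ^ i))"

lemma poly_eq_sum_le: "degree (p :: complex poly) \<le> k \<Longrightarrow> poly p x = (\<Sum>j\<le>k. coeff p j * x ^ j)"
  unfolding poly_altdef by (intro sum.mono_neutral_left) (auto simp: coeff_eq_0)

lemma divided_difference:
  "degree p \<le> k \<Longrightarrow> poly p x - poly p y = (x - y) * divided_difference k p x y"
  by (simp add: poly_eq_sum_le divided_difference_def sum_distrib_left flip: sum_subtractf right_diff_distrib)
    (simp add: power_diff_sumr2 sum_distrib_left algebra_simps)

lemma divided_difference_diag:
  assumes "degree p \<le> k"
  shows "divided_difference k p x x = poly (pderiv p) x"
proof -
  have "((\<lambda>x. \<Sum>j\<le>k. coeff p j * x ^ j) has_field_derivative (\<Sum>j\<le>k. coeff p j * (of_nat j * x ^ (j - 1)))) (at x)"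
    by (auto intro!: derivative_eq_intros sum.cong simp: algebra_simps)
  moreover have "(\<lambda>x. \<Sum>j\<le>k. coeff p j * x ^ j) = poly p"
    using poly_eq_sum_le[OF assms] by auto
  ultimately have "poly (pderiv p) x = (\<Sum>j\<le>k. coeff p j * (of_nat j * x ^ (j - 1)))"
    using DERIV_unique[OF poly_DERIV] by metis
  also have "\<dots> = divided_difference k p x x"
    unfolding divided_difference_def
    by (intro sum.cong refl arg_cong[where f = "\<lambda>u. coeff p _ * u"]) (simp flip: power_add)
  finally show ?thesis by simp
qed

text \<open>For families inside some \<open>H0 m\<close> this is continuity into the analytic
  topology of \<open>H0_variety m\<close>.\<close>

definition pcont :: "'a topology \<Rightarrow> ('a \<Rightarrow> complex poly) \<Rightarrow> bool" where
  "pcont X f \<longleftrightarrow> (\<forall>j. cts X (\<lambda>x. coeff (f x) j))"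

lemma continuous_map_power:
  fixes f :: "'a \<Rightarrow> complex"
  shows "cts X f \<Longrightarrow> cts X (\<lambda>x. f x ^ n)"
  by (induction n) (auto intro: continuous_map_mult)

lemma pcont_const: "pcont X (\<lambda>_. p)"
  by (simp add: pcont_def)

lemma pcont_mult: "pcont X f \<Longrightarrow> pcont X g \<Longrightarrow> pcont X (\<lambda>x. f x * g x)"
  unfolding pcont_def coeff_mult by (intro allI continuous_map_sum continuous_map_mult) auto

lemma pcont_prod: "(\<And>i. i \<in> A \<Longrightarrow> pcont X (f i)) \<Longrightarrow> pcont X (\<lambda>x. \<Prod>i\<in>A. f i x)"
  by (induction A rule: infinite_finite_induct) (auto intro: pcont_const pcont_mult)

lemma pcont_smult: "cts X c \<Longrightarrow> pcont X f \<Longrightarrow> pcont X (\<lambda>x. smult (c x) (f x))"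
  unfolding pcont_def coeff_smult by (intro allI continuous_map_mult) auto

lemma pcont_lin:
  assumes "cts X (\<lambda>x. fst (v x))" "cts X (\<lambda>x. snd (v x))"
  shows "pcont X (\<lambda>x. lin (v x))"
  unfolding pcont_def
proof
  fix j
  show "cts X (\<lambda>x. coeff (lin (v x)) j)"
    using assms by (cases j; cases "j - 1") (auto simp: lin_def continuous_map_minus)
qed

lemma continuous_map_ev:
  assumes "pcont X f" "cts X (\<lambda>x. fst (v x))" "cts X (\<lambda>x. snd (v x))"
  shows "cts X (\<lambda>x. ev k (f x) (v x))"
  unfolding ev_altdef using assms
  by (intro continuous_map_sum continuous_map_mult continuous_map_power) (auto simp: pcont_def)

lemma continuous_map_poly:
  assumes "pcont X f" "\<And>x. x \<in> topspace X \<Longrightarrow> degree (f x) \<le> k"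
  shows "cts X (\<lambda>x. poly (f x) z)"
proof -
  have "cts X (\<lambda>x. \<Sum>j\<le>k. coeff (f x) j * z ^ j)"
    using assms(1) by (intro continuous_map_sum continuous_map_mult) (auto simp: pcont_def)
  then show ?thesis
    by (rule continuous_map_eq) (simp add: poly_eq_sum_le[OF assms(2)])
qed

lemma pcont_subtopology: "pcont X f \<Longrightarrow> pcont (subtopology X S) f"
  by (simp add: pcont_def continuous_map_from_subtopology)

lemma openin_nonzero:
  fixes f :: "'a \<Rightarrow> complex"
  assumes "cts X f"
  shows "openin X {x \<in> topspace X. f x \<noteq> 0}"
  using openin_continuous_map_preimage[OF assms, of "- {0}"] by auto

lemma openin_less:
  fixes f g :: "'a \<Rightarrow> real"
  assumes "cts X f" "cts X g"
  shows "openin X {x \<in> topspace X. f x < g x}"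
  using openin_continuous_map_preimage[OF continuous_map_diff[OF assms(2,1)], of "{0<..}"] by auto

text \<open>
  The divided difference does not vanish near the diagonal point of a simple root, which makes the
  root unique there; \<open>root_near\<close> supplies its existence, at every nearby parameter.
\<close>

lemma local_root_function:
  assumes deg: "\<And>x. x \<in> topspace X \<Longrightarrow> degree (s x) \<le> k" and cont: "pcont X s"
    and x0: "x0 \<in> topspace X" and root: "poly (s x0) z0 = 0" and simple: "poly (pderiv (s x0)) z0 \<noteq> 0"
  shows "\<exists>V w. openin X V \<and> x0 \<in> V \<and> cts (subtopology X V) w \<and>
    (\<forall>x\<in>V. poly (s x) (w x) = 0) \<and> w x0 = z0"
proof -
  let ?T = "prod_topology X (euclidean :: (complex \<times> complex) topology)"
  define G where "G = (\<lambda>(x, a, b). divided_difference k (s x) a b)"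
  have c1: "cts ?T (\<lambda>y. coeff (s (fst y)) j)" for j
    using continuous_map_compose[OF continuous_map_fst, of X euclidean "\<lambda>x. coeff (s x) j"] cont
    by (simp add: pcont_def o_def)
  have c2: "cts ?T (\<lambda>y. \<Sum>i<j. snd (snd y) ^ (j - Suc i) * fst (snd y) ^ i)" for j
    using continuous_map_compose[OF continuous_map_snd[of X euclidean], of euclidean
        "\<lambda>w. \<Sum>i<j. snd w ^ (j - Suc i) * fst w ^ i :: complex"]
    by (simp add: o_def continuous_intros)
  have "cts ?T G"
    unfolding G_def divided_difference_def case_prod_beta
    by (intro continuous_map_sum continuous_map_mult c1 c2) auto
  then have "openin ?T {y \<in> topspace ?T. G y \<noteq> 0}"
    by (rule openin_nonzero)
  moreover have "(x0, z0, z0) \<in> {y \<in> topspace ?T. G y \<noteq> 0}"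
    using x0 simple deg by (simp add: G_def divided_difference_diag)
  ultimately have "\<exists>U W. openin X U \<and> openin euclidean W \<and> x0 \<in> U \<and> (z0, z0) \<in> W \<and>
      U \<times> W \<subseteq> {y \<in> topspace ?T. G y \<noteq> 0}"
    unfolding openin_prod_topology_alt by (elim allE[of _ x0] allE[of _ "(z0, z0)"]) (rule mp)
  then obtain U W where U: "openin X U" "x0 \<in> U" and W: "open W" "(z0, z0) \<in> W"
    and UW: "U \<times> W \<subseteq> {y \<in> topspace ?T. G y \<noteq> 0}"
    by auto
  from W obtain A B where AB: "open A" "open B" "z0 \<in> A" "z0 \<in> B" "A \<times> B \<subseteq> W"
    by (metis open_prod_elim mem_Sigma_iff)
  obtain \<delta> where \<delta>: "\<delta> > 0" "ball z0 \<delta> \<subseteq> A \<inter> B"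
    using AB open_contains_ball_eq[of "A \<inter> B" z0] by blast
  have dd: "divided_difference k (s x) a b \<noteq> 0" if "x \<in> U" "a \<in> ball z0 \<delta>" "b \<in> ball z0 \<delta>" for x a b
  proof -
    have "a \<in> A" "b \<in> B" using that \<delta>(2) by blast+
    then have "(x, a, b) \<in> U \<times> W" using that(1) AB(5) by blast
    then show ?thesis using UW by (auto simp: G_def)
  qed
  have UX: "U \<subseteq> topspace X" using U by (simp add: openin_subset)
  have uniq: "a = b" if "x \<in> U" "a \<in> ball z0 \<delta>" "b \<in> ball z0 \<delta>" "poly (s x) a = 0" "poly (s x) b = 0" for x a b
    using divided_difference[of "s x" k a b] dd[OF that(1-3)] that deg UX by auto
  have cpoly: "cts X (\<lambda>x. norm (poly (s x) z))" for z
    using continuous_map_poly[OF cont deg] by (intro continuous_map_norm) auto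
  have "cts X (\<lambda>x. divided_difference k (s x) z z)" for z
    using cont unfolding divided_difference_def
    by (intro continuous_map_sum continuous_map_mult) (auto simp: pcont_def)
  then have cdd: "cts X (\<lambda>x. norm (divided_difference k (s x) z z))" for z
    by (intro continuous_map_norm)
  \<comment> \<open>The open set of parameters for which \<open>root_near\<close>, applied at
    \<open>z\<close>, yields a root at distance less than \<open>\<epsilon>\<close> from
    \<open>z\<close>; the divided difference on the diagonal stands for the derivative.\<close>
  define N where "N z \<epsilon> = U \<inter> {x \<in> topspace X. real k * norm (poly (s x) z) < \<epsilon> * norm (divided_difference k (s x) z z)}" for z \<epsilon>
  have oN: "openin X (N z \<epsilon>)" for z \<epsilon>
    unfolding N_def using U(1) cpoly cdd by (intro openin_Int openin_less continuous_map_mult) auto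
  have rootN: "\<exists>\<rho>. poly (s x) \<rho> = 0 \<and> norm (\<rho> - z) < \<epsilon>" if "x \<in> N z \<epsilon>" "z \<in> ball z0 \<delta>" for x z \<epsilon>
  proof -
    have x: "x \<in> U" "real k * norm (poly (s x) z) < \<epsilon> * norm (poly (pderiv (s x)) z)" "degree (s x) \<le> k"
      using that deg UX by (auto simp: N_def divided_difference_diag)
    have nz: "poly (pderiv (s x)) z \<noteq> 0"
      using dd[OF x(1) that(2) that(2)] x(3) by (simp add: divided_difference_diag)
    obtain \<rho> where \<rho>: "poly (s x) \<rho> = 0"
      "norm (poly (pderiv (s x)) z) * norm (\<rho> - z) \<le> real k * norm (poly (s x) z)"
      using root_near[OF x(3) nz] by blast
    then have "norm (poly (pderiv (s x)) z) * norm (\<rho> - z) < norm (poly (pderiv (s x)) z) * \<epsilon>"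
      using x(2) by (simp add: mult.commute)
    then show ?thesis using \<rho>(1) nz by auto
  qed
  define V where "V = N z0 \<delta>"
  define w where "w x = (SOME a. a \<in> ball z0 \<delta> \<and> poly (s x) a = 0)" for x
  have w: "w x \<in> ball z0 \<delta> \<and> poly (s x) (w x) = 0" if "x \<in> V" for x
    unfolding w_def
    by (rule someI_ex) (use rootN[of x z0 \<delta>] that \<delta> in \<open>auto simp: V_def dist_norm norm_minus_commute\<close>)
  have VU: "V \<subseteq> U" by (auto simp: V_def N_def)
  have x0V: "x0 \<in> V"
    using x0 U root dd[of x0 z0 z0] \<delta>(1) by (auto simp: V_def N_def)
  have w0: "w x0 = z0"
    using uniq[of x0 "w x0" z0] w[OF x0V] U(2) root \<delta>(1) by auto
  \<comment> \<open>Continuity at \<open>x\<close> uses the estimate at the base point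
    \<open>w x\<close>. There \<open>s x\<close> vanishes, so the inequality defining
    \<open>N\<close> holds at \<open>x\<close> and persists nearby; the root it produces for a
    nearby \<open>y\<close> lies in the ball and must be \<open>w y\<close> by uniqueness.\<close>
  have "cts (subtopology X V) w"
    unfolding continuous_map_def
  proof (intro conjI allI impI)
    fix O' :: "complex set" assume O': "openin euclidean O'"
    show "openin (subtopology X V) {x \<in> topspace (subtopology X V). w x \<in> O'}"
    proof (subst openin_subopen, intro ballI)
      fix x assume "x \<in> {x \<in> topspace (subtopology X V). w x \<in> O'}"
      then have x: "x \<in> V" "w x \<in> O'" by auto
      have "w x \<in> O' \<inter> ball z0 \<delta>" "open (O' \<inter> ball z0 \<delta>)"
        using x w O' by auto
      then obtain \<epsilon> where \<epsilon>: "\<epsilon> > 0" "ball (w x) \<epsilon> \<subseteq> O' \<inter> ball z0 \<delta>"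
        using open_contains_ball by blast
      have xN: "x \<in> N (w x) \<epsilon>"
        using x VU UX w[OF x(1)] dd[of x "w x" "w x"] \<epsilon> by (auto simp: N_def)
      have "w y \<in> O'" if y: "y \<in> V" "y \<in> N (w x) \<epsilon>" for y
      proof -
        obtain \<rho> where \<rho>: "poly (s y) \<rho> = 0" "norm (\<rho> - w x) < \<epsilon>"
          using rootN[OF y(2)] w[OF x(1)] by blast
        then have "\<rho> \<in> O' \<inter> ball z0 \<delta>"
          using \<epsilon>(2) by (auto simp: dist_norm norm_minus_commute subset_iff)
        moreover from this have "w y = \<rho>"
          using uniq[of y "w y" \<rho>] w[OF y(1)] \<rho>(1) y(1) VU by auto
        ultimately show ?thesis by simp
      qed
      then show "\<exists>T. openin (subtopology X V) T \<and> x \<in> T \<and> T \<subseteq> {x \<in> topspace (subtopology X V). w x \<in> O'}"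
        using x xN oN[of "w x" \<epsilon>] VU UX
        by (intro exI[of _ "V \<inter> N (w x) \<epsilon>"]) (auto intro: openin_subtopology_Int2)
    qed
  qed auto
  then show ?thesis
    using x0V w w0 oN unfolding V_def by blast
qed

text \<open>The condition \<open>ev k \<psi> v0 \<noteq> 0\<close> says that the zero is simple, so
  \<open>local_root_function\<close> applies in an affine chart around it. The vector found is
  normalised in that chart, which is why only the points \<open>pt (v x0)\<close> and
  \<open>pt v0\<close> are said to agree.\<close>

lemma local_zero_function:
  assumes deg: "\<And>x. x \<in> topspace X \<Longrightarrow> degree (s x) \<le> Suc k" and cont: "pcont X s"
    and x0: "x0 \<in> topspace X" and v0: "v0 \<noteq> 0"
    and s0: "s x0 = lin v0 * \<psi>" and \<psi>: "degree \<psi> \<le> k" "ev k \<psi> v0 \<noteq> 0"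
  shows "\<exists>V v. openin X V \<and> x0 \<in> V \<and> cts (subtopology X V) (\<lambda>x. fst (v x)) \<and>
    cts (subtopology X V) (\<lambda>x. snd (v x)) \<and>
    (\<forall>x\<in>V. v x \<noteq> 0 \<and> ev (Suc k) (s x) (v x) = 0) \<and> pt (v x0) = pt v0"
proof (cases "snd v0 = 0")
  case False
  let ?z = "fst v0 / snd v0"
  have l0: "poly (lin v0) ?z = 0" using False by (simp add: lin_def)
  have "pderiv (lin v0) = [:snd v0:]" by (simp add: lin_def pderiv_pCons)
  then have "poly (pderiv (s x0)) ?z = snd v0 * poly \<psi> ?z"
    unfolding s0 pderiv_mult poly_add poly_mult l0 by simp
  moreover have "poly \<psi> ?z \<noteq> 0"
    using \<psi> False by (auto simp: ev_eq)
  ultimately obtain V w where V: "openin X V" "x0 \<in> V" "cts (subtopology X V) w"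
      "\<forall>x\<in>V. poly (s x) (w x) = 0" "w x0 = ?z"
    using local_root_function[OF deg cont x0, of ?z] l0 False by (auto simp: s0)
  have "ev (Suc k) (s x) (w x, 1) = 0" if "x \<in> V" for x
    using V(4) that deg[of x] openin_subset[OF V(1)] by (auto simp: ev_eq)
  then show ?thesis
    using V False by (intro exI[of _ V] exI[of _ "\<lambda>x. (w x, 1)"]) (auto simp: pt_def zero_prod_def)
next
  case True
  then have x: "fst v0 \<noteq> 0" using v0 by (cases v0) (auto simp: zero_prod_def)
  \<comment> \<open>zeros at infinity are zeros at \<open>0\<close> of the reversed polynomial\<close>
  define r where "r p = (\<Sum>i\<le>Suc k. monom (coeff p (Suc k - i)) i)" for p :: "complex poly"
  have coeff_r: "coeff (r p) i = (if i \<le> Suc k then coeff p (Suc k - i) else 0)" for p i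
    by (simp add: r_def coeff_sum)
  have poly_r: "poly (r p) u = ev (Suc k) p (1, u)" for p u
    unfolding r_def ev_altdef poly_sum poly_monom
    by (rule sum.reindex_bij_witness[of _ "\<lambda>i. Suc k - i" "\<lambda>i. Suc k - i"]) auto
  have deg_r: "degree (r p) \<le> Suc k" for p
    by (rule degree_le) (simp add: coeff_r)
  have cr: "pcont X (\<lambda>x. r (s x))"
    using cont by (simp add: pcont_def coeff_r)
  have lin0: "lin v0 = [:- fst v0:]" using True by (simp add: lin_def)
  have "coeff (s x0) (Suc k) = 0"
    using \<psi>(1) by (simp add: s0 lin0 coeff_eq_0)
  then have 1: "poly (r (s x0)) 0 = 0"
    by (simp add: poly_0_coeff_0 coeff_r)
  \<comment> \<open>The derivative at 0 is the coefficient of index 1, which reversal takes from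
    index \<open>k\<close> of \<open>s x0\<close>. As \<open>lin v0\<close> is constant here, it is
    a nonzero multiple of the top coefficient of \<open>\<psi>\<close>.\<close>
  have "poly (pderiv (r (s x0))) 0 = coeff (s x0) k"
    by (simp add: poly_0_coeff_0 coeff_pderiv coeff_r)
  also have "\<dots> \<noteq> 0"
    using \<psi> x True by (simp add: s0 lin0 ev_eq)
  finally obtain V w where V: "openin X V" "x0 \<in> V" "cts (subtopology X V) w"
      "\<forall>x\<in>V. poly (r (s x)) (w x) = 0" "w x0 = 0"
    using local_root_function[OF deg_r cr x0 1] by auto
  then show ?thesis
    using True by (intro exI[of _ V] exI[of _ "\<lambda>x. (1, w x)"]) (auto simp: poly_r pt_def zero_prod_def)
qed

section \<open>Coverings from local sections\<close>

lemma descend_class: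
  assumes "equiv A R" "x \<in> A" "\<And>y. (x, y) \<in> R \<Longrightarrow> f y = f x"
  shows "descend f (R `` {x}) = f x"
proof -
  have "f ` (R `` {x}) = {f x}"
  proof
    show "f ` (R `` {x}) \<subseteq> {f x}" using assms(3) by blast
    show "{f x} \<subseteq> f ` (R `` {x})" using equiv_class_self[OF assms(1,2)] by blast
  qed
  then show ?thesis by (simp add: descend_def)
qed

lemma descend_class_map:
  assumes "equiv A R" "equiv B T" "x \<in> A" "\<And>y. (x, y) \<in> R \<Longrightarrow> (f x, f y) \<in> T"
  shows "descend (\<lambda>x. T `` {f x}) (R `` {x}) = T `` {f x}"
proof (rule descend_class[OF assms(1,3)])
  fix y assume "(x, y) \<in> R"
  from equiv_class_eq[OF assms(2) assms(4)[OF this]] show "T `` {f y} = T `` {f x}" by simp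
qed

text \<open>
  The sheets \<open>U i\<close> are required to be open, so that the total space need not be known to be Hausdorff.
\<close>

definition sheets ::
  "'i set \<Rightarrow> ('i \<Rightarrow> 'a set) \<Rightarrow> ('i \<Rightarrow> 'b \<Rightarrow> 'a) \<Rightarrow> 'a topology \<Rightarrow> 'b topology \<Rightarrow> ('a \<Rightarrow> 'b) \<Rightarrow> 'b set \<Rightarrow> bool" where
  "sheets I U f X Y p V \<longleftrightarrow>
     (\<forall>i\<in>I. openin X (U i) \<and> continuous_map (subtopology Y V) X (f i) \<and>
        (\<forall>v\<in>V. f i v \<in> U i \<and> p (f i v) = v) \<and> (\<forall>x\<in>U i. p x \<in> V \<and> f i (p x) = x)) \<and>
     disjoint_family_on U I \<and> (\<forall>x\<in>topspace X. p x \<in> V \<longrightarrow> (\<exists>i\<in>I. x \<in> U i))"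

lemma covering_overI:
  assumes cont: "continuous_map X Y p" and B: "B \<subseteq> topspace Y"
    and loc: "\<And>y. y \<in> B \<Longrightarrow> \<exists>V (I :: 'i set) U f.
      openin Y V \<and> y \<in> V \<and> V \<subseteq> B \<and> finite I \<and> card I = N \<and> sheets I U f X Y p V"
  shows "covering_over N X Y p B"
  unfolding covering_over_def sheeted_covering_def
proof (intro conjI ballI)
  let ?X = "subtopology X {x \<in> topspace X. p x \<in> B}"
  show "continuous_map ?X (subtopology Y B) p"
    unfolding continuous_map_in_subtopology using continuous_map_from_subtopology[OF cont] by auto
  fix y assume "y \<in> topspace (subtopology Y B)"
  then have "y \<in> B" by simp
  from loc[OF this] obtain V and I :: "'i set" and U f where
    V: "openin Y V" "y \<in> V" "V \<subseteq> B" and I: "finite I" "card I = N" and *: "sheets I U f X Y p V"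
    by blast
  have disj: "disjoint_family_on U I" and cov: "\<And>x. x \<in> topspace X \<Longrightarrow> p x \<in> V \<Longrightarrow> \<exists>i\<in>I. x \<in> U i"
    using * unfolding sheets_def by blast+
  have U: "openin X (U i)" and f: "continuous_map (subtopology Y V) X (f i)"
    and fv: "\<And>v. v \<in> V \<Longrightarrow> f i v \<in> U i \<and> p (f i v) = v"
    and fu: "\<And>x. x \<in> U i \<Longrightarrow> p x \<in> V \<and> f i (p x) = x" if "i \<in> I" for i
    using * that unfolding sheets_def by blast+
  have UX: "U i \<subseteq> {x \<in> topspace X. p x \<in> B}" if "i \<in> I" for i
    using openin_subset[OF U[OF that]] fu[OF that] V(3) by blast
  \<comment> \<open>Each sheet contains the point \<open>f i y\<close>, so no sheet is empty and
    disjoint sheets with different indices are different sets. The cardinality of \<open>I\<close>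
    is thus the number of sheets.\<close>
  have inj: "inj_on U I"
  proof (rule inj_onI, rule ccontr)
    fix i j assume ij: "i \<in> I" "j \<in> I" "U i = U j" "i \<noteq> j"
    then have "f i y \<in> U i \<inter> U j" using fv V(2) by auto
    then show False using disj ij by (auto simp: disjoint_family_on_def)
  qed
  show "\<exists>V. openin (subtopology Y B) V \<and> y \<in> V \<and>
      (\<exists>\<U>. finite \<U> \<and> card \<U> = N \<and> pairwise disjnt \<U> \<and> \<Union>\<U> = {x \<in> topspace ?X. p x \<in> V} \<and>
         (\<forall>U\<in>\<U>. openin ?X U \<and> homeomorphic_map (subtopology ?X U) (subtopology (subtopology Y B) V) p))"
  proof (intro exI[of _ V] exI[of _ "U ` I"] conjI ballI)
    show "openin (subtopology Y B) V"
      using V(1,3) by (auto simp: openin_subtopology)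
    show "y \<in> V" "finite (U ` I)" using V I by auto
    show "card (U ` I) = N" using card_image[OF inj] I by simp
    show "pairwise disjnt (U ` I)"
    proof (rule pairwiseI)
      fix A B assume "A \<in> U ` I" "B \<in> U ` I" "A \<noteq> B"
      then obtain i j where "i \<in> I" "j \<in> I" "A = U i" "B = U j" "i \<noteq> j" by auto
      then show "disjnt A B" using disjoint_family_onD[OF disj, of i j] by (simp add: disjnt_def)
    qed
    show "\<Union>(U ` I) = {x \<in> topspace ?X. p x \<in> V}"
      using cov UX fu V(3) by auto
    fix W assume "W \<in> U ` I"
    then obtain i where i: "i \<in> I" "W = U i" by auto
    show "openin ?X W"
      unfolding i(2) openin_subtopology using U[OF i(1)] UX[OF i(1)] by (intro exI[of _ "U i"]) auto
    have sX: "subtopology ?X W = subtopology X W"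
      unfolding i(2) by (rule subtopology_nested[OF UX[OF i(1)]])
    have sY: "subtopology (subtopology Y B) V = subtopology Y V"
      by (rule subtopology_nested[OF V(3)])
    have "homeomorphic_maps (subtopology X W) (subtopology Y V) p (f i)"
      unfolding homeomorphic_maps_def continuous_map_in_subtopology i(2)
      using continuous_map_from_subtopology[OF cont, of "U i"] f[OF i(1)] fv[OF i(1)] fu[OF i(1)] by auto
    then show "homeomorphic_map (subtopology ?X W) (subtopology (subtopology Y B) V) p"
      unfolding sX sY homeomorphic_map_maps by blast
  qed
qed

text \<open>Each of the \<open>k\<close> simple zeros at \<open>x0\<close> is followed separately.
  As long as the moving points stay distinct they exhaust the zeros of a form of degree
  \<open>k\<close>, and only a scalar remains to be found.\<close>

lemma local_factorization:
  assumes deg: "\<And>x. x \<in> topspace X \<Longrightarrow> degree (s x) \<le> k" and cont: "pcont X s"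
    and x0: "x0 \<in> topspace X" and dist: "s x0 \<in> distinct_zeros (int k)"
  shows "\<exists>V c v. openin X V \<and> x0 \<in> V \<and> cts (subtopology X V) c \<and>
    (\<forall>j<k. cts (subtopology X V) (\<lambda>x. fst (v j x)) \<and>
           cts (subtopology X V) (\<lambda>x. snd (v j x))) \<and>
    (\<forall>x\<in>V. (\<forall>j<k. v j x \<noteq> 0) \<and> inj_on (\<lambda>j. pt (v j x)) {..<k} \<and> c x \<noteq> 0 \<and>
       s x = smult (c x) (\<Prod>j<k. lin (v j x)))"
proof -
  have nz0: "s x0 \<noteq> 0" using dist by (simp add: distinct_zeros_def)
  obtain c0 p where p: "c0 \<noteq> 0" "\<And>j. j < k \<Longrightarrow> p j \<noteq> 0" "s x0 = smult c0 (\<Prod>j<k. lin (p j))"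
    using form_factorization[OF deg[OF x0] nz0] by blast
  have injp: "inj_on (pt \<circ> p) {..<k}"
    using distinct_zeros_prod_iff[of "{..<k}" p c0] p dist by simp
  define Q where "Q j V v \<longleftrightarrow> openin X V \<and> x0 \<in> V \<and> cts (subtopology X V) (\<lambda>x. fst (v x)) \<and>
    cts (subtopology X V) (\<lambda>x. snd (v x)) \<and>
    (\<forall>x\<in>V. v x \<noteq> 0 \<and> ev k (s x) (v x) = 0) \<and> pt (v x0) = pt (p j)" for j V v
  have "\<exists>V v. Q j V v" if j: "j < k" for j
  proof -
    obtain l where l: "k = Suc l" using j by (cases k) auto
    let ?\<psi> = "smult c0 (\<Prod>i\<in>{..<k} - {j}. lin (p i))"
    have card: "card ({..<k} - {j}) = l" using j l by simp
    have "s x0 = lin (p j) * ?\<psi>"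
      using j p(3) by (simp add: prod.remove[of "{..<k}" j])
    moreover have "degree ?\<psi> \<le> l"
      using degree_prod_lin_le[of p "{..<k} - {j}"] card degree_smult_le[of c0] order_trans by metis
    moreover have "ev l ?\<psi> (p j) \<noteq> 0"
    proof -
      have "ev (\<Sum>i\<in>{..<k} - {j}. Suc 0) (\<Prod>i\<in>{..<k} - {j}. lin (p i)) (p j) =
          (\<Prod>i\<in>{..<k} - {j}. ev (Suc 0) (lin (p i)) (p j))"
        by (rule ev_prod) (auto simp: degree_lin_le)
      moreover have "ev (Suc 0) (lin (p i)) (p j) \<noteq> 0" if "i \<in> {..<k} - {j}" for i
        using inj_onD[OF injp, of i j] that j p(2) by (auto simp flip: pt_eq_iff)
      ultimately show ?thesis using card p(1) by (simp add: ev_smult)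
    qed
    ultimately show ?thesis
      using local_zero_function[of X s l x0 "p j" ?\<psi>] deg cont x0 p(2)[OF j] l by (simp add: Q_def)
  qed
  then obtain W v where Q: "\<And>j. j < k \<Longrightarrow> Q j (W j) (v j)" by metis
  then have W: "\<And>j. j < k \<Longrightarrow> openin X (W j)" "\<And>j. j < k \<Longrightarrow> x0 \<in> W j"
    and v1: "\<And>j. j < k \<Longrightarrow> cts (subtopology X (W j)) (\<lambda>x. fst (v j x))"
    and v2: "\<And>j. j < k \<Longrightarrow> cts (subtopology X (W j)) (\<lambda>x. snd (v j x))"
    and v: "\<And>j x. j < k \<Longrightarrow> x \<in> W j \<Longrightarrow> v j x \<noteq> 0 \<and> ev k (s x) (v j x) = 0"
    and ptv: "\<And>j. j < k \<Longrightarrow> pt (v j x0) = pt (p j)"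
    unfolding Q_def by blast+
  \<comment> \<open>Intersecting with the whole space takes care of \<open>k = 0\<close>, where the
    intersection over the empty index set is everything.\<close>
  define V1 where "V1 = topspace X \<inter> (\<Inter>j\<in>{..<k}. W j)"
  have oV1: "openin X V1"
    unfolding V1_def using W by (cases "k = 0") (auto intro!: openin_INT2 openin_Int)
  have x0V1: "x0 \<in> V1" using W x0 by (auto simp: V1_def)
  have V1W: "subtopology X V1 = subtopology (subtopology X (W j)) V1" if "j < k" for j
    by (rule subtopology_nested[symmetric]) (use that in \<open>auto simp: V1_def\<close>)
  have c1: "cts (subtopology X V1) (\<lambda>x. fst (v j x))" if "j < k" for j
    unfolding V1W[OF that] using v1[OF that] by (rule continuous_map_from_subtopology)
  have c2: "cts (subtopology X V1) (\<lambda>x. snd (v j x))" if "j < k" for j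
    unfolding V1W[OF that] using v2[OF that] by (rule continuous_map_from_subtopology)
  have pl: "pcont (subtopology X V1) (\<lambda>x. \<Prod>j<k. lin (v j x))"
    by (intro pcont_prod pcont_lin c1 c2) auto
  have vV1: "v j x \<noteq> 0" "ev k (s x) (v j x) = 0" if "j < k" "x \<in> V1" for j x
    using v[OF that(1), of x] that by (auto simp: V1_def)
  have "(\<Prod>j<k. lin (v j x0)) \<noteq> 0"
    using vV1 x0V1 by (intro prod_lin_nonzero) auto
  \<comment> \<open>A fixed coefficient that is nonzero at \<open>x0\<close>; the scalar will be
    read off from it.\<close>
  then obtain l where l: "coeff (\<Prod>j<k. lin (v j x0)) l \<noteq> 0"
    by (metis coeff_0 poly_eq_iff)
  define Pr where "Pr = {q \<in> {..<k} \<times> {..<k}. fst q \<noteq> snd q}"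
  have fin: "finite Pr" by (simp add: Pr_def)
  \<comment> \<open>All conditions still to be imposed are gathered in one continuous function: the
    \<open>l\<close>-th coefficients of both sides are nonzero and the moving zeros are pairwise
    distinct.\<close>
  define g where "g x = coeff (s x) l * coeff (\<Prod>j<k. lin (v j x)) l *
      (\<Prod>q\<in>Pr. ev (Suc 0) (lin (v (fst q) x)) (v (snd q) x))" for x
  have "cts (subtopology X V1) (\<lambda>x. \<Prod>q\<in>Pr. ev (Suc 0) (lin (v (fst q) x)) (v (snd q) x))"
    by (rule continuous_map_product, rule continuous_map_ev) (auto simp: Pr_def intro!: pcont_lin c1 c2)
  then have "cts (subtopology X V1) g"
    unfolding g_def using pl pcont_subtopology[OF cont, of V1]
    by (intro continuous_map_mult) (auto simp: pcont_def)
  then have og: "openin (subtopology X V1) {x \<in> topspace (subtopology X V1). g x \<noteq> 0}"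
    by (rule openin_nonzero)
  define V where "V = {x \<in> V1. g x \<noteq> 0}"
  have "V = {x \<in> topspace (subtopology X V1). g x \<noteq> 0}"
    using openin_subset[OF oV1] by (auto simp: V_def)
  then have oV: "openin X V" using og oV1 openin_trans_full by metis
  have VV1: "V \<subseteq> V1" by (auto simp: V_def)
  have sub: "subtopology X V = subtopology (subtopology X V1) V"
    by (rule subtopology_nested[OF VV1, symmetric])
  have injx0: "pt (v i x0) \<noteq> pt (v j x0)" if "i < k" "j < k" "i \<noteq> j" for i j
    using inj_onD[OF injp, of i j] that by (auto simp: ptv)
  have nonpar: "(\<forall>q\<in>Pr. ev (Suc 0) (lin (v (fst q) x)) (v (snd q) x) \<noteq> 0) \<longleftrightarrow>
      inj_on (\<lambda>j. pt (v j x)) {..<k}" if "x \<in> V1" for x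
  proof -
    have "(\<forall>q\<in>Pr. ev (Suc 0) (lin (v (fst q) x)) (v (snd q) x) \<noteq> 0) \<longleftrightarrow>
        (\<forall>q\<in>Pr. pt (v (fst q) x) \<noteq> pt (v (snd q) x))"
      using vV1(1)[OF _ that] by (intro ball_cong) (auto simp: Pr_def pt_eq_iff)
    also have "\<dots> \<longleftrightarrow> inj_on (\<lambda>j. pt (v j x)) {..<k}"
      by (auto simp: Pr_def inj_on_def)
    finally show ?thesis .
  qed
  have fact: "\<exists>c. s x = smult c (\<Prod>j<k. lin (v j x))" if "x \<in> V1" "inj_on (\<lambda>j. pt (v j x)) {..<k}" for x
    by (rule form_eq_prod_of_zeros[OF deg])
      (use vV1[OF _ that(1)] that openin_subset[OF oV1] in \<open>auto simp: o_def\<close>)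
  have inj0: "inj_on (\<lambda>j. pt (v j x0)) {..<k}"
    using injx0 by (auto simp: inj_on_def)
  obtain c' where c': "s x0 = smult c' (\<Prod>j<k. lin (v j x0))"
    using fact[OF x0V1 inj0] by blast
  then have "coeff (s x0) l \<noteq> 0"
    using nz0 l by auto
  then have "g x0 \<noteq> 0"
    unfolding g_def using l fin nonpar[OF x0V1] inj0 by simp
  then have x0V: "x0 \<in> V" using x0V1 by (simp add: V_def)
  \<comment> \<open>The proportionality factor as a quotient of \<open>l\<close>-th coefficients,
    which makes its continuity visible.\<close>
  define c where "c x = coeff (s x) l / coeff (\<Prod>j<k. lin (v j x)) l" for x
  have "cts (subtopology X V) c"
    unfolding c_def sub
    using pcont_subtopology[OF pl, of V] pcont_subtopology[OF pcont_subtopology[OF cont, of V1], of V]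
    by (intro continuous_map_divide) (auto simp: pcont_def V_def g_def)
  moreover have "cts (subtopology X V) (\<lambda>x. fst (v j x))"
      "cts (subtopology X V) (\<lambda>x. snd (v j x))" if "j < k" for j
    unfolding sub using c1[OF that] c2[OF that] by (auto intro: continuous_map_from_subtopology)
  moreover have "(\<forall>j<k. v j x \<noteq> 0) \<and> inj_on (\<lambda>j. pt (v j x)) {..<k} \<and> c x \<noteq> 0 \<and>
       s x = smult (c x) (\<Prod>j<k. lin (v j x))" if x: "x \<in> V" for x
  proof -
    have xV1: "x \<in> V1" and cs: "coeff (s x) l \<noteq> 0" and cp: "coeff (\<Prod>j<k. lin (v j x)) l \<noteq> 0"
      and np: "\<forall>q\<in>Pr. ev (Suc 0) (lin (v (fst q) x)) (v (snd q) x) \<noteq> 0"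
      using x fin by (auto simp: V_def g_def)
    have inj: "inj_on (\<lambda>j. pt (v j x)) {..<k}" using np nonpar[OF xV1] by blast
    obtain c' where c': "s x = smult c' (\<Prod>j<k. lin (v j x))"
      using fact[OF xV1 inj] by blast
    then have "c' = c x"
      using cp by (simp add: c_def)
    moreover have "c x \<noteq> 0"
      using cs cp by (simp add: c_def)
    ultimately show ?thesis
      using c' inj vV1(1)[OF _ xV1] by simp
  qed
  ultimately show ?thesis
    using oV x0V by blast
qed

section \<open>The Hitchin map as a covering\<close>

lemma degree_le_iff_H0: "m \<ge> 0 \<Longrightarrow> s \<in> H0 m \<longleftrightarrow> degree s \<le> nat m"
  by (auto simp: H0_def)

lemma image_class_iff:
  assumes "equiv A R" "U \<subseteq> A" "\<And>x y. x \<in> U \<Longrightarrow> (x, y) \<in> R \<Longrightarrow> y \<in> U" "x \<in> A"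
  shows "R `` {x} \<in> (\<lambda>x. R `` {x}) ` U \<longleftrightarrow> x \<in> U"
proof
  assume "R `` {x} \<in> (\<lambda>x. R `` {x}) ` U"
  then obtain y where y: "y \<in> U" "R `` {x} = R `` {y}" by blast
  then have "(y, x) \<in> R"
    using equiv_class_self[OF assms(1,4)] by blast
  then show "x \<in> U" using assms(3) y by blast
qed auto

lemma ev_prod_lin:
  assumes "finite J" "card J = k"
  shows "ev k (smult e (\<Prod>j\<in>J. lin (v j))) u = e * (\<Prod>j\<in>J. ev (Suc 0) (lin (v j)) u)"
proof -
  have "ev (\<Sum>j\<in>J. Suc 0) (\<Prod>j\<in>J. lin (v j)) u = (\<Prod>j\<in>J. ev (Suc 0) (lin (v j)) u)"
    by (rule ev_prod) (auto simp: assms degree_lin_le)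
  then show ?thesis using assms by (simp add: ev_smult)
qed

text \<open>The slope arguments reach the remaining development only through these assumptions:
  stability becomes the nonvanishing of the first \<open>n - 1\<close> maps.\<close>

locale quiver_moduli =
  fixes n :: nat and d :: "nat \<Rightarrow> int" and t :: int
  assumes n2: "n \<ge> 2" and nonneg: "\<And>i. i \<in> {1..n} \<Longrightarrow> map_degree n d t i \<ge> 0"
    and stable_iff: "\<And>\<phi>. \<phi> \<in> stable_reps n d t \<longleftrightarrow> \<phi> \<in> reps n d t \<and> (\<forall>i\<in>{1..<n}. \<phi> i \<noteq> 0)"
begin

declare One_nat_def [simp del]

abbreviation m where "m i \<equiv> nat (map_degree n d t i)"
abbreviation stab where "stab \<equiv> stable_reps n d t"
abbreviation iso where "iso \<equiv> rep_iso n d t"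
abbreviation coords :: "(nat \<Rightarrow> complex poly) \<Rightarrow> nat \<times> nat \<Rightarrow> complex"
  where "coords \<equiv> \<lambda>\<phi> (i, k). coeff (\<phi> i) k"
abbreviation S where "S \<equiv> embedded_variety stab coords"
abbreviation M where "M \<equiv> moduli n d t"
abbreviation N where "N \<equiv> int n * t"
abbreviation cls where "cls \<phi> \<equiv> iso `` {\<phi>}"

definition K where "K = (\<Sum>i=1..n. m i)"

abbreviation P where "P \<phi> \<equiv> \<Prod>i=1..n. \<phi> i"
abbreviation perms where "perms \<equiv> permutations_of_multiset (type_mset n m)"

lemma K_eq: "int K = N"
proof -
  have "int K = (\<Sum>i=1..n. map_degree n d t i)"
    unfolding K_def of_nat_sum using nonneg by (intro sum.cong) auto
  then show ?thesis using sum_map_degree[of n d t] n2 by simp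
qed

lemma H0_iff: "s \<in> H0 N \<longleftrightarrow> degree s \<le> K"
  unfolding K_eq[symmetric] by (subst degree_le_iff_H0) simp_all

lemma pcont_H0: "pcont (an (H0_variety N)) (\<lambda>s. s)"
  unfolding pcont_def H0_variety_def by (intro allI continuous_map_coord_embedded)

lemma eta_eq: "eta n d t = card perms"
  unfolding eta_def card_permutations_type_mset K_eq[symmetric] nat_int K_def ..

lemma stab_iff: "\<phi> \<in> stab \<longleftrightarrow> (\<forall>i\<in>{1..n}. degree (\<phi> i) \<le> m i) \<and> (\<forall>i. i \<notin> {1..n} \<longrightarrow> \<phi> i = 0) \<and>
    (\<forall>i\<in>{1..<n}. \<phi> i \<noteq> 0)"
  unfolding stable_iff reps_def using degree_le_iff_H0[OF nonneg] by auto

lemma stab_degree: "\<phi> \<in> stab \<Longrightarrow> i \<in> {1..n} \<Longrightarrow> degree (\<phi> i) \<le> m i"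
  by (simp add: stab_iff)

lemma degree_P: "\<phi> \<in> stab \<Longrightarrow> degree (P \<phi>) \<le> K"
  unfolding K_def by (rule degree_prod_le_sum) (simp add: stab_degree)

lemma prod_nodes: "(\<Prod>i=1..n. f i) = (\<Prod>i\<in>{1..<n}. f i) * (f n :: 'b :: comm_monoid_mult)"
proof -
  have "{1..n} = insert n {1..<n}" using n2 by auto
  then show ?thesis by (simp add: mult.commute)
qed

text \<open>The quotients \<open>g (nxt n i) / g i\<close> multiply to 1 around the cycle.
  Conversely the partial products \<open>g i\<close> of the \<open>l j\<close> with
  \<open>j < i\<close> solve the equations for the arrows before the last, and the product condition
  is exactly the equation for the arrow that closes the cycle.\<close>

lemma iso_iff:
  "(\<phi>, \<psi>) \<in> iso \<longleftrightarrow> \<phi> \<in> stab \<and> \<psi> \<in> stab \<and>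
    (\<exists>l. (\<forall>i\<in>{1..n}. l i \<noteq> 0 \<and> \<psi> i = smult (l i) (\<phi> i)) \<and> (\<Prod>i=1..n. l i) = 1)"
proof safe
  assume "(\<phi>, \<psi>) \<in> iso"
  then show "\<phi> \<in> stab" "\<psi> \<in> stab" by (auto simp: rep_iso_def)
  from \<open>(\<phi>, \<psi>) \<in> iso\<close> obtain g where g: "\<forall>i\<in>{1..n}. g i \<noteq> 0 \<and> \<psi> i = smult (g (nxt n i) / g i) (\<phi> i)"
    by (auto simp: rep_iso_def)
  have nxt: "nxt n i \<in> {1..n}" if "i \<in> {1..n}" for i
    using that by (auto simp: nxt_def)
  have "(\<Prod>i=1..n. g (nxt n i)) = (\<Prod>i=1..n. g i)"
    by (rule prod.reindex_bij_witness[of _ "\<lambda>i. if i = 1 then n else i - 1" "nxt n"])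
      (use n2 in \<open>auto simp: nxt_def\<close>)
  then have "(\<Prod>i=1..n. g (nxt n i) / g i) = 1"
    using g by (simp add: prod_dividef)
  then show "\<exists>l. (\<forall>i\<in>{1..n}. l i \<noteq> 0 \<and> \<psi> i = smult (l i) (\<phi> i)) \<and> (\<Prod>i=1..n. l i) = 1"
    using g nxt by (intro exI[of _ "\<lambda>i. g (nxt n i) / g i"]) auto
next
  fix l assume st: "\<phi> \<in> stab" "\<psi> \<in> stab"
    and l: "\<forall>i\<in>{1..n}. l i \<noteq> 0 \<and> \<psi> i = smult (l i) (\<phi> i)" "(\<Prod>i=1..n. l i) = 1"
  define g where "g i = (\<Prod>j\<in>{1..<i}. l j)" for i
  have g0: "g i \<noteq> 0" if "i \<in> {1..n}" for i
    using l(1) that by (auto simp: g_def)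
  have "g (nxt n i) / g i = l i" if i: "i \<in> {1..n}" for i
  proof (cases "i = n")
    case True
    have "g n * l n = 1" using l(2) unfolding prod_nodes g_def .
    then show ?thesis using True g0[OF i] by (simp add: nxt_def g_def field_simps)
  next
    case False
    have "{1..<i + 1} = insert i {1..<i}" using i by auto
    then have "g (i + 1) = l i * g i" by (simp add: g_def)
    then show ?thesis using False g0[OF i] by (simp add: nxt_def)
  qed
  then show "(\<phi>, \<psi>) \<in> iso"
    using st l(1) g0 unfolding rep_iso_def by (auto intro!: exI[of _ g])
qed

lemma equiv_iso: "equiv stab iso" by (rule equiv_rep_iso)

lemma iso_P: "(\<phi>, \<psi>) \<in> iso \<Longrightarrow> P \<psi> = P \<phi>"
proof -
  assume "(\<phi>, \<psi>) \<in> iso"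
  then obtain l where l: "\<forall>i\<in>{1..n}. l i \<noteq> 0 \<and> \<psi> i = smult (l i) (\<phi> i)" "(\<Prod>i=1..n. l i) = 1"
    unfolding iso_iff by blast
  have "P \<psi> = (\<Prod>i=1..n. smult (l i) (\<phi> i))"
    using l by (intro prod.cong) auto
  also have "\<dots> = smult (\<Prod>i=1..n. l i) (P \<phi>)"
    by (simp add: prod_smult)
  finally show ?thesis using l by simp
qed

lemma hitchin_cls: "\<phi> \<in> stab \<Longrightarrow> hitchin_map n (cls \<phi>) = P \<phi>"
  unfolding hitchin_map_def
  using descend_class[OF equiv_iso, of \<phi> "hitchin n"] iso_P n2 by (simp add: hitchin_eq_prod)

lemma an_M: "an M = quotient_topology (an S) iso"
  by (simp add: moduli_def an_quotient)

lemma topspace_M: "topspace (an M) = stab // iso" "points M = stab // iso"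
  by (simp_all add: moduli_def)

lemma in_M_iff: "C \<in> stab // iso \<longleftrightarrow> (\<exists>\<phi>\<in>stab. C = cls \<phi>)"
  by (auto simp: quotient_def)

lemma continuous_map_into_S:
  "continuous_map T (an S) f \<longleftrightarrow> f ` topspace T \<subseteq> stab \<and> (\<forall>i. pcont T (\<lambda>x. f x i))"
  unfolding continuous_map_into_embedded pcont_def by auto

lemma pcont_S: "pcont (an S) (\<lambda>\<phi>. \<phi> i)"
proof -
  have "continuous_map (an S) (an S) id" by simp
  then show ?thesis unfolding continuous_map_into_S by simp
qed

lemma continuous_map_cls: "continuous_map T (an S) f \<Longrightarrow> continuous_map T (an M) (\<lambda>x. cls (f x))"
  unfolding an_M by (rule continuous_map_to_quotient)

lemma openin_M_iff: "openin (an M) W \<longleftrightarrow> W \<subseteq> stab // iso \<and> openin (an S) {\<phi> \<in> stab. cls \<phi> \<in> W}"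
  unfolding an_M openin_quotient_topology by simp

text \<open>A set closed under isomorphism is the full preimage of its set of classes, so openness
  upstairs is openness in the quotient.\<close>

lemma openin_cls_image:
  assumes "openin (an S) U" "\<And>\<phi> \<psi>. \<phi> \<in> U \<Longrightarrow> (\<phi>, \<psi>) \<in> iso \<Longrightarrow> \<psi> \<in> U"
  shows "openin (an M) (cls ` U)"
proof -
  have U: "U \<subseteq> stab" using openin_subset[OF assms(1)] by simp
  have "cls \<phi> \<in> cls ` U \<longleftrightarrow> \<phi> \<in> U" if "\<phi> \<in> stab" for \<phi>
    by (rule image_class_iff[OF equiv_iso U _ that]) (rule assms(2))
  then have "{\<phi> \<in> stab. cls \<phi> \<in> cls ` U} = U"
    using U by blast
  moreover have "cls ` U \<subseteq> stab // iso" using U by (auto intro: quotientI)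
  ultimately show ?thesis
    unfolding openin_M_iff using assms(1) by simp
qed

lemma rational_on_coeff_prod:
  assumes "\<And>i k. i \<in> A \<Longrightarrow> rational_on V c (\<lambda>z. coeff (f i z) k)"
  shows "rational_on V c (\<lambda>z. coeff (\<Prod>i\<in>A. f i z) k)"
  using assms
proof (induction A arbitrary: k rule: infinite_finite_induct)
  case (insert x A)
  then show ?case
    by (simp add: coeff_mult) (intro rational_on_sum rational_on_mult; simp)
qed (simp_all add: rational_on_const)

lemma coords_rational: "rational_on V coords (\<lambda>\<phi>. coeff (\<phi> i) k)"
  using rational_on_coord[of V coords "(i, k)"] by simp

lemma P_in_H0: "\<phi> \<in> stab \<Longrightarrow> P \<phi> \<in> H0 N"
  unfolding H0_iff by (rule degree_P)

lemma hitchin_morphism: "variety_morphism M (H0_variety N) (hitchin_map n)"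
  unfolding moduli_def H0_variety_def
proof (rule variety_morphism_from_quotient[where f = P])
  show "variety_morphism S (embedded_variety (H0 N) coeff) P"
    by (rule variety_morphism_rationalI, use P_in_H0 in blast, rule rational_on_coeff_prod, rule coords_rational)
qed (rule hitchin_cls)

lemma continuous_hitchin: "continuous_map (an M) (an (H0_variety N)) (hitchin_map n)"
  using hitchin_morphism by (simp add: variety_morphism_def)

lemma continuous_P: "continuous_map (an S) (an (H0_variety N)) P"
  unfolding H0_variety_def continuous_map_into_embedded
  using P_in_H0 pcont_prod[of "{1..n}" "an S" "\<lambda>i \<phi>. \<phi> i"] pcont_S by (auto simp: pcont_def)

text \<open>
  The representation whose map at node \<open>i\<close> has the zeros \<open>v j\<close> with \<open>\<sigma> ! j = i\<close>; up to isomorphism the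
  remaining scalar \<open>c\<close> may be put at the last node.
\<close>

definition mk :: "complex \<Rightarrow> (nat \<Rightarrow> complex \<times> complex) \<Rightarrow> nat list \<Rightarrow> nat \<Rightarrow> complex poly" where
  "mk c v \<sigma> i = (if i \<in> {1..n} then
     smult (if i = n then c else 1) (\<Prod>j\<in>{j. j < K \<and> \<sigma> ! j = i}. lin (v j)) else 0)"

lemma perms_length: "\<sigma> \<in> perms \<Longrightarrow> length \<sigma> = K"
  unfolding permutations_of_multiset_def K_def size_type_mset[symmetric] by (metis mem_Collect_eq size_mset)

lemma perms_nth: "\<sigma> \<in> perms \<Longrightarrow> j < K \<Longrightarrow> \<sigma> ! j \<in> {1..n}"
  using perms_length[of \<sigma>] by (auto simp: permutations_type_mset_iff subset_iff)

lemma perms_card: "\<sigma> \<in> perms \<Longrightarrow> i \<in> {1..n} \<Longrightarrow> card {j. j < K \<and> \<sigma> ! j = i} = m i"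
  using card_positions[of \<sigma> i] perms_length[of \<sigma>] by (simp add: permutations_type_mset_iff)

lemma mk_in_stab:
  assumes "\<sigma> \<in> perms" "\<And>j. j < K \<Longrightarrow> v j \<noteq> 0"
  shows "mk c v \<sigma> \<in> stab"
  unfolding stab_iff
proof (intro conjI ballI allI impI)
  fix i assume "i \<in> {1..n}"
  then show "degree (mk c v \<sigma> i) \<le> m i"
    using degree_prod_lin_le[of v "{j. j < K \<and> \<sigma> ! j = i}"] perms_card[OF assms(1)]
    by (auto simp: mk_def intro: order_trans[OF degree_smult_le])
next
  fix i assume "i \<in> {1..<n}"
  then show "mk c v \<sigma> i \<noteq> 0"
    using assms(2) by (auto simp: mk_def)
next
  fix i assume "i \<notin> {1..n}"
  then show "mk c v \<sigma> i = 0" unfolding mk_def by (rule if_not_P)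
qed

lemma P_mk:
  assumes "\<sigma> \<in> perms"
  shows "P (mk c v \<sigma>) = smult c (\<Prod>j<K. lin (v j))"
proof -
  have "P (mk c v \<sigma>) = (\<Prod>i=1..n. smult (if i = n then c else 1) (\<Prod>j\<in>{j\<in>{..<K}. \<sigma> ! j = i}. lin (v j)))"
    by (rule prod.cong) (auto simp: mk_def)
  also have "\<dots> = smult (\<Prod>i=1..n. if i = n then c else 1) (\<Prod>i=1..n. \<Prod>j\<in>{j\<in>{..<K}. \<sigma> ! j = i}. lin (v j))"
    by (simp add: prod_smult)
  also have "(\<Prod>i=1..n. if i = n then c else 1) = c"
    using n2 by simp
  also have "(\<Prod>i=1..n. \<Prod>j\<in>{j\<in>{..<K}. \<sigma> ! j = i}. lin (v j)) = (\<Prod>j<K. lin (v j))"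
    by (rule prod.group) (use perms_nth[OF assms] in auto)
  finally show ?thesis .
qed

text \<open>\<open>factor_assignment\<close> determines \<open>\<phi>\<close> up to one scalar per
  node. Since \<open>\<phi>\<close> and the model \<open>mk c v \<sigma>\<close> have the same
  nonzero product, the scalars \<open>l i\<close> relating them multiply to 1, which is what an
  isomorphism requires.\<close>

lemma classify:
  assumes \<phi>: "\<phi> \<in> stab" and eq: "P \<phi> = smult c (\<Prod>j<K. lin (v j))"
    and c: "c \<noteq> 0" and v: "\<And>j. j < K \<Longrightarrow> v j \<noteq> 0"
  obtains \<sigma> e where "\<sigma> \<in> perms" "(mk c v \<sigma>, \<phi>) \<in> iso"
    "\<And>i. i \<in> {1..n} \<Longrightarrow> e i \<noteq> 0 \<and> \<phi> i = smult (e i) (\<Prod>j\<in>{j. j < K \<and> \<sigma> ! j = i}. lin (v j))"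
proof -
  have "P \<phi> \<noteq> 0" unfolding eq using c v by simp
  then have nz: "\<phi> i \<noteq> 0" if "i \<in> {1..n}" for i using that by auto
  obtain \<sigma> e where \<sigma>: "length \<sigma> = K" "set \<sigma> \<subseteq> {1..n}" "\<forall>i\<in>{1..n}. count (mset \<sigma>) i = m i"
    and e: "\<And>i. i \<in> {1..n} \<Longrightarrow> e i \<noteq> 0 \<and> \<phi> i = smult (e i) (\<Prod>j\<in>{j. j < K \<and> \<sigma> ! j = i}. lin (v j))"
    using factor_assignment[OF finite_atLeastAtMost stab_degree[OF \<phi>] nz eq v K_def[symmetric]] by blast
  have perm: "\<sigma> \<in> perms" using \<sigma> by (simp add: permutations_type_mset_iff)
  \<comment> \<open>The division by \<open>c\<close> at the last node compensates for
    \<open>mk\<close>, which puts the whole scalar there.\<close>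
  define l where "l i = e i / (if i = n then c else 1)" for i
  have l: "l i \<noteq> 0 \<and> \<phi> i = smult (l i) (mk c v \<sigma> i)" if "i \<in> {1..n}" for i
    using e[OF that] c that by (auto simp: l_def mk_def)
  have "smult c (\<Prod>j<K. lin (v j)) = (\<Prod>i=1..n. smult (l i) (mk c v \<sigma> i))"
    unfolding eq[symmetric] using l by (intro prod.cong) auto
  also have "\<dots> = smult (\<Prod>i=1..n. l i) (smult c (\<Prod>j<K. lin (v j)))"
    using P_mk[OF perm, of c v] by (simp add: prod_smult)
  finally have "smult c (\<Prod>j<K. lin (v j)) = smult ((\<Prod>i=1..n. l i) * c) (\<Prod>j<K. lin (v j))"
    by simp
  then have "smult (c - (\<Prod>i=1..n. l i) * c) (\<Prod>j<K. lin (v j)) = 0"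
    by (simp only: smult_diff_left diff_self)
  then have "c = (\<Prod>i=1..n. l i) * c"
    using v by simp
  then have "(\<Prod>i=1..n. l i) = 1" using c by simp
  moreover have "mk c v \<sigma> \<in> stab" by (rule mk_in_stab[OF perm]) (rule v)
  ultimately have "(mk c v \<sigma>, \<phi>) \<in> iso"
    unfolding iso_iff using l \<phi> by blast
  with perm e that show ?thesis by blast
qed

lemma fibre_eq:
  assumes "c \<noteq> 0" "\<And>j. j < K \<Longrightarrow> v j \<noteq> 0"
  shows "{C \<in> topspace (an M). hitchin_map n C = smult c (\<Prod>j<K. lin (v j))} =
    (\<lambda>\<sigma>. cls (mk c v \<sigma>)) ` perms" (is "?F = ?G")
proof
  show "?F \<subseteq> ?G"
  proof
    fix C assume "C \<in> ?F"
    then obtain \<phi> where \<phi>: "\<phi> \<in> stab" "C = cls \<phi>" "P \<phi> = smult c (\<Prod>j<K. lin (v j))"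
      by (auto simp: topspace_M in_M_iff hitchin_cls)
    obtain \<sigma> where "\<sigma> \<in> perms" "(mk c v \<sigma>, \<phi>) \<in> iso"
      using classify[OF \<phi>(1,3) assms] by blast
    then show "C \<in> ?G"
      using \<phi>(2) equiv_class_eq[OF equiv_iso] by blast
  qed
  show "?G \<subseteq> ?F"
  proof
    fix C assume "C \<in> ?G"
    then obtain \<sigma> where \<sigma>: "\<sigma> \<in> perms" "C = cls (mk c v \<sigma>)" by blast
    have "mk c v \<sigma> \<in> stab" by (rule mk_in_stab[OF \<sigma>(1)]) (rule assms(2))
    then show "C \<in> ?F"
      by (simp add: \<sigma>(2) topspace_M quotientI hitchin_cls P_mk[OF \<sigma>(1)])
  qed
qed

lemma continuous_mk:
  assumes \<sigma>: "\<sigma> \<in> perms" and c: "cts T c"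
    and v: "\<And>j. j < K \<Longrightarrow> cts T (\<lambda>x. fst (v j x))"
      "\<And>j. j < K \<Longrightarrow> cts T (\<lambda>x. snd (v j x))"
    and nz: "\<And>x j. x \<in> topspace T \<Longrightarrow> j < K \<Longrightarrow> v j x \<noteq> 0"
  shows "continuous_map T (an S) (\<lambda>x. mk (c x) (\<lambda>j. v j x) \<sigma>)"
  unfolding continuous_map_into_S
proof (intro conjI allI)
  show "(\<lambda>x. mk (c x) (\<lambda>j. v j x) \<sigma>) ` topspace T \<subseteq> stab"
  proof
    fix \<phi> assume "\<phi> \<in> (\<lambda>x. mk (c x) (\<lambda>j. v j x) \<sigma>) ` topspace T"
    then obtain x where x: "x \<in> topspace T" "\<phi> = mk (c x) (\<lambda>j. v j x) \<sigma>" by blast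
    show "\<phi> \<in> stab" unfolding x(2) by (rule mk_in_stab[OF \<sigma>]) (rule nz[OF x(1)])
  qed
  fix i
  have lins: "pcont T (\<lambda>x. \<Prod>j\<in>{j. j < K \<and> \<sigma> ! j = i}. lin (v j x))"
    by (rule pcont_prod, rule pcont_lin) (simp_all add: v)
  have "cts T (\<lambda>x. if i = n then c x else 1)"
    using c by (cases "i = n") auto
  then have "pcont T (\<lambda>x. smult (if i = n then c x else 1) (\<Prod>j\<in>{j. j < K \<and> \<sigma> ! j = i}. lin (v j x)))"
    by (rule pcont_smult[OF _ lins])
  then show "pcont T (\<lambda>x. mk (c x) (\<lambda>j. v j x) \<sigma> i)"
    unfolding mk_def by (cases "i \<in> {1..n}") (simp_all only: if_True if_False pcont_const)
qed

lemma hitchin_covering: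
  "covering_over (eta n d t) (an M) (an (H0_variety N)) (hitchin_map n) (distinct_zeros N)"
proof (rule covering_overI[where 'i = "nat list", OF continuous_hitchin])
  let ?Y = "an (H0_variety N)"
  have tY: "topspace ?Y = H0 N" by (simp add: H0_variety_def)
  show "distinct_zeros N \<subseteq> topspace ?Y"
    unfolding tY distinct_zeros_def by blast
  fix s0 assume s0: "s0 \<in> distinct_zeros N"
  have s0Y: "s0 \<in> topspace ?Y" using s0 unfolding tY distinct_zeros_def by blast
  have "\<exists>V c v. openin ?Y V \<and> s0 \<in> V \<and> cts (subtopology ?Y V) c \<and>
      (\<forall>j<K. cts (subtopology ?Y V) (\<lambda>x. fst (v j x)) \<and>
             cts (subtopology ?Y V) (\<lambda>x. snd (v j x))) \<and>
      (\<forall>s\<in>V. (\<forall>j<K. v j s \<noteq> 0) \<and> inj_on (\<lambda>j. pt (v j s)) {..<K} \<and> c s \<noteq> 0 \<and>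
         s = smult (c s) (\<Prod>j<K. lin (v j s)))" (is "\<exists>V c v. ?Q V c v")
    by (rule local_factorization[of ?Y "\<lambda>s. s" K s0]) (use H0_iff pcont_H0 s0Y s0 K_eq tY in simp_all)
  then obtain V c v where *: "?Q V c v" by (elim exE) (rule that)
  have V: "openin ?Y V" "s0 \<in> V" and c: "cts (subtopology ?Y V) c"
    and v: "\<And>j. j < K \<Longrightarrow> cts (subtopology ?Y V) (\<lambda>x. fst (v j x))"
           "\<And>j. j < K \<Longrightarrow> cts (subtopology ?Y V) (\<lambda>x. snd (v j x))"
    using * by blast+
  have v0: "\<And>j. j < K \<Longrightarrow> v j s \<noteq> 0" and inj: "inj_on (\<lambda>j. pt (v j s)) {..<K}" and c0: "c s \<noteq> 0"
    and fact: "s = smult (c s) (\<Prod>j<K. lin (v j s))" if "s \<in> V" for s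
    using * that by blast+
  have VY: "V \<subseteq> topspace ?Y" using V(1) by (rule openin_subset)
  have VD: "V \<subseteq> distinct_zeros N"
  proof
    fix s assume s: "s \<in> V"
    show "s \<in> distinct_zeros N"
      unfolding K_eq[symmetric]
      using distinct_zeros_prod_iff[of "{..<K}" "\<lambda>j. v j s" "c s"] v0[OF s] c0[OF s] inj[OF s]
      by (subst fact[OF s]) (simp add: o_def)
  qed
  have nonpar: "ev (Suc 0) (lin (v i s)) (v j s) \<noteq> 0" if "s \<in> V" "i < K" "j < K" "i \<noteq> j" for s i j
    using inj_onD[OF inj[OF that(1)], of i j] that v0[OF that(1)] by (auto simp flip: pt_eq_iff)
  define W where "W = {\<phi> \<in> stab. P \<phi> \<in> V}"
  have oW: "openin (an S) W"
    using openin_continuous_map_preimage[OF continuous_P V(1)] by (simp add: W_def)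
  define f where "f \<sigma> s = cls (mk (c s) (\<lambda>j. v j s) \<sigma>)" for \<sigma> s
  \<comment> \<open>a representation is on the sheet \<open>\<sigma>\<close> iff \<open>\<phi> i\<close> is nonzero at the zeros given to other nodes, which is an open condition\<close>
  define Uz where "Uz \<sigma> = {\<phi> \<in> W. \<forall>j<K. \<forall>i\<in>{1..n}. i \<noteq> \<sigma> ! j \<longrightarrow> ev (m i) (\<phi> i) (v j (P \<phi>)) \<noteq> 0}" for \<sigma>
  have key: "\<exists>\<sigma>\<in>perms. (mk (c (P \<phi>)) (\<lambda>j. v j (P \<phi>)) \<sigma>, \<phi>) \<in> iso \<and> (\<forall>\<tau>\<in>perms. \<phi> \<in> Uz \<tau> \<longleftrightarrow> \<tau> = \<sigma>)"
    if "\<phi> \<in> W" for \<phi>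
  proof -
    have \<phi>: "\<phi> \<in> stab" "P \<phi> \<in> V" using that by (auto simp: W_def)
    obtain \<sigma> e where \<sigma>: "\<sigma> \<in> perms" "(mk (c (P \<phi>)) (\<lambda>j. v j (P \<phi>)) \<sigma>, \<phi>) \<in> iso"
      and e: "\<And>i. i \<in> {1..n} \<Longrightarrow> e i \<noteq> 0 \<and> \<phi> i = smult (e i) (\<Prod>j\<in>{j. j < K \<and> \<sigma> ! j = i}. lin (v j (P \<phi>)))"
      using classify[OF \<phi>(1) fact[OF \<phi>(2)] c0[OF \<phi>(2)] v0[OF \<phi>(2)]] by blast
    \<comment> \<open>The zeros of \<open>s\<close> are distinct, so \<open>\<phi> i\<close>
      vanishes at the \<open>j\<close>-th one exactly when that zero was assigned to node
      \<open>i\<close>. The list \<open>\<sigma>\<close> can therefore be read off from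
      \<open>\<phi>\<close>.\<close>
    have ev: "ev (m i) (\<phi> i) (v j (P \<phi>)) \<noteq> 0 \<longleftrightarrow> i \<noteq> \<sigma> ! j" if "j < K" "i \<in> {1..n}" for i j
    proof -
      let ?J = "{j. j < K \<and> \<sigma> ! j = i}"
      have finJ: "finite ?J" by simp
      have e0: "e i \<noteq> 0" and eqi: "\<phi> i = smult (e i) (\<Prod>j\<in>?J. lin (v j (P \<phi>)))"
        using e[OF that(2)] by blast+
      have evi: "ev (m i) (\<phi> i) (v j (P \<phi>)) = e i * (\<Prod>l\<in>?J. ev (Suc 0) (lin (v l (P \<phi>))) (v j (P \<phi>)))"
        by (subst eqi) (rule ev_prod_lin[OF finJ perms_card[OF \<sigma>(1) that(2)]])
      have "ev (m i) (\<phi> i) (v j (P \<phi>)) \<noteq> 0 \<longleftrightarrow> (\<forall>l\<in>?J. ev (Suc 0) (lin (v l (P \<phi>))) (v j (P \<phi>)) \<noteq> 0)"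
        unfolding evi mult_eq_0_iff prod_zero_iff[OF finJ] using e0 by blast
      also have "\<dots> \<longleftrightarrow> (\<forall>l\<in>?J. l \<noteq> j)"
        using nonpar[OF \<phi>(2) _ that(1)] by (intro ball_cong refl) (auto simp: ev_lin)
      also have "\<dots> \<longleftrightarrow> i \<noteq> \<sigma> ! j" using that by auto
      finally show ?thesis .
    qed
    have "\<phi> \<in> Uz \<tau> \<longleftrightarrow> \<tau> = \<sigma>" if \<tau>: "\<tau> \<in> perms" for \<tau>
    proof -
      \<comment> \<open>At the \<open>j\<close>-th zero the map at node \<open>\<sigma> ! j\<close>
        does vanish; membership in \<open>Uz \<tau>\<close> permits this only at node
        \<open>\<tau> ! j\<close>.\<close>
      have "\<phi> \<in> Uz \<tau> \<longleftrightarrow> (\<forall>j<K. \<forall>i\<in>{1..n}. i \<noteq> \<tau> ! j \<longrightarrow> i \<noteq> \<sigma> ! j)"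
        unfolding Uz_def using \<open>\<phi> \<in> W\<close> ev by blast
      also have "\<dots> \<longleftrightarrow> (\<forall>j<K. \<tau> ! j = \<sigma> ! j)"
      proof (intro all_cong)
        fix j assume "j < K"
        then have "\<sigma> ! j \<in> {1..n}" by (rule perms_nth[OF \<sigma>(1)])
        then show "(\<forall>i\<in>{1..n}. i \<noteq> \<tau> ! j \<longrightarrow> i \<noteq> \<sigma> ! j) \<longleftrightarrow> \<tau> ! j = \<sigma> ! j" by metis
      qed
      also have "\<dots> \<longleftrightarrow> \<tau> = \<sigma>"
        using perms_length[OF \<tau>] perms_length[OF \<sigma>(1)] by (auto simp: list_eq_iff_nth_eq)
      finally show ?thesis .
    qed
    then show ?thesis using \<sigma> by blast
  qed
  have UzW: "Uz \<sigma> \<subseteq> W" for \<sigma> by (auto simp: Uz_def)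
  have Wiso: "\<psi> \<in> W" if "\<phi> \<in> W" "(\<phi>, \<psi>) \<in> iso" for \<phi> \<psi>
  proof -
    have "\<psi> \<in> stab" using that(2) unfolding iso_iff by blast
    then show ?thesis using that(1) unfolding W_def mem_Collect_eq iso_P[OF that(2)] by blast
  qed
  have Uziso: "\<psi> \<in> Uz \<sigma>" if \<phi>: "\<phi> \<in> Uz \<sigma>" and i: "(\<phi>, \<psi>) \<in> iso" for \<phi> \<psi> \<sigma>
  proof -
    obtain l where "\<And>i. i \<in> {1..n} \<Longrightarrow> l i \<noteq> 0 \<and> \<psi> i = smult (l i) (\<phi> i)"
      using i unfolding iso_iff by blast
    then have "ev (m k) (\<psi> k) u \<noteq> 0 \<longleftrightarrow> ev (m k) (\<phi> k) u \<noteq> 0" if "k \<in> {1..n}" for k u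
      using that by (simp add: ev_smult)
    then show ?thesis
      using \<phi> Wiso[OF _ i] unfolding Uz_def mem_Collect_eq iso_P[OF i] by blast
  qed
  have oUz: "openin (an S) (Uz \<sigma>)" for \<sigma>
  proof -
    \<comment> \<open>The pairs of a zero and a node that should not vanish there. Being finite in
      number, they combine into one product whose nonvanishing defines
      \<open>Uz \<sigma>\<close>.\<close>
    define Q where "Q = {q \<in> {..<K} \<times> {1..n}. snd q \<noteq> \<sigma> ! fst q}"
    have fQ: "finite Q" by (simp add: Q_def)
    have cP: "continuous_map (subtopology (an S) W) (subtopology ?Y V) P"
      unfolding continuous_map_in_subtopology
      using continuous_map_from_subtopology[OF continuous_P] by (auto simp: W_def)
    have "cts (subtopology (an S) W) (\<lambda>\<phi>. \<Prod>q\<in>Q. ev (m (snd q)) (\<phi> (snd q)) (v (fst q) (P \<phi>)))"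
    proof (rule continuous_map_product)
      fix q assume "q \<in> Q"
      then have q: "fst q < K" by (auto simp: Q_def)
      show "cts (subtopology (an S) W) (\<lambda>\<phi>. ev (m (snd q)) (\<phi> (snd q)) (v (fst q) (P \<phi>)))"
        using continuous_map_compose[OF cP v(1)[OF q]] continuous_map_compose[OF cP v(2)[OF q]]
        by (intro continuous_map_ev pcont_subtopology pcont_S) (simp_all add: o_def)
    qed
    then have "openin (subtopology (an S) W) {\<phi> \<in> topspace (subtopology (an S) W).
        (\<Prod>q\<in>Q. ev (m (snd q)) (\<phi> (snd q)) (v (fst q) (P \<phi>))) \<noteq> 0}"
      by (rule openin_nonzero)
    also have "{\<phi> \<in> topspace (subtopology (an S) W).
        (\<Prod>q\<in>Q. ev (m (snd q)) (\<phi> (snd q)) (v (fst q) (P \<phi>))) \<noteq> 0} = Uz \<sigma>"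
    proof -
      have "(\<Prod>q\<in>Q. ev (m (snd q)) (\<phi> (snd q)) (v (fst q) (P \<phi>))) \<noteq> 0 \<longleftrightarrow>
          (\<forall>j<K. \<forall>i\<in>{1..n}. i \<noteq> \<sigma> ! j \<longrightarrow> ev (m i) (\<phi> i) (v j (P \<phi>)) \<noteq> 0)" for \<phi>
        unfolding prod_zero_iff[OF fQ] unfolding Q_def Bex_def mem_Collect_eq split_paired_Ex fst_conv snd_conv
          mem_Sigma_iff lessThan_iff by blast
      then show ?thesis
        unfolding Uz_def using openin_subset[OF oW] by auto
    qed
    finally show ?thesis using oW openin_trans_full by blast
  qed
  have mem: "cls \<phi> \<in> cls ` Uz \<sigma> \<longleftrightarrow> \<phi> \<in> Uz \<sigma>" if "\<phi> \<in> stab" for \<phi> \<sigma>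
    by (rule image_class_iff[OF equiv_iso _ Uziso that]) (use UzW W_def in auto)
  have mkV: "mk (c s) (\<lambda>j. v j s) \<sigma> \<in> stab \<and> P (mk (c s) (\<lambda>j. v j s) \<sigma>) = s \<and> mk (c s) (\<lambda>j. v j s) \<sigma> \<in> Uz \<sigma>"
    if "s \<in> V" "\<sigma> \<in> perms" for s \<sigma>
  proof -
    let ?\<phi> = "mk (c s) (\<lambda>j. v j s) \<sigma>"
    have st: "?\<phi> \<in> stab" by (rule mk_in_stab[OF that(2)]) (rule v0[OF that(1)])
    have Ps: "P ?\<phi> = s" using P_mk[OF that(2)] fact[OF that(1)] by simp
    have "ev (m i) (?\<phi> i) (v j s) \<noteq> 0" if ij: "j < K" "i \<in> {1..n}" "i \<noteq> \<sigma> ! j" for i j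
    proof -
      let ?J = "{j. j < K \<and> \<sigma> ! j = i}"
      have "ev (m i) (?\<phi> i) (v j s) = (if i = n then c s else 1) * (\<Prod>l\<in>?J. ev (Suc 0) (lin (v l s)) (v j s))"
        using ij perms_card[OF \<open>\<sigma> \<in> perms\<close> ij(2)] by (simp only: mk_def if_True ev_prod_lin) (simp add: ev_prod_lin)
      then show ?thesis
        using ij c0[OF \<open>s \<in> V\<close>] nonpar[OF \<open>s \<in> V\<close> _ ij(1)] by auto
    qed
    then show ?thesis using st Ps that by (simp add: Uz_def W_def)
  qed
  have "sheets perms (\<lambda>\<sigma>. cls ` Uz \<sigma>) f (an M) ?Y (hitchin_map n) V"
    unfolding sheets_def
  proof (intro conjI ballI impI)
    fix \<sigma> assume \<sigma>: "\<sigma> \<in> perms"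
    show "openin (an M) (cls ` Uz \<sigma>)"
      by (rule openin_cls_image[OF oUz Uziso])
    show "continuous_map (subtopology ?Y V) (an M) (f \<sigma>)"
      unfolding f_def using \<sigma> c v v0 by (intro continuous_map_cls continuous_mk) auto
    show "f \<sigma> s \<in> cls ` Uz \<sigma>" "hitchin_map n (f \<sigma> s) = s" if "s \<in> V" for s
      using mkV[OF that \<sigma>] by (auto simp: f_def hitchin_cls)
    fix C assume "C \<in> cls ` Uz \<sigma>"
    then obtain \<phi> where \<phi>: "\<phi> \<in> Uz \<sigma>" "C = cls \<phi>" by blast
    then have W: "\<phi> \<in> W" "\<phi> \<in> stab" "P \<phi> \<in> V" using UzW by (auto simp: W_def)
    then show "hitchin_map n C \<in> V" by (simp add: \<phi> hitchin_cls)
    obtain \<tau> where \<tau>: "(mk (c (P \<phi>)) (\<lambda>j. v j (P \<phi>)) \<tau>, \<phi>) \<in> iso" "\<forall>\<sigma>\<in>perms. \<phi> \<in> Uz \<sigma> \<longleftrightarrow> \<sigma> = \<tau>"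
      using key[OF W(1)] by blast
    then have "\<sigma> = \<tau>" using \<sigma> \<phi>(1) by blast
    then show "f \<sigma> (hitchin_map n C) = C"
      using equiv_class_eq[OF equiv_iso \<tau>(1)] by (simp add: \<phi>(2) hitchin_cls[OF W(2)] f_def)
  next
    show "disjoint_family_on (\<lambda>\<sigma>. cls ` Uz \<sigma>) perms"
      unfolding disjoint_family_on_def
    proof (intro ballI impI equals0I)
      fix \<sigma> \<tau> C assume *: "\<sigma> \<in> perms" "\<tau> \<in> perms" "\<sigma> \<noteq> \<tau>" "C \<in> cls ` Uz \<sigma> \<inter> cls ` Uz \<tau>"
      then obtain \<phi> where \<phi>: "\<phi> \<in> Uz \<sigma>" "C = cls \<phi>" by blast
      then have W: "\<phi> \<in> W" "\<phi> \<in> stab" using UzW by (auto simp: W_def)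
      then have "\<phi> \<in> Uz \<tau>" using *(4) mem[of \<phi> \<tau>] \<phi>(2) by blast
      then show False using key[OF W(1)] \<phi>(1) *(1-3) by metis
    qed
    fix C assume "C \<in> topspace (an M)" "hitchin_map n C \<in> V"
    then obtain \<phi> where \<phi>: "\<phi> \<in> stab" "C = cls \<phi>" "P \<phi> \<in> V"
      by (auto simp: topspace_M in_M_iff hitchin_cls)
    then have "\<phi> \<in> W" by (simp add: W_def)
    then show "\<exists>\<sigma>\<in>perms. C \<in> cls ` Uz \<sigma>"
      using key[of \<phi>] \<phi>(2) by blast
  qed
  then show "\<exists>V (I :: nat list set) U f. openin ?Y V \<and> s0 \<in> V \<and> V \<subseteq> distinct_zeros N \<and>
      finite I \<and> card I = eta n d t \<and> sheets I U f (an M) ?Y (hitchin_map n) V"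
    using V VD finite_permutations_of_multiset eta_eq by metis
qed

end

section \<open>Branching and the nilpotent cone\<close>

lemma lin_parallel:
  assumes "v \<noteq> 0" "w \<noteq> 0" "pt v = pt w"
  shows "\<exists>\<kappa>. \<kappa> \<noteq> 0 \<and> lin w = smult \<kappa> (lin v)"
proof (cases "snd v = 0")
  case True
  then have "snd w = 0" "fst v \<noteq> 0" "fst w \<noteq> 0"
    using assms by (auto simp: pt_def prod_eq_iff split: if_splits)
  then show ?thesis
    using True by (intro exI[of _ "fst w / fst v"]) (auto simp: lin_def)
next
  case False
  then have "snd w \<noteq> 0" "fst v / snd v = fst w / snd w"
    using assms by (auto simp: pt_def split: if_splits)
  then show ?thesis
    using False by (intro exI[of _ "snd w / snd v"]) (auto simp: lin_def field_simps)
qed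

context quiver_moduli
begin

lemma perms_swap:
  assumes "\<sigma> \<in> perms" "a < K" "b < K"
  shows "\<sigma>[a := \<sigma> ! b, b := \<sigma> ! a] \<in> perms"
  using assms(1) mset_swap[of b \<sigma> a] assms(2,3) perms_length[OF assms(1)]
  by (simp add: permutations_of_multiset_def)

text \<open>A constant list is the only arrangement of its multiset, so a second arrangement forces
  two different entries.\<close>

lemma perms_nonconstant:
  assumes card: "card perms > 1" and \<sigma>: "\<sigma> \<in> perms" and a: "a < K"
  shows "\<exists>y<K. \<sigma> ! y \<noteq> \<sigma> ! a"
proof (rule ccontr)
  assume *: "\<not> ?thesis"
  have "set \<sigma> \<subseteq> {\<sigma> ! a}"
    using * perms_length[OF \<sigma>] by (auto simp: in_set_conv_nth)
  then have "\<tau> = replicate K (\<sigma> ! a)" if \<tau>: "\<tau> \<in> perms" for \<tau>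
  proof -
    have "mset \<tau> = mset \<sigma>" using \<sigma> \<tau> by (simp add: permutations_of_multiset_def)
    then have "set \<tau> = set \<sigma>" by (rule mset_eq_setD)
    with \<open>set \<sigma> \<subseteq> {\<sigma> ! a}\<close> show ?thesis
      using perms_length[OF \<tau>] by (intro replicate_eqI) auto
  qed
  then have "perms \<subseteq> {replicate K (\<sigma> ! a)}" by blast
  then have "card perms \<le> card {replicate K (\<sigma> ! a)}"
    by (intro card_mono) simp_all
  with card show False by simp
qed

text \<open>If a list has equal entries at \<open>a\<close> and \<open>b\<close>, exchanging
  position \<open>b\<close> with a position that holds another value separates them without changing
  the multiset.\<close>

lemma perms_separate:
  assumes card: "card perms > 1" and ab: "a < K" "b < K" "a \<noteq> b"
  shows "\<exists>\<sigma>\<in>perms. \<sigma> ! a \<noteq> \<sigma> ! b"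
proof -
  obtain \<sigma> where \<sigma>: "\<sigma> \<in> perms" using card by fastforce
  show ?thesis
  proof (cases "\<sigma> ! a = \<sigma> ! b")
    case True
    obtain y where y: "y < K" "\<sigma> ! y \<noteq> \<sigma> ! a"
      using perms_nonconstant[OF card \<sigma> ab(1)] by blast
    have "y \<noteq> a" "y \<noteq> b" using y True by auto
    then have "\<sigma>[b := \<sigma> ! y, y := \<sigma> ! b] ! a \<noteq> \<sigma>[b := \<sigma> ! y, y := \<sigma> ! b] ! b"
      using y ab perms_length[OF \<sigma>] by (simp add: nth_list_update)
    then show ?thesis
      using perms_swap[OF \<sigma> ab(2) y(1)] by blast
  qed (use \<sigma> in blast)
qed

lemma mk_swap:
  assumes \<sigma>: "\<sigma> \<in> perms" and ab: "a < K" "b < K" and v: "v a = v b"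
  shows "mk c v (\<sigma>[a := \<sigma> ! b, b := \<sigma> ! a]) = mk c v \<sigma>"
proof
  fix i
  let ?\<tau> = "\<sigma>[a := \<sigma> ! b, b := \<sigma> ! a]"
  have \<tau>: "?\<tau> ! j = \<sigma> ! transpose a b j" for j
    using ab perms_length[OF \<sigma>] by (auto simp: nth_list_update transpose_def)
  have tK: "transpose a b j < K" if "j < K" for j
    using that ab by (auto simp: transpose_def)
  have vt: "v (transpose a b j) = v j" for j
    using v by (auto simp: transpose_def)
  have "(\<Prod>j\<in>{j. j < K \<and> ?\<tau> ! j = i}. lin (v j)) = (\<Prod>j\<in>{j. j < K \<and> \<sigma> ! j = i}. lin (v j))"
    by (rule prod.reindex_bij_witness[of _ "transpose a b" "transpose a b"]) (use tK vt in \<open>auto simp: \<tau>\<close>)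
  then show "mk c v ?\<tau> i = mk c v \<sigma> i"
    unfolding mk_def by simp
qed

lemma hitchin_branches:
  assumes eta: "eta n d t > 1" and s: "s \<in> repeated_zeros N"
  shows "branches_over (eta n d t) (an M) (hitchin_map n) s"
proof -
  have deg: "degree s \<le> K" and s0: "s \<noteq> 0" and nd: "s \<notin> distinct_zeros (int K)"
    using s unfolding repeated_zeros_iff K_eq H0_iff by blast+
  obtain c0 p0 where p0: "c0 \<noteq> 0" "\<forall>j<K. p0 j \<noteq> 0" "s = smult c0 (\<Prod>j<K. lin (p0 j))"
    using form_factorization[OF deg s0] by blast
  have "\<not> inj_on (pt \<circ> p0) {..<K}"
    using distinct_zeros_prod_iff[of "{..<K}" p0 c0] p0 nd by simp
  then obtain a b where ab: "a < K" "b < K" "a \<noteq> b" "pt (p0 a) = pt (p0 b)"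
    by (auto simp: inj_on_def)
  obtain \<kappa> where \<kappa>: "\<kappa> \<noteq> 0" "lin (p0 b) = smult \<kappa> (lin (p0 a))"
    using lin_parallel[of "p0 a" "p0 b"] p0(2) ab by blast
  \<comment> \<open>Two vectors for the same point may differ by a factor. Moving the factor into
    the scalar makes the vectors at \<open>a\<close> and \<open>b\<close> literally equal, as
    \<open>mk_swap\<close> demands.\<close>
  define c where "c = c0 * \<kappa>"
  define p where "p = p0(b := p0 a)"
  define u where "u = p0 a"
  have c: "c \<noteq> 0" using p0 \<kappa> by (simp add: c_def)
  have p: "p j \<noteq> 0" if "j < K" for j using p0(2) ab that by (auto simp: p_def)
  have pa: "p a = u" "p b = u" using ab by (auto simp: p_def u_def)
  have sp: "s = smult c (\<Prod>j<K. lin (p j))"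
  proof -
    have "(\<Prod>j\<in>{..<K} - {b}. lin (p j)) = (\<Prod>j\<in>{..<K} - {b}. lin (p0 j))"
      by (rule prod.cong) (auto simp: p_def)
    then show ?thesis
      using ab(2) by (simp add: p0(3) prod.remove[of "{..<K}" b] c_def \<kappa>(2) pa u_def)
  qed
  let ?F = "{C \<in> topspace (an M). hitchin_map n C = s}"
  have F: "?F = (\<lambda>\<sigma>. cls (mk c p \<sigma>)) ` perms"
    unfolding sp by (rule fibre_eq[OF c p])
  obtain \<sigma> where \<sigma>: "\<sigma> \<in> perms" "\<sigma> ! a \<noteq> \<sigma> ! b"
    using perms_separate[OF eta[unfolded eta_eq] ab(1-3)] by blast
  let ?\<tau> = "\<sigma>[a := \<sigma> ! b, b := \<sigma> ! a]"
  have "?\<tau> \<in> perms" "mk c p ?\<tau> = mk c p \<sigma>"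
    using perms_swap[OF \<sigma>(1) ab(1,2)] mk_swap[OF \<sigma>(1) ab(1,2)] pa by simp_all
  moreover have "?\<tau> ! a \<noteq> \<sigma> ! a"
    using \<sigma> ab perms_length[OF \<sigma>(1)] by (simp add: nth_list_update)
  then have "?\<tau> \<noteq> \<sigma>" by metis
  \<comment> \<open>The fibre is the image of \<open>perms\<close>, and two different lists now give
    the same representation; hence it has fewer than \<open>eta n d t\<close> points.\<close>
  ultimately have ninj: "\<not> inj_on (\<lambda>\<sigma>. cls (mk c p \<sigma>)) perms"
    using \<sigma>(1) unfolding inj_on_def by metis
  have finF: "finite ?F" unfolding F by simp
  have cardF: "card ?F < eta n d t"
    unfolding F eta_eq using card_image_le[of perms "\<lambda>\<sigma>. cls (mk c p \<sigma>)"] ninj eq_card_imp_inj_on[of perms "\<lambda>\<sigma>. cls (mk c p \<sigma>)"]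
    by fastforce
  have xF: "cls (mk c p \<sigma>) \<in> ?F" unfolding F using \<sigma>(1) by blast
  \<comment> \<open>A vector independent of \<open>u\<close>, so that adding multiples of it really
    moves the point of the projective line.\<close>
  define w :: "complex \<times> complex" where "w = (if snd u \<noteq> 0 then (1, 0) else (0, 1))"
  have u0: "u \<noteq> 0" using p0(2) ab(1) by (simp add: u_def)
  have uw: "ev (Suc 0) (lin u) w \<noteq> 0"
    using u0 by (auto simp: ev_lin w_def prod_eq_iff)
  define uu where "uu \<epsilon> = (fst u + \<epsilon> * fst w, snd u + \<epsilon> * snd w)" for \<epsilon>
  have uu0: "uu 0 = u" by (simp add: uu_def)
  have uunz: "uu \<epsilon> \<noteq> 0" for \<epsilon>
  proof
    assume "uu \<epsilon> = 0"
    then have "fst u = - \<epsilon> * fst w" "snd u = - \<epsilon> * snd w"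
      by (auto simp: uu_def prod_eq_iff add_eq_0_iff2)
    then show False using uw by (simp add: ev_lin)
  qed
  \<comment> \<open>the double zero \<open>u\<close> moves apart in opposite directions; changing the sign of \<open>\<epsilon>\<close> exchanges the two zeros and keeps the product\<close>
  define q where "q \<epsilon> j = (if j = a then uu \<epsilon> else if j = b then uu (- \<epsilon>) else p j)" for \<epsilon> j
  have q0: "q 0 = p" using pa uu0 by (auto simp: q_def fun_eq_iff)
  have qnz: "q \<epsilon> j \<noteq> 0" if "j < K" for \<epsilon> j
    using p[OF that] uunz by (simp add: q_def)
  have qt: "q (- \<epsilon>) j = q \<epsilon> (transpose a b j)" for \<epsilon> j
    using ab(3) by (auto simp: q_def transpose_def)
  define \<phi> where "\<phi> \<epsilon> = mk c (q \<epsilon>) \<sigma>" for \<epsilon>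
  have \<phi>st: "\<phi> \<epsilon> \<in> stab" for \<epsilon>
    unfolding \<phi>_def by (rule mk_in_stab[OF \<sigma>(1)]) (rule qnz)
  have "continuous_map (euclidean :: complex topology) (an S) (\<lambda>\<epsilon>. mk c (\<lambda>j. q \<epsilon> j) \<sigma>)"
  proof (rule continuous_mk[OF \<sigma>(1)])
    show "cts euclidean (\<lambda>\<epsilon>. fst (q \<epsilon> j))" for j
      by (cases "j = a"; cases "j = b") (auto simp: q_def uu_def intro!: continuous_intros)
    show "cts euclidean (\<lambda>\<epsilon>. snd (q \<epsilon> j))" for j
      by (cases "j = a"; cases "j = b") (auto simp: q_def uu_def intro!: continuous_intros)
  qed (use qnz in simp_all)
  then have cont: "continuous_map euclidean (an M) (\<lambda>\<epsilon>. cls (\<phi> \<epsilon>))"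
    unfolding \<phi>_def by (rule continuous_map_cls)
  have same: "P (\<phi> (- \<epsilon>)) = P (\<phi> \<epsilon>)" for \<epsilon>
  proof -
    have "(\<Prod>j<K. lin (q (- \<epsilon>) j)) = (\<Prod>j<K. lin (q \<epsilon> j))"
      by (rule prod.reindex_bij_witness[of _ "transpose a b" "transpose a b"])
        (use ab in \<open>auto simp: qt transpose_def\<close>)
    then show ?thesis unfolding \<phi>_def P_mk[OF \<sigma>(1)] by simp
  qed
  have diff: "cls (\<phi> \<epsilon>) \<noteq> cls (\<phi> (- \<epsilon>))" if \<epsilon>: "\<epsilon> \<noteq> 0" for \<epsilon>
  proof
    assume "cls (\<phi> \<epsilon>) = cls (\<phi> (- \<epsilon>))"
    then have "(\<phi> \<epsilon>, \<phi> (- \<epsilon>)) \<in> iso"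
      using eq_equiv_class[OF _ equiv_iso \<phi>st] by blast
    then obtain l where l: "\<forall>i\<in>{1..n}. l i \<noteq> 0 \<and> \<phi> (- \<epsilon>) i = smult (l i) (\<phi> \<epsilon> i)"
      unfolding iso_iff by blast
    let ?i = "\<sigma> ! a"
    let ?J = "{j. j < K \<and> \<sigma> ! j = ?i} - {a}"
    have i: "?i \<in> {1..n}" using perms_nth[OF \<sigma>(1) ab(1)] .
    \<comment> \<open>Since \<open>\<sigma>\<close> sends \<open>a\<close> and \<open>b\<close> to
      different nodes, only one of the two moving zeros belongs to node \<open>\<sigma> ! a\<close>,
      and the remaining factor does not depend on the parameter.\<close>
    define rest where "rest = smult (if ?i = n then c else 1) (\<Prod>j\<in>?J. lin (p j))"
    have "rest \<noteq> 0" using c p by (auto simp: rest_def)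
    have split: "\<phi> \<delta> ?i = lin (uu \<delta>) * rest" for \<delta>
    proof -
      have "(\<Prod>j\<in>{j. j < K \<and> \<sigma> ! j = ?i}. lin (q \<delta> j)) = lin (q \<delta> a) * (\<Prod>j\<in>?J. lin (q \<delta> j))"
        using ab(1) by (intro prod.remove) auto
      also have "(\<Prod>j\<in>?J. lin (q \<delta> j)) = (\<Prod>j\<in>?J. lin (p j))"
        using \<sigma>(2) by (intro prod.cong) (auto simp: q_def)
      finally show ?thesis
        unfolding \<phi>_def mk_def using i by (simp add: rest_def q_def)
    qed
    have "\<phi> (- \<epsilon>) ?i = smult (l ?i) (\<phi> \<epsilon> ?i)"
      using l i by blast
    then have "lin (uu (- \<epsilon>)) * rest = smult (l ?i) (lin (uu \<epsilon>)) * rest"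
      unfolding split mult_smult_left .
    then have "lin (uu (- \<epsilon>)) = smult (l ?i) (lin (uu \<epsilon>))"
      using \<open>rest \<noteq> 0\<close> by (metis mult_right_cancel)
    \<comment> \<open>At the point \<open>uu \<epsilon>\<close> the right-hand side vanishes, while
      the left-hand side is \<open>2 * \<epsilon>\<close> times the determinant of \<open>u\<close>
      and \<open>w\<close>.\<close>
    then have "ev (Suc 0) (lin (uu (- \<epsilon>))) (uu \<epsilon>) = l ?i * ev (Suc 0) (lin (uu \<epsilon>)) (uu \<epsilon>)"
      by (simp add: ev_smult)
    then have "2 * \<epsilon> * ev (Suc 0) (lin u) w = 0"
      by (simp add: ev_lin uu_def algebra_simps)
    then show False using uw \<epsilon> by simp
  qed
  have "\<not> inj_on (hitchin_map n) U" if U: "openin (an M) U" "cls (mk c p \<sigma>) \<in> U" for U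
  proof
    assume inj: "inj_on (hitchin_map n) U"
    have "open {\<epsilon>. cls (\<phi> \<epsilon>) \<in> U}"
      using openin_continuous_map_preimage[OF cont U(1)] by simp
    moreover have "0 \<in> {\<epsilon>. cls (\<phi> \<epsilon>) \<in> U}"
      using U(2) by (simp add: \<phi>_def q0)
    ultimately obtain \<delta> where \<delta>: "\<delta> > 0" "ball 0 \<delta> \<subseteq> {\<epsilon>. cls (\<phi> \<epsilon>) \<in> U}"
      using open_contains_ball_eq by blast
    define \<epsilon> :: complex where "\<epsilon> = of_real (\<delta> / 2)"
    have "\<epsilon> \<in> ball 0 \<delta>" "- \<epsilon> \<in> ball 0 \<delta>" "\<epsilon> \<noteq> 0"
      using \<delta>(1) by (auto simp: \<epsilon>_def norm_divide)
    then have "cls (\<phi> \<epsilon>) \<in> U" "cls (\<phi> (- \<epsilon>)) \<in> U" using \<delta>(2) by blast+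
    then have "cls (\<phi> \<epsilon>) = cls (\<phi> (- \<epsilon>))"
      using inj_onD[OF inj] hitchin_cls[OF \<phi>st] same by metis
    then show False using diff \<open>\<epsilon> \<noteq> 0\<close> by blast
  qed
  then show ?thesis
    unfolding branches_over_def Let_def using finF cardF xF by blast
qed

text \<open>If there is only one list, every exchange of entries fixes it, so it is constant and all
  zeros belong to one node. For \<open>K = 0\<close> there are no zeros and any node may be
  named.\<close>

lemma eta_one_concentrated:
  assumes "eta n d t = 1"
  obtains i0 where "i0 \<in> {1..n}" "m i0 = K" "\<And>i. i \<in> {1..n} \<Longrightarrow> i \<noteq> i0 \<Longrightarrow> m i = 0"
proof (cases "K = 0")
  case True
  then have "m i = 0" if "i \<in> {1..n}" for i
    using True that by (simp add: K_def)
  then show ?thesis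
    using that[of n] True n2 by auto
next
  case False
  obtain \<sigma> where \<sigma>: "perms = {\<sigma>}"
    using assms unfolding eta_eq by (rule card_1_singletonE)
  then have \<sigma>p: "\<sigma> \<in> perms" by blast
  have const: "\<sigma> ! j = \<sigma> ! 0" if "j < K" for j
  proof -
    have "\<sigma>[0 := \<sigma> ! j, j := \<sigma> ! 0] = \<sigma>"
      using perms_swap[OF \<sigma>p _ that, of 0] False \<sigma> by auto
    moreover have "\<sigma>[0 := \<sigma> ! j, j := \<sigma> ! 0] ! j = \<sigma> ! 0"
      using that perms_length[OF \<sigma>p] by simp
    ultimately show ?thesis by metis
  qed
  have m: "m i = card {j. j < K \<and> \<sigma> ! j = i}" if "i \<in> {1..n}" for i
    using perms_card[OF \<sigma>p that] by simp
  have i0: "\<sigma> ! 0 \<in> {1..n}" using perms_nth[OF \<sigma>p] False by blast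
  show ?thesis
  proof (rule that[OF i0])
    have "{j. j < K \<and> \<sigma> ! j = \<sigma> ! 0} = {..<K}" using const unfolding lessThan_def by blast
    then show "m (\<sigma> ! 0) = K" using m[OF i0] by simp
    fix i assume i: "i \<in> {1..n}" "i \<noteq> \<sigma> ! 0"
    then have "{j. j < K \<and> \<sigma> ! j = i} = {}" using const by blast
    then show "m i = 0" using m[OF i(1)] by simp
  qed
qed

text \<open>All maps but the one at \<open>i0\<close> are constants. Away from product 0 they can be
  normalised to 1 by the torus, which makes the map at \<open>i0\<close> equal to the product;
  \<open>sect\<close> is thus a global continuous inverse, at repeated zeros as well.\<close>

lemma hitchin_covering_one:
  assumes "eta n d t = 1"
  shows "covering_over 1 (an M) (an (H0_variety N)) (hitchin_map n) (H0 N - {0})"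
proof -
  obtain i0 where i0: "i0 \<in> {1..n}" "m i0 = K" and m0: "\<And>i. i \<in> {1..n} \<Longrightarrow> i \<noteq> i0 \<Longrightarrow> m i = 0"
    using eta_one_concentrated[OF assms] by blast
  let ?Y = "an (H0_variety N)"
  let ?V = "H0 N - {0}"
  define sect where "sect s i = (if i = i0 then s else if i \<in> {1..n} then 1 else 0)" for s :: "complex poly" and i
  have tY: "topspace ?Y = H0 N" by (simp add: H0_variety_def)
  have sect_st: "sect s \<in> stab" if "s \<in> ?V" for s
    unfolding stab_iff using that i0 by (auto simp: sect_def H0_iff)
  have P_sect: "P (sect s) = s" for s
    using i0(1) by (simp add: prod.remove[of "{1..n}" i0] sect_def)
  have iso_sect: "(sect (P \<phi>), \<phi>) \<in> iso" if \<phi>: "\<phi> \<in> stab" "P \<phi> \<noteq> 0" for \<phi>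
  proof -
    have nz: "\<phi> i \<noteq> 0" if "i \<in> {1..n}" for i using \<phi>(2) that by auto
    define e where "e i = coeff (\<phi> i) 0" for i
    have e: "\<phi> i = [:e i:]" "e i \<noteq> 0" if i: "i \<in> {1..n}" "i \<noteq> i0" for i
    proof -
      have "degree (\<phi> i) = 0" using stab_degree[OF \<phi>(1) i(1)] m0[OF i] by simp
      then show "\<phi> i = [:e i:]" unfolding e_def by (metis coeff_pCons_0 degree_eq_zeroE)
      then show "e i \<noteq> 0" using nz[OF i(1)] by auto
    qed
    define E where "E = (\<Prod>i\<in>{1..n} - {i0}. e i)"
    have E: "E \<noteq> 0" using e(2) by (simp add: E_def)
    have "(\<Prod>i\<in>{1..n} - {i0}. \<phi> i) = (\<Prod>i\<in>{1..n} - {i0}. smult (e i) 1)"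
      using e(1) by (intro prod.cong) auto
    also have "\<dots> = smult E 1"
      unfolding prod_smult E_def by simp
    finally have P: "P \<phi> = smult E (\<phi> i0)"
      using i0(1) by (simp add: prod.remove[of "{1..n}" i0])
    define l where "l i = (if i = i0 then 1 / E else e i)" for i
    have "l i \<noteq> 0 \<and> \<phi> i = smult (l i) (sect (P \<phi>) i)" if "i \<in> {1..n}" for i
      using e[OF that] that E P by (cases "i = i0") (simp_all add: l_def sect_def)
    moreover have "(\<Prod>i\<in>{1..n} - {i0}. l i) = E"
      unfolding E_def by (rule prod.cong) (auto simp: l_def)
    then have "(\<Prod>i=1..n. l i) = 1"
      using i0(1) E by (simp add: prod.remove[of "{1..n}" i0] l_def)
    moreover have "sect (P \<phi>) \<in> stab"
      using sect_st P_in_H0[OF \<phi>(1)] \<phi>(2) by blast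
    ultimately show ?thesis unfolding iso_iff using \<phi>(1) by blast
  qed
  have oV: "openin ?Y ?V"
  proof (subst openin_subopen, intro ballI)
    fix s assume s: "s \<in> ?V"
    then obtain k where k: "coeff s k \<noteq> 0" by (metis DiffE coeff_0 insertI1 poly_eqI)
    have "openin ?Y {s \<in> topspace ?Y. coeff s k \<noteq> 0}"
      using pcont_H0 by (intro openin_nonzero) (simp add: pcont_def)
    then show "\<exists>T. openin ?Y T \<and> s \<in> T \<and> T \<subseteq> ?V"
      using s k by (intro exI[of _ "{s \<in> topspace ?Y. coeff s k \<noteq> 0}"]) (auto simp: tY)
  qed
  have csect: "continuous_map (subtopology ?Y ?V) (an S) sect"
    unfolding continuous_map_into_S
  proof (intro conjI allI)
    show "sect ` topspace (subtopology ?Y ?V) \<subseteq> stab"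
      using sect_st by (auto simp: tY)
    show "pcont (subtopology ?Y ?V) (\<lambda>s. sect s i)" for i
      unfolding sect_def using pcont_subtopology[OF pcont_H0] by (cases "i = i0"; cases "i \<in> {1..n}") (simp_all add: pcont_const)
  qed
  let ?U = "{C \<in> topspace (an M). hitchin_map n C \<in> ?V}"
  have oU: "openin (an M) ?U"
    by (rule openin_continuous_map_preimage[OF continuous_hitchin oV])
  have recover: "cls (sect (hitchin_map n C)) = C" if C: "C \<in> ?U" for C
  proof -
    have "C \<in> stab // iso" using C by (simp add: topspace_M)
    then obtain \<phi> where \<phi>: "\<phi> \<in> stab" "C = cls \<phi>" unfolding in_M_iff by blast
    then have "P \<phi> \<noteq> 0" using C by (simp add: hitchin_cls)
    then show ?thesis
      using equiv_class_eq[OF equiv_iso iso_sect[OF \<phi>(1)]] by (simp add: \<phi> hitchin_cls)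
  qed
  show ?thesis
  proof (rule covering_overI[where 'i = unit, OF continuous_hitchin])
    show "?V \<subseteq> topspace ?Y" by (auto simp: tY)
    fix s assume s: "s \<in> ?V"
    have "sheets {()} (\<lambda>_. ?U) (\<lambda>_ s. cls (sect s)) (an M) ?Y (hitchin_map n) ?V"
      unfolding sheets_def
    proof (intro conjI ballI impI)
      show "continuous_map (subtopology ?Y ?V) (an M) (\<lambda>s. cls (sect s))"
        using csect by (rule continuous_map_cls)
      show "hitchin_map n (cls (sect v)) = v" if "v \<in> ?V" for v
        using hitchin_cls[OF sect_st[OF that]] P_sect by simp
      then show "cls (sect v) \<in> ?U" if "v \<in> ?V" for v
        using that sect_st[OF that] by (auto simp: topspace_M intro: quotientI)
    qed (use oU recover in \<open>auto simp: disjoint_family_on_def\<close>)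
    then show "\<exists>V (I :: unit set) U f. openin ?Y V \<and> s \<in> V \<and> V \<subseteq> ?V \<and> finite I \<and> card I = 1 \<and>
        sheets I U f (an M) ?Y (hitchin_map n) V"
      using s oV by (intro exI[of _ ?V] exI[of _ "{()}"] exI conjI) auto
  qed
qed

text \<open>A one-parameter family \<open>\<psi>\<close> through the given representation has
  distinct zeros for all but finitely many parameters, and its class depends continuously on the
  parameter.\<close>

lemma nilpotent_in_closure:
  "{C \<in> points M. hitchin_map n C = 0} \<subseteq>
    an M closure_of {C \<in> points M. hitchin_map n C \<in> distinct_zeros N}"
proof
  fix C assume "C \<in> {C \<in> points M. hitchin_map n C = 0}"
  then obtain \<phi> where \<phi>: "\<phi> \<in> stab" "C = cls \<phi>" "P \<phi> = 0"
    by (auto simp: topspace_M in_M_iff hitchin_cls)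
  have nz: "\<phi> i \<noteq> 0" if "i \<in> {1..<n}" for i using \<phi>(1) that by (simp add: stab_iff)
  have \<phi>n: "\<phi> n = 0"
    using \<phi>(3) nz unfolding prod_nodes by simp
  have "\<forall>i\<in>{1..<n}. \<exists>q. fst q \<noteq> 0 \<and> (\<forall>j<m i. snd q j \<noteq> 0) \<and>
      \<phi> i = smult (fst q) (\<Prod>j<m i. lin (snd q j))"
  proof
    fix i assume i: "i \<in> {1..<n}"
    then have "degree (\<phi> i) \<le> m i" using stab_degree[OF \<phi>(1), of i] by simp
    from form_factorization[OF this nz[OF i]] obtain c p where "c \<noteq> 0" "\<forall>j<m i. p j \<noteq> 0"
      "\<phi> i = smult c (\<Prod>j<m i. lin (p j))" by blast
    then show "\<exists>q. fst q \<noteq> 0 \<and> (\<forall>j<m i. snd q j \<noteq> 0) \<and>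
      \<phi> i = smult (fst q) (\<Prod>j<m i. lin (snd q j))"
      by (intro exI[of _ "(c, p)"]) simp
  qed
  from bchoice[OF this] obtain q where q: "\<forall>i\<in>{1..<n}. fst (q i) \<noteq> 0 \<and> (\<forall>j<m i. snd (q i) j \<noteq> 0) \<and>
      \<phi> i = smult (fst (q i)) (\<Prod>j<m i. lin (snd (q i) j))" by blast
  define J where "J = (SIGMA i:{1..n}. {..<m i})"
  have finJ: "finite J" by (simp add: J_def)
  have cardJ: "card J = K" by (simp add: J_def K_def)
  \<comment> \<open>At node \<open>n\<close> the starting vectors are zero and name no point; for
    \<open>\<epsilon> \<noteq> 0\<close> they become multiples of \<open>(r x, 1)\<close>, which
    prescribes the zeros of the last map.\<close>
  define p0 where "p0 x = (if fst x = n then 0 else snd (q (fst x)) (snd x))" for x :: "nat \<times> nat"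
  define r where "r x = (of_nat (prod_encode x) :: complex)" for x
  \<comment> \<open>the directions \<open>(r x, 1)\<close> are pairwise independent, so coincidences of zeros are roots of quadratic polynomials in \<open>\<epsilon>\<close>\<close>
  define v where "v \<epsilon> x = (fst (p0 x) + \<epsilon> * r x, snd (p0 x) + \<epsilon>)" for \<epsilon> x
  \<comment> \<open>The scalar \<open>\<epsilon>\<close> at the last node gives
    \<open>\<psi> 0 n = 0\<close> also when \<open>m n = 0\<close> and there are no linear factors
    to vanish.\<close>
  define \<psi> where "\<psi> \<epsilon> i = (if i \<in> {1..n} then
      smult (if i = n then \<epsilon> else fst (q i)) (\<Prod>j<m i. lin (v \<epsilon> (i, j))) else 0)" for \<epsilon> i
  have v0: "v 0 x = p0 x" for x by (simp add: v_def)
  have \<psi>0: "\<psi> 0 = \<phi>"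
  proof
    fix i
    consider "i = n" | "i \<in> {1..<n}" | "i \<notin> {1..n}" using n2 by force
    then show "\<psi> 0 i = \<phi> i"
    proof cases
      case 1
      then show ?thesis using n2 \<phi>n by (simp add: \<psi>_def)
    next
      case 2
      then have "\<phi> i = smult (fst (q i)) (\<Prod>j<m i. lin (snd (q i) j))" using q by blast
      then show ?thesis using 2 by (simp add: \<psi>_def v0 p0_def)
    next
      case 3
      then have "\<phi> i = 0" using \<phi>(1) unfolding stab_iff by blast
      moreover have "\<psi> 0 i = 0" unfolding \<psi>_def using 3 by (rule if_not_P)
      ultimately show ?thesis by simp
    qed
  qed
  define bad where "bad = (\<Union>x\<in>J. {\<epsilon>. v \<epsilon> x = 0}) \<union>
      (\<Union>x\<in>J. \<Union>y\<in>J - {x}. {\<epsilon>. ev (Suc 0) (lin (v \<epsilon> x)) (v \<epsilon> y) = 0})"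
  have fb1: "finite {\<epsilon>. v \<epsilon> x = 0}" for x
    by (rule finite_subset[of _ "{- snd (p0 x)}"]) (auto simp: v_def prod_eq_iff add_eq_0_iff2)
  have fb2: "finite {\<epsilon>. ev (Suc 0) (lin (v \<epsilon> x)) (v \<epsilon> y) = 0}" if "x \<noteq> y" for x y
  proof -
    \<comment> \<open>The determinant of the two moving vectors as a polynomial in
      \<open>\<epsilon>\<close>. Its leading coefficient \<open>r y - r x\<close> is nonzero by
      injectivity of \<open>prod_encode\<close>, whatever the starting vectors are.\<close>
    define pp where "pp = [: snd (p0 x) * fst (p0 y) - fst (p0 x) * snd (p0 y),
        snd (p0 x) * r y + fst (p0 y) - fst (p0 x) - r x * snd (p0 y), r y - r x :]"
    have "r y \<noteq> r x" using that by (simp add: r_def)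
    then have "pp \<noteq> 0" by (simp add: pp_def)
    moreover have "{\<epsilon>. ev (Suc 0) (lin (v \<epsilon> x)) (v \<epsilon> y) = 0} = {\<epsilon>. poly pp \<epsilon> = 0}"
      by (simp add: pp_def ev_lin v_def algebra_simps)
    ultimately show ?thesis using poly_roots_finite by simp
  qed
  have finbad: "finite bad"
    unfolding bad_def
  proof (intro finite_UnI finite_UN_I finJ fb1)
    fix x y assume "y \<in> J - {x}"
    then have "x \<noteq> y" by blast
    then show "finite {\<epsilon>. ev (Suc 0) (lin (v \<epsilon> x)) (v \<epsilon> y) = 0}" by (rule fb2)
  qed (use finJ in simp)
  \<comment> \<open>The parameter 0 is retained even if it is bad, because \<open>\<psi> 0\<close>
    is the given stable representation and is the limit to be reached.\<close>
  define G where "G = {\<epsilon>. \<epsilon> = 0 \<or> \<epsilon> \<notin> bad}"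
  have deg: "degree (\<psi> \<epsilon> i) \<le> m i" if "i \<in> {1..n}" for \<epsilon> i
    using degree_prod_lin_le[of "\<lambda>j. v \<epsilon> (i, j)" "{..<m i}"] that
    by (auto simp: \<psi>_def intro: order_trans[OF degree_smult_le])
  have vnz: "v \<epsilon> x \<noteq> 0" if "\<epsilon> \<notin> bad" "x \<in> J" for \<epsilon> x
    using that by (auto simp: bad_def)
  have st: "\<psi> \<epsilon> \<in> stab" if "\<epsilon> \<in> G" for \<epsilon>
  proof (cases "\<epsilon> = 0")
    case True
    then show ?thesis using \<psi>0 \<phi>(1) by simp
  next
    case False
    then have nb: "\<epsilon> \<notin> bad" using that by (simp add: G_def)
    show ?thesis
      unfolding stab_iff
    proof (intro conjI ballI allI impI deg)
      fix i assume "i \<notin> {1..n}"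
      then show "\<psi> \<epsilon> i = 0" unfolding \<psi>_def by (rule if_not_P)
    next
      fix i assume i: "i \<in> {1..<n}"
      then have "v \<epsilon> (i, j) \<noteq> 0" if "j < m i" for j
        using that by (intro vnz nb) (auto simp: J_def)
      then show "\<psi> \<epsilon> i \<noteq> 0" using i q by (auto simp: \<psi>_def)
    qed
  qed
  have "continuous_map (top_of_set G) (an S) \<psi>"
    unfolding continuous_map_into_S
  proof (intro conjI allI)
    show "\<psi> ` topspace (top_of_set G) \<subseteq> stab" using st by auto
    fix i
    have lins: "pcont (top_of_set G) (\<lambda>\<epsilon>. \<Prod>j<m i. lin (v \<epsilon> (i, j)))"
      by (rule pcont_prod, rule pcont_lin) (auto simp: v_def intro!: continuous_intros)
    have "cts (top_of_set G) (\<lambda>\<epsilon>. if i = n then \<epsilon> else fst (q i))"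
      by (cases "i = n") (auto intro!: continuous_intros)
    then have "pcont (top_of_set G) (\<lambda>\<epsilon>. smult (if i = n then \<epsilon> else fst (q i)) (\<Prod>j<m i. lin (v \<epsilon> (i, j))))"
      by (rule pcont_smult[OF _ lins])
    then show "pcont (top_of_set G) (\<lambda>\<epsilon>. \<psi> \<epsilon> i)"
      unfolding \<psi>_def by (cases "i \<in> {1..n}") (simp_all only: if_True if_False pcont_const)
  qed
  then have cont: "continuous_map (top_of_set G) (an M) (\<lambda>\<epsilon>. cls (\<psi> \<epsilon>))"
    by (rule continuous_map_cls)
  have dist: "P (\<psi> \<epsilon>) \<in> distinct_zeros N" if \<epsilon>: "\<epsilon> \<noteq> 0" "\<epsilon> \<notin> bad" for \<epsilon>
  proof -
    define e where "e = (\<Prod>i=1..n. if i = n then \<epsilon> else fst (q i))"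
    have "P (\<psi> \<epsilon>) = (\<Prod>i=1..n. smult (if i = n then \<epsilon> else fst (q i)) (\<Prod>j<m i. lin (v \<epsilon> (i, j))))"
      by (rule prod.cong) (auto simp: \<psi>_def)
    also have "\<dots> = smult e (\<Prod>i=1..n. \<Prod>j<m i. lin (v \<epsilon> (i, j)))"
      unfolding prod_smult e_def ..
    also have "(\<Prod>i=1..n. \<Prod>j<m i. lin (v \<epsilon> (i, j))) = (\<Prod>x\<in>J. lin (v \<epsilon> x))"
      unfolding J_def by (subst prod.Sigma) auto
    finally have P: "P (\<psi> \<epsilon>) = smult e (\<Prod>x\<in>J. lin (v \<epsilon> x))" .
    have e: "e \<noteq> 0" using q \<epsilon>(1) by (auto simp: e_def)
    have "pt (v \<epsilon> x) \<noteq> pt (v \<epsilon> y)" if "x \<in> J" "y \<in> J" "x \<noteq> y" for x y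
    proof -
      have "ev (Suc 0) (lin (v \<epsilon> x)) (v \<epsilon> y) \<noteq> 0"
        using that \<epsilon>(2) unfolding bad_def by blast
      then show ?thesis using vnz[OF \<epsilon>(2)] that by (simp add: pt_eq_iff)
    qed
    then have "inj_on (pt \<circ> v \<epsilon>) J" unfolding inj_on_def o_def by blast
    then show ?thesis
      unfolding P K_eq[symmetric] cardJ[symmetric]
      using distinct_zeros_prod_iff[OF finJ vnz[OF \<epsilon>(2)] e] by simp
  qed
  show "C \<in> an M closure_of {C \<in> points M. hitchin_map n C \<in> distinct_zeros N}"
    unfolding in_closure_of
  proof (intro conjI allI impI)
    show "C \<in> topspace (an M)" using \<phi> by (simp add: topspace_M quotientI)
    fix T assume T: "C \<in> T \<and> openin (an M) T"
    have "openin (top_of_set G) {\<epsilon> \<in> G. cls (\<psi> \<epsilon>) \<in> T}"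
      using openin_continuous_map_preimage[OF cont, of T] T by simp
    then obtain A where A: "open A" "{\<epsilon> \<in> G. cls (\<psi> \<epsilon>) \<in> T} = G \<inter> A"
      by (auto simp: openin_open)
    have "0 \<in> {\<epsilon> \<in> G. cls (\<psi> \<epsilon>) \<in> T}" using T \<phi>(2) \<psi>0 by (simp add: G_def)
    then have "0 \<in> A" using A by blast
    \<comment> \<open>Finitely many bad parameters other than 0 form a closed set, so all small
      nonzero parameters are good.\<close>
    moreover have "open (A \<inter> - (bad - {0}))"
      using A(1) finbad by (intro open_Int open_Compl finite_imp_closed) auto
    ultimately obtain \<delta> where \<delta>: "\<delta> > 0" "ball 0 \<delta> \<subseteq> A \<inter> - (bad - {0})"
      using open_contains_ball_eq[of "A \<inter> - (bad - {0})" 0] by auto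
    define \<epsilon> :: complex where "\<epsilon> = of_real (\<delta> / 2)"
    have \<epsilon>: "\<epsilon> \<in> ball 0 \<delta>" "\<epsilon> \<noteq> 0" using \<delta>(1) by (auto simp: \<epsilon>_def norm_divide)
    then have nb: "\<epsilon> \<notin> bad" "\<epsilon> \<in> A" using \<delta>(2) by blast+
    then have G: "\<epsilon> \<in> G" by (simp add: G_def)
    then have "cls (\<psi> \<epsilon>) \<in> T" using A(2) nb(2) by blast
    moreover have "cls (\<psi> \<epsilon>) \<in> points M" using st[OF G] by (simp add: topspace_M quotientI)
    moreover have "hitchin_map n (cls (\<psi> \<epsilon>)) \<in> distinct_zeros N"
      unfolding hitchin_cls[OF st[OF G]] using dist[OF \<epsilon>(2) nb(1)] .
    ultimately show "\<exists>y. y \<in> {C \<in> points M. hitchin_map n C \<in> distinct_zeros N} \<and> y \<in> T"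
      by blast
  qed
qed

end

section \<open>The total space of the vector bundle\<close>

definition poly_upto :: "nat \<Rightarrow> (nat \<Rightarrow> complex) \<Rightarrow> complex poly" where
  "poly_upto k f = (\<Sum>l\<le>k. monom (f l) l)"

lemma coeff_poly_upto: "coeff (poly_upto k f) j = (if j \<le> k then f j else 0)"
  by (simp add: poly_upto_def coeff_sum)

lemma degree_poly_upto: "degree (poly_upto k f) \<le> k"
  by (rule degree_le) (simp add: coeff_poly_upto)

lemma poly_upto_coeff: "degree p \<le> k \<Longrightarrow> poly_upto k (coeff p) = p"
  by (rule poly_eqI) (auto simp: coeff_poly_upto coeff_eq_0)

lemma pure_tensor_rescale:
  assumes "finite I" "\<And>i. i \<in> I \<Longrightarrow> y i = (\<lambda>k. a i * x i k)"
  shows "pure_tensor I m y \<alpha> = (\<Prod>i\<in>I. a i) * pure_tensor I m x \<alpha>"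
proof (cases "\<alpha> \<in> (\<Pi>\<^sub>E i\<in>I. {..m i})")
  case True
  have "(\<Prod>i\<in>I. y i (\<alpha> i)) = (\<Prod>i\<in>I. a i * x i (\<alpha> i))"
    by (rule prod.cong) (simp_all add: assms(2))
  then show ?thesis using True by (simp add: pure_tensor_def prod.distrib)
qed (simp add: pure_tensor_def)

lemma pure_tensor_nonzero:
  assumes "finite I" "x \<in> multicone I m"
  shows "\<exists>\<alpha>. pure_tensor I m x \<alpha> \<noteq> 0"
proof -
  have "\<forall>i\<in>I. \<exists>k. x i k \<noteq> 0" using assms(2) by (simp add: multicone_def)
  from bchoice[OF this] obtain f where f: "\<forall>i\<in>I. x i (f i) \<noteq> 0" by blast
  have "f i \<le> m i" if "i \<in> I" for i
    using f assms(2) that by (auto simp: multicone_def not_less[symmetric])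
  then have "(\<lambda>i\<in>I. f i) \<in> (\<Pi>\<^sub>E i\<in>I. {..m i})" by auto
  then have "pure_tensor I m x (\<lambda>i\<in>I. f i) \<noteq> 0"
    using assms(1) f by (simp add: pure_tensor_def)
  then show ?thesis by blast
qed

text \<open>The coordinate of a vector in the line spanned by the pure tensor of \<open>x\<close>.
  It is unique for \<open>x\<close> in the cone, where that tensor is nonzero, and is only
  meaningful on \<open>taut_fibre\<close>.\<close>

definition tensor_coord ::
  "nat set \<Rightarrow> (nat \<Rightarrow> nat) \<Rightarrow> (nat \<Rightarrow> nat \<Rightarrow> complex) \<Rightarrow> ((nat \<Rightarrow> nat) \<Rightarrow> complex) \<Rightarrow> complex" where
  "tensor_coord I m x T = (SOME a. T = (\<lambda>\<alpha>. a * pure_tensor I m x \<alpha>))"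

lemma tensor_coord:
  "T \<in> taut_fibre I m x \<Longrightarrow> T \<alpha> = tensor_coord I m x T * pure_tensor I m x \<alpha>"
proof -
  assume "T \<in> taut_fibre I m x"
  then have "\<exists>a. T = (\<lambda>\<alpha>. a * pure_tensor I m x \<alpha>)" by (simp add: taut_fibre_def)
  then have "T = (\<lambda>\<alpha>. tensor_coord I m x T * pure_tensor I m x \<alpha>)"
    unfolding tensor_coord_def by (rule someI_ex)
  then show ?thesis by (rule fun_cong)
qed

lemma tensor_coord_eq:
  assumes "finite I" "x \<in> multicone I m" "T = (\<lambda>\<alpha>. a * pure_tensor I m x \<alpha>)"
  shows "tensor_coord I m x T = a"
proof -
  obtain \<alpha> where \<alpha>: "pure_tensor I m x \<alpha> \<noteq> 0" using pure_tensor_nonzero[OF assms(1,2)] by blast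
  have "T \<in> taut_fibre I m x" using assms(3) by (auto simp: taut_fibre_def)
  from tensor_coord[OF this, of \<alpha>] show ?thesis using \<alpha> by (simp add: assms(3))
qed

lemma variety_isoI:
  assumes "variety_morphism X Y f" "variety_morphism Y X g"
    "\<And>x. x \<in> points X \<Longrightarrow> g (f x) = x" "\<And>y. y \<in> points Y \<Longrightarrow> f (g y) = y"
  shows "variety_iso X Y f"
  unfolding variety_iso_def using assms by blast

context quiver_moduli
begin

abbreviation I where "I \<equiv> {1..<n}"
abbreviation rank where "rank \<equiv> nat (map_degree n d t n + 1)"
abbreviation cone where "cone \<equiv> multicone I m"
abbreviation resc where "resc \<equiv> rescaling I m"
abbreviation tpairs where "tpairs \<equiv> taut_pairs I m rank"
abbreviation tresc where "tresc \<equiv> taut_rescaling I m rank"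
abbreviation ccoords :: "(nat \<Rightarrow> nat \<Rightarrow> complex) \<Rightarrow> nat \<times> nat \<Rightarrow> complex"
  where "ccoords \<equiv> \<lambda>x (i, k). x i k"

lemma rank_eq: "rank = m n + 1"
  using nonneg[of n] n2 by simp

lemma nodes_cases:
  obtains "i \<in> I" "i \<noteq> n" "i \<in> {1..n}" | "i = n" "i \<notin> I" "i \<in> {1..n}" | "i \<notin> I" "i \<noteq> n" "i \<notin> {1..n}"
  using n2 by force

definition xc :: "(nat \<Rightarrow> complex poly) \<Rightarrow> nat \<Rightarrow> nat \<Rightarrow> complex" where
  "xc \<phi> = (\<lambda>i. if i \<in> I then coeff (\<phi> i) else (\<lambda>_. 0))"

definition tc :: "(nat \<Rightarrow> complex poly) \<Rightarrow> nat \<Rightarrow> (nat \<Rightarrow> nat) \<Rightarrow> complex" where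
  "tc \<phi> j \<alpha> = coeff (\<phi> n) j * pure_tensor I m (xc \<phi>) \<alpha>"

text \<open>The argument \<open>a\<close> lists the coefficients of the last map; truncation by
  \<open>poly_upto\<close> enforces the degree bounds for arbitrary arguments.\<close>

definition rep_of :: "(nat \<Rightarrow> nat \<Rightarrow> complex) \<Rightarrow> (nat \<Rightarrow> complex) \<Rightarrow> nat \<Rightarrow> complex poly" where
  "rep_of x a i = (if i \<in> I then poly_upto (m i) (x i) else if i = n then poly_upto (m n) a else 0)"

lemma xc_outside: "i \<notin> I \<Longrightarrow> xc \<phi> i = (\<lambda>_. 0)"
  unfolding xc_def by (rule if_not_P)

lemma xc_in_cone:
  assumes "\<phi> \<in> stab"
  shows "xc \<phi> \<in> cone"
  unfolding multicone_def
proof (intro CollectI conjI ballI allI impI)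
  fix i assume i: "i \<in> I"
  then have nz: "\<phi> i \<noteq> 0" using assms by (simp add: stab_iff)
  show "\<exists>k. xc \<phi> i k \<noteq> 0"
    using i nz by (intro exI[of _ "degree (\<phi> i)"]) (simp add: xc_def)
  fix k assume "k > m i"
  moreover have "degree (\<phi> i) \<le> m i" using assms i by (intro stab_degree) auto
  ultimately show "xc \<phi> i k = 0"
    using i by (simp add: xc_def coeff_eq_0)
qed (rule xc_outside)

lemma pair_in_tpairs:
  assumes "\<phi> \<in> stab"
  shows "(xc \<phi>, tc \<phi>) \<in> tpairs"
  unfolding taut_pairs_def
proof (intro CollectI case_prodI conjI allI impI xc_in_cone[OF assms])
  fix j
  show "tc \<phi> j \<in> taut_fibre I m (xc \<phi>)"
    unfolding taut_fibre_def tc_def by blast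
  assume "j \<ge> rank"
  then have "coeff (\<phi> n) j = 0"
    using stab_degree[OF assms, of n] n2 by (intro coeff_eq_0) (simp add: rank_eq)
  then show "tc \<phi> j = (\<lambda>_. 0)" by (simp add: tc_def fun_eq_iff)
qed

lemma rep_of_in_stab:
  assumes "x \<in> cone"
  shows "rep_of x a \<in> stab"
  unfolding stab_iff
proof (intro conjI ballI allI impI)
  fix i
  show "degree (rep_of x a i) \<le> m i"
    by (simp add: rep_of_def degree_poly_upto)
  show "rep_of x a i = 0" if "i \<notin> {1..n}"
    using that by (cases rule: nodes_cases[of i]) (simp_all only: rep_of_def if_False)
next
  fix i assume i: "i \<in> I"
  have "\<exists>k. x i k \<noteq> 0" "\<forall>k>m i. x i k = 0"
    using assms i unfolding multicone_def by blast+
  then obtain k where k: "x i k \<noteq> 0" "k \<le> m i"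
    using leI by blast
  then have "coeff (rep_of x a i) k \<noteq> 0"
    using i by (simp add: rep_of_def coeff_poly_upto)
  then show "rep_of x a i \<noteq> 0" by auto
qed

lemma xc_rep_of:
  assumes "x \<in> cone"
  shows "xc (rep_of x a) = x"
proof (intro ext)
  fix i k
  show "xc (rep_of x a) i k = x i k"
  proof (cases "i \<in> I")
    case True
    then have "\<forall>k>m i. x i k = 0" using assms by (simp add: multicone_def)
    then show ?thesis
      using True by (simp add: xc_def rep_of_def coeff_poly_upto)
  next
    case False
    then have "x i = (\<lambda>_. 0)" using assms unfolding multicone_def by blast
    then show ?thesis unfolding xc_outside[OF False] by simp
  qed
qed

lemma coeff_rep_of_n: "coeff (rep_of x a n) j = (if j \<le> m n then a j else 0)"
  by (simp add: rep_of_def coeff_poly_upto)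

lemma rep_of_xc:
  assumes "\<phi> \<in> stab" "\<And>j. j \<le> m n \<Longrightarrow> a j = coeff (\<phi> n) j"
  shows "rep_of (xc \<phi>) a = \<phi>"
proof
  fix i
  show "rep_of (xc \<phi>) a i = \<phi> i"
  proof (cases rule: nodes_cases[of i])
    case 1
    have "xc \<phi> i = coeff (\<phi> i)" using 1 by (simp add: xc_def)
    then show ?thesis
      using 1 poly_upto_coeff[OF stab_degree[OF assms(1) 1(3)]] by (simp add: rep_of_def)
  next
    case 2
    have "poly_upto (m n) a = poly_upto (m n) (coeff (\<phi> n))"
      by (rule poly_eqI) (simp add: coeff_poly_upto assms(2))
    also have "\<dots> = \<phi> n"
      using 2 by (intro poly_upto_coeff stab_degree[OF assms(1)]) simp
    finally show ?thesis using 2 by (simp add: rep_of_def)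
  next
    case 3
    then have "\<phi> i = 0" using assms(1) unfolding stab_iff by blast
    then show ?thesis using 3 by (simp only: rep_of_def if_False)
  qed
qed

text \<open>The pure tensor of the first \<open>n - 1\<close> maps is multiplied by their scalars
  and the last map by the inverse of the product of these, so \<open>tc\<close> is unchanged. This
  cancellation is the source of the twist by \<open>O(-1,...,-1)\<close>.\<close>

lemma iso_xc:
  assumes "(\<phi>, \<psi>) \<in> iso"
  shows "(xc \<phi>, xc \<psi>) \<in> resc" "tc \<psi> = tc \<phi>"
proof -
  obtain l where st: "\<phi> \<in> stab" "\<psi> \<in> stab"
    and l: "\<And>i. i \<in> {1..n} \<Longrightarrow> l i \<noteq> 0 \<and> \<psi> i = smult (l i) (\<phi> i)" and l1: "(\<Prod>i=1..n. l i) = 1"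
    using assms unfolding iso_iff by blast
  have x: "l i \<noteq> 0 \<and> xc \<psi> i = (\<lambda>k. l i * xc \<phi> i k)" if "i \<in> I" for i
    using l[of i] that by (auto simp: xc_def)
  then show "(xc \<phi>, xc \<psi>) \<in> resc"
    using xc_in_cone st unfolding rescaling_def by blast
  have t: "pure_tensor I m (xc \<psi>) \<alpha> = (\<Prod>i\<in>I. l i) * pure_tensor I m (xc \<phi>) \<alpha>" for \<alpha>
    by (rule pure_tensor_rescale) (use x in auto)
  have "\<psi> n = smult (l n) (\<phi> n)" using l[of n] n2 by simp
  then show "tc \<psi> = tc \<phi>"
  proof (intro ext)
    fix j \<alpha>
    assume \<psi>n: "\<psi> n = smult (l n) (\<phi> n)"
    have "tc \<psi> j \<alpha> = ((\<Prod>i\<in>I. l i) * l n) * tc \<phi> j \<alpha>"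
      by (simp add: tc_def t \<psi>n)
    then show "tc \<psi> j \<alpha> = tc \<phi> j \<alpha>" using l1 unfolding prod_nodes by simp
  qed
qed

text \<open>The scalar at the last node is forced to be the inverse of the product of the others,
  and \<open>ab\<close> asks that \<open>b\<close> be obtained from \<open>a\<close> in this way. It
  is quantified over all rescaling factors \<open>l\<close> because the factors relating
  \<open>x\<close> and \<open>y\<close> are only chosen inside the proof. The lemma serves both
  tensor coordinates and the zero section.\<close>

lemma resc_rep_of:
  assumes xy: "(x, y) \<in> resc"
    and ab: "\<And>l j. (\<And>i. i \<in> I \<Longrightarrow> l i \<noteq> 0 \<and> y i = (\<lambda>k. l i * x i k)) \<Longrightarrow> b j * (\<Prod>i\<in>I. l i) = a j"
  shows "(rep_of x a, rep_of y b) \<in> iso"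
proof -
  obtain c where cone: "x \<in> cone" "y \<in> cone" and c: "\<And>i. i \<in> I \<Longrightarrow> c i \<noteq> 0 \<and> y i = (\<lambda>k. c i * x i k)"
    using xy unfolding rescaling_def by blast
  have E: "(\<Prod>i\<in>I. c i) \<noteq> 0" using c by simp
  define l where "l i = (if i = n then 1 / (\<Prod>i\<in>I. c i) else c i)" for i
  have "l i \<noteq> 0 \<and> rep_of y b i = smult (l i) (rep_of x a i)" if "i \<in> {1..n}" for i
  proof (cases rule: nodes_cases[of i])
    case 1
    then show ?thesis
      using c[OF 1(1)] by (auto simp: l_def rep_of_def coeff_poly_upto intro!: poly_eqI)
  next
    case 2
    have "b j = l n * a j" for j
      using ab[OF c, of j] E by (simp add: l_def field_simps)
    then have "rep_of y b n = smult (l n) (rep_of x a n)"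
      by (intro poly_eqI) (simp add: coeff_rep_of_n)
    then show ?thesis using 2 E by (simp add: l_def)
  qed (use that in blast)
  moreover have "(\<Prod>i=1..n. l i) = 1"
  proof -
    have "(\<Prod>i\<in>I. l i) = (\<Prod>i\<in>I. c i)" by (rule prod.cong) (auto simp: l_def)
    then show ?thesis unfolding prod_nodes using E by (simp add: l_def)
  qed
  ultimately show ?thesis
    unfolding iso_iff using rep_of_in_stab cone by blast
qed

definition of_pair :: "(nat \<Rightarrow> nat \<Rightarrow> complex) \<times> (nat \<Rightarrow> (nat \<Rightarrow> nat) \<Rightarrow> complex) \<Rightarrow> nat \<Rightarrow> complex poly" where
  "of_pair p = rep_of (fst p) (\<lambda>j. tensor_coord I m (fst p) (snd p j))"

lemma tpairs_fst: "p \<in> tpairs \<Longrightarrow> fst p \<in> cone"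
  by (auto simp: taut_pairs_def)

lemma tpairs_snd:
  assumes "p \<in> tpairs"
  shows "snd p j \<in> taut_fibre I m (fst p)"
proof (cases "j < rank")
  case False
  then have "snd p j = (\<lambda>_. 0)" using assms by (auto simp: taut_pairs_def)
  then show ?thesis by (auto simp: taut_fibre_def intro: exI[of _ 0])
qed (use assms in \<open>auto simp: taut_pairs_def\<close>)

lemma of_pair_in_stab: "p \<in> tpairs \<Longrightarrow> of_pair p \<in> stab"
  unfolding of_pair_def by (rule rep_of_in_stab) (rule tpairs_fst)

lemma of_pair_pair: "\<phi> \<in> stab \<Longrightarrow> of_pair (xc \<phi>, tc \<phi>) = \<phi>"
  unfolding of_pair_def fst_conv snd_conv
  by (rule rep_of_xc) (auto intro!: tensor_coord_eq xc_in_cone simp: tc_def)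

lemma pair_of_pair:
  assumes p: "p \<in> tpairs"
  shows "(xc (of_pair p), tc (of_pair p)) = p"
proof -
  have x: "xc (of_pair p) = fst p"
    unfolding of_pair_def by (rule xc_rep_of[OF tpairs_fst[OF p]])
  have "tc (of_pair p) j \<alpha> = snd p j \<alpha>" for j \<alpha>
  proof (cases "j \<le> m n")
    case True
    then show ?thesis
      unfolding tc_def x using tensor_coord[OF tpairs_snd[OF p]]
      by (simp add: of_pair_def coeff_rep_of_n)
  next
    case False
    then have "snd p j = (\<lambda>_. 0)" using p unfolding taut_pairs_def rank_eq by auto
    then show ?thesis
      using False by (simp add: tc_def of_pair_def coeff_rep_of_n)
  qed
  then show ?thesis using x by (auto simp: prod_eq_iff)
qed

text \<open>The tensors of the two pairs coincide while the spanning pure tensor is rescaled, so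
  their coordinates differ by the inverse factor; the last map absorbs it.\<close>

lemma tresc_of_pair:
  assumes "(p, p') \<in> tresc"
  shows "(of_pair p, of_pair p') \<in> iso"
proof -
  obtain x y T where p: "p = (x, T)" "p' = (y, T)" "(x, T) \<in> tpairs" "(y, T) \<in> tpairs" "(x, y) \<in> resc"
    using assms by (auto simp: taut_rescaling_def)
  show ?thesis
    unfolding p(1,2) of_pair_def fst_conv snd_conv
  proof (rule resc_rep_of[OF p(5)])
    fix l j assume l: "\<And>i. i \<in> I \<Longrightarrow> l i \<noteq> 0 \<and> y i = (\<lambda>k. l i * x i k)"
    have "T j = (\<lambda>\<alpha>. (tensor_coord I m y (T j) * (\<Prod>i\<in>I. l i)) * pure_tensor I m x \<alpha>)"
    proof
      fix \<alpha>
      have "pure_tensor I m y \<alpha> = (\<Prod>i\<in>I. l i) * pure_tensor I m x \<alpha>"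
        by (rule pure_tensor_rescale) (use l in auto)
      then show "T j \<alpha> = (tensor_coord I m y (T j) * (\<Prod>i\<in>I. l i)) * pure_tensor I m x \<alpha>"
        using tensor_coord[OF tpairs_snd[OF p(4)], of j \<alpha>] by simp
    qed
    then have "tensor_coord I m x (T j) = tensor_coord I m y (T j) * (\<Prod>i\<in>I. l i)"
      using tpairs_fst[OF p(3)] by (intro tensor_coord_eq) simp_all
    then show "tensor_coord I m y (T j) * (\<Prod>i\<in>I. l i) = tensor_coord I m x (T j)" by simp
  qed
qed

lemma rational_xc: "rational_on V coords (\<lambda>\<phi>. xc \<phi> i k)"
  unfolding xc_def by (cases "i \<in> I") (simp_all only: if_True if_False coords_rational rational_on_const)

lemma rational_pure_tensor:
  assumes "\<And>i k. rational_on V c (\<lambda>z. f z i k)"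
  shows "rational_on V c (\<lambda>z. pure_tensor I m (f z) \<alpha>)"
  unfolding pure_tensor_def
  by (cases "\<alpha> \<in> (\<Pi>\<^sub>E i\<in>I. {..m i})")
    (simp_all only: if_True if_False rational_on_const, rule rational_on_prod, rule assms)

lemma to_pairs_morphism:
  "variety_morphism S (embedded_variety tpairs taut_coords) (\<lambda>\<phi>. (xc \<phi>, tc \<phi>))"
proof (rule variety_morphism_rationalI)
  show "(\<lambda>\<phi>. (xc \<phi>, tc \<phi>)) ` stab \<subseteq> tpairs" using pair_in_tpairs by blast
  show "rational_on stab coords (\<lambda>\<phi>. taut_coords (xc \<phi>, tc \<phi>) k)" for k
  proof (cases k)
    case (Inl ij)
    then show ?thesis by (cases ij) (simp add: taut_coords_def rational_xc)
  next
    case (Inr ja)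
    obtain j \<alpha> where "ja = (j, \<alpha>)" by (cases ja)
    moreover have "rational_on stab coords (\<lambda>\<phi>. tc \<phi> j \<alpha>)"
      unfolding tc_def by (rule rational_on_mult[OF coords_rational rational_pure_tensor[OF rational_xc]])
    ultimately show ?thesis using Inr by (simp add: taut_coords_def)
  qed
qed

lemma of_pair_morphism:
  "variety_morphism (embedded_variety tpairs taut_coords) S of_pair"
proof (rule variety_morphism_embeddedI)
  show "of_pair ` tpairs \<subseteq> stab" using of_pair_in_stab by blast
  fix p assume p: "p \<in> tpairs"
  \<comment> \<open>The multi-index depends on \<open>p\<close>, so the coordinates of the last map
    get their rational formula on a chart around \<open>p\<close>, where this entry of the pure
    tensor is nonzero.\<close>
  obtain \<alpha> where \<alpha>: "pure_tensor I m (fst p) \<alpha> \<noteq> 0"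
    using pure_tensor_nonzero[OF _ tpairs_fst[OF p]] by blast
  define V where "V = {p \<in> tpairs. pure_tensor I m (fst p) \<alpha> \<noteq> 0}"
  have c1: "rational_on W taut_coords (\<lambda>p. fst p i k)" for W i k
    using rational_on_coord[of W taut_coords "Inl (i, k)"] by (simp add: taut_coords_def case_prod_beta)
  have c2: "rational_on W taut_coords (\<lambda>p. snd p j \<alpha>)" for W j \<alpha>
    using rational_on_coord[of W taut_coords "Inr (j, \<alpha>)"] by (simp add: taut_coords_def case_prod_beta)
  have pure: "rational_on W taut_coords (\<lambda>p. pure_tensor I m (fst p) \<alpha>)" for W
    by (rule rational_pure_tensor) (rule c1)
  have "openin (zariski tpairs taut_coords) V"
    unfolding V_def using openin_topspace[of "zariski tpairs taut_coords"]
    by (intro openin_rational_nonzero pure) simp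
  moreover have "p \<in> V" using p \<alpha> by (simp add: V_def)
  moreover have "rational_on V taut_coords (\<lambda>p. coords (of_pair p) k)" for k
  proof -
    obtain i j where k: "k = (i, j)" by (cases k)
    show ?thesis
    proof (cases rule: nodes_cases[of i])
      case 1
      have "coords (of_pair p) k = (if j \<le> m i then fst p i j else 0)" for p
        using 1 by (simp add: k of_pair_def rep_of_def coeff_poly_upto)
      then show ?thesis by (cases "j \<le> m i") (simp_all add: c1 rational_on_const)
    next
      case 2
      show ?thesis
      proof (cases "j \<le> m n")
        case True
        have "rational_on V taut_coords (\<lambda>p. snd p j \<alpha> / pure_tensor I m (fst p) \<alpha>)"
          by (rule rational_on_divide[OF c2 pure]) (simp add: V_def)
        also have "?this \<longleftrightarrow> rational_on V taut_coords (\<lambda>p. coords (of_pair p) k)"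
        proof (rule rational_on_cong)
          fix p assume "p \<in> V"
          then have pV: "p \<in> tpairs" "pure_tensor I m (fst p) \<alpha> \<noteq> 0" by (auto simp: V_def)
          show "snd p j \<alpha> / pure_tensor I m (fst p) \<alpha> = coords (of_pair p) k"
            using 2 True pV(2) tensor_coord[OF tpairs_snd[OF pV(1)], of j \<alpha>]
            by (simp add: k of_pair_def coeff_rep_of_n)
        qed
        finally show ?thesis .
      next
        case False
        then have "coords (of_pair p) k = 0" for p
          using 2 by (simp add: k of_pair_def coeff_rep_of_n)
        then show ?thesis by (simp add: rational_on_const)
      qed
    next
      case 3
      then have "coords (of_pair p) k = 0" for p
        unfolding k of_pair_def rep_of_def by (simp only: if_False prod.case coeff_0)
      then show ?thesis by (simp add: rational_on_const)
    qed
  qed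
  ultimately show "\<exists>V. openin (zariski tpairs taut_coords) V \<and> p \<in> V \<and>
      (\<forall>k. rational_on V taut_coords (\<lambda>p. coords (of_pair p) k))" by blast
qed

definition to_total :: "(nat \<Rightarrow> complex poly) set \<Rightarrow> ((nat \<Rightarrow> nat \<Rightarrow> complex) \<times> (nat \<Rightarrow> (nat \<Rightarrow> nat) \<Rightarrow> complex)) set" where
  "to_total = descend (\<lambda>\<phi>. tresc `` {(xc \<phi>, tc \<phi>)})"

lemma iso_pair: "(\<phi>, \<psi>) \<in> iso \<Longrightarrow> ((xc \<phi>, tc \<phi>), (xc \<psi>, tc \<psi>)) \<in> tresc"
proof -
  assume i: "(\<phi>, \<psi>) \<in> iso"
  then have "\<phi> \<in> stab" "\<psi> \<in> stab" by (simp_all add: iso_iff)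
  from pair_in_tpairs[OF this(1)] pair_in_tpairs[OF this(2)] show ?thesis
    using iso_xc[OF i] by (simp add: taut_rescaling_def)
qed

lemma to_total_cls: "\<phi> \<in> stab \<Longrightarrow> to_total (cls \<phi>) = tresc `` {(xc \<phi>, tc \<phi>)}"
  unfolding to_total_def by (rule descend_class_map[OF equiv_iso equiv_taut_rescaling], assumption, erule iso_pair)

lemma of_pair_class: "p \<in> tpairs \<Longrightarrow> descend (\<lambda>p. cls (of_pair p)) (tresc `` {p}) = cls (of_pair p)"
  by (rule descend_class_map[OF equiv_taut_rescaling equiv_iso], assumption, erule tresc_of_pair)

lemma total_space_iso: "variety_iso M (taut_total I m rank) to_total"
  unfolding moduli_def taut_total_def
proof (rule variety_isoI)
  show "variety_morphism (quotient_variety S iso) (quotient_variety (embedded_variety tpairs taut_coords) tresc) to_total"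
    by (rule variety_morphism_quotientI[OF to_pairs_morphism]) (rule to_total_cls)
  show "variety_morphism (quotient_variety (embedded_variety tpairs taut_coords) tresc) (quotient_variety S iso)
      (descend (\<lambda>p. cls (of_pair p)))"
    by (rule variety_morphism_quotientI[OF of_pair_morphism]) (rule of_pair_class)
  fix C assume "C \<in> points (quotient_variety S iso)"
  then obtain \<phi> where \<phi>: "\<phi> \<in> stab" "C = cls \<phi>" by (auto simp: in_M_iff)
  show "descend (\<lambda>p. cls (of_pair p)) (to_total C) = C"
    unfolding \<phi>(2) to_total_cls[OF \<phi>(1)] of_pair_class[OF pair_in_tpairs[OF \<phi>(1)]] of_pair_pair[OF \<phi>(1)] ..
next
  fix D assume "D \<in> points (quotient_variety (embedded_variety tpairs taut_coords) tresc)"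
  then obtain p where p: "p \<in> tpairs" "D = tresc `` {p}" by (auto simp: quotient_def)
  show "to_total (descend (\<lambda>p. cls (of_pair p)) D) = D"
    unfolding p(2) of_pair_class[OF p(1)] to_total_cls[OF of_pair_in_stab[OF p(1)]] pair_of_pair[OF p(1)] ..
qed

section \<open>The bundle projection, the zero section and the fibre over zero\<close>

lemma projection_cls: "\<phi> \<in> stab \<Longrightarrow> moduli_projection n d t (cls \<phi>) = resc `` {xc \<phi>}"
  unfolding moduli_projection_def xc_def[symmetric]
  by (rule descend_class_map[OF equiv_iso equiv_rescaling], assumption, erule iso_xc(1))

lemma total_space_projection:
  assumes "C \<in> points M"
  shows "taut_projection I m (to_total C) = moduli_projection n d t C"
proof -
  obtain \<phi> where \<phi>: "\<phi> \<in> stab" "C = cls \<phi>" using assms by (auto simp: topspace_M in_M_iff)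
  have "taut_projection I m (tresc `` {(xc \<phi>, tc \<phi>)}) = (case (xc \<phi>, tc \<phi>) of (x, T) \<Rightarrow> resc `` {x})"
    unfolding taut_projection_def
  proof (rule descend_class[OF equiv_taut_rescaling pair_in_tpairs[OF \<phi>(1)]])
    fix p assume "((xc \<phi>, tc \<phi>), p) \<in> tresc"
    then have "(xc \<phi>, fst p) \<in> resc" by (auto simp: taut_rescaling_def)
    from equiv_class_eq[OF equiv_rescaling this]
    show "(case p of (x, T) \<Rightarrow> resc `` {x}) = (case (xc \<phi>, tc \<phi>) of (x, T) \<Rightarrow> resc `` {x})"
      by (simp add: case_prod_beta)
  qed
  then show ?thesis
    unfolding \<phi>(2) to_total_cls[OF \<phi>(1)] projection_cls[OF \<phi>(1)] by simp
qed

lemma projection_morphism: "variety_morphism M (proj_product I m) (moduli_projection n d t)"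
  unfolding moduli_def proj_product_def
proof (rule variety_morphism_quotientI[where f = xc])
  show "variety_morphism S (embedded_variety cone ccoords) xc"
  proof (rule variety_morphism_rationalI)
    show "xc ` stab \<subseteq> cone" using xc_in_cone by blast
    show "rational_on stab coords (\<lambda>\<phi>. ccoords (xc \<phi>) k)" for k
      by (cases k) (simp add: rational_xc)
  qed
qed (rule projection_cls)

lemma zero_section_class:
  "x \<in> cone \<Longrightarrow> descend (\<lambda>x. cls (rep_of x (\<lambda>_. 0))) (resc `` {x}) = cls (rep_of x (\<lambda>_. 0))"
proof (rule descend_class_map[OF equiv_rescaling equiv_iso])
  fix y assume "(x, y) \<in> resc"
  then show "(rep_of x (\<lambda>_. 0), rep_of y (\<lambda>_. 0)) \<in> iso"
    by (rule resc_rep_of) simp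
qed

lemma zero_section_morphism:
  "variety_morphism (proj_product I m) M (descend (\<lambda>x. cls (rep_of x (\<lambda>_. 0))))"
  unfolding moduli_def proj_product_def
proof (rule variety_morphism_quotientI[where f = "\<lambda>x. rep_of x (\<lambda>_. 0)"])
  show "variety_morphism (embedded_variety cone ccoords) S (\<lambda>x. rep_of x (\<lambda>_. 0))"
  proof (rule variety_morphism_rationalI)
    show "(\<lambda>x. rep_of x (\<lambda>_. 0)) ` cone \<subseteq> stab" using rep_of_in_stab by blast
    fix k :: "nat \<times> nat"
    obtain i j where k: "k = (i, j)" by (cases k)
    have c: "rational_on cone ccoords (\<lambda>x. x i j)"
      using rational_on_coord[of cone ccoords "(i, j)"] by simp
    have "coords (rep_of x (\<lambda>_. 0)) k = (if i \<in> I \<and> j \<le> m i then x i j else 0)" for x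
      by (simp add: k rep_of_def coeff_poly_upto)
    then show "rational_on cone ccoords (\<lambda>x. coords (rep_of x (\<lambda>_. 0)) k)"
      using c by (cases "i \<in> I \<and> j \<le> m i") (simp_all only: if_True if_False simp_thms rational_on_const)
  qed
qed (rule zero_section_class)

text \<open>The first \<open>n - 1\<close> maps are nonzero, so product 0 means that the last map
  vanishes. The fibre is therefore the image of the zero section, which inverts the projection
  there; gluing on the product of projective spaces lets that section land in the
  subvariety.\<close>

lemma nilpotent_cone_iso:
  "variety_iso (subvariety M {C \<in> points M. hitchin_map n C = 0}) (proj_product I m) (moduli_projection n d t)"
proof (rule variety_isoI)
  let ?A = "{C \<in> points M. hitchin_map n C = 0}"
  let ?g = "descend (\<lambda>x. cls (rep_of x (\<lambda>_. 0)))"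
  show "variety_morphism (subvariety M ?A) (proj_product I m) (moduli_projection n d t)"
    by (rule variety_morphism_from_subvariety[OF projection_morphism])
  have pts: "points (proj_product I m) = cone // resc" "topspace (an (proj_product I m)) = cone // resc"
    by (simp_all add: proj_product_def)
  have P0: "P (rep_of x (\<lambda>_. 0)) = 0" for x
    unfolding prod_nodes by (simp add: rep_of_def poly_upto_def)
  have "?g D \<in> ?A" if D: "D \<in> cone // resc" for D
  proof -
    obtain x where x: "x \<in> cone" "D = resc `` {x}" using D by (auto simp: quotient_def)
    show ?thesis
      unfolding x(2) zero_section_class[OF x(1)]
      using rep_of_in_stab[OF x(1)] P0 by (simp add: hitchin_cls topspace_M quotientI)
  qed
  then show "variety_morphism (proj_product I m) (subvariety M ?A) ?g"
    using zero_section_morphism pts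
    by (intro variety_morphism_into_subvariety)
      (auto simp: proj_product_def intro: local_functions_quotient local_functions_embedded)
  fix C assume "C \<in> points (subvariety M ?A)"
  then have "C \<in> stab // iso" "hitchin_map n C = 0" by (auto simp: subvariety_def topspace_M)
  then obtain \<phi> where \<phi>: "\<phi> \<in> stab" "C = cls \<phi>" "P \<phi> = 0" by (auto simp: in_M_iff hitchin_cls)
  then have "\<phi> n = 0"
    unfolding prod_nodes by (auto simp: stab_iff)
  then have "rep_of (xc \<phi>) (\<lambda>_. 0) = \<phi>"
    by (intro rep_of_xc[OF \<phi>(1)]) simp
  then show "?g (moduli_projection n d t C) = C"
    unfolding \<phi>(2) projection_cls[OF \<phi>(1)] zero_section_class[OF xc_in_cone[OF \<phi>(1)]] by simp
next
  fix D assume "D \<in> points (proj_product I m)"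
  then obtain x where x: "x \<in> cone" "D = resc `` {x}" by (auto simp: proj_product_def quotient_def)
  show "moduli_projection n d t (descend (\<lambda>x. cls (rep_of x (\<lambda>_. 0))) D) = D"
    unfolding x(2) zero_section_class[OF x(1)] projection_cls[OF rep_of_in_stab[OF x(1)]] xc_rep_of[OF x(1)] ..
qed

end

theorem theorem5p1:
  fixes n :: nat and d :: "nat \<Rightarrow> int" and t :: int
  assumes nodes: "n \<ge> 2"
    and coprime: "coprime (\<Sum>i=1..n. d i) (int n)"
    and stable: "stable_reps n d t \<noteq> {}"
    and indexed: "indexed_to_vanish_last n d"
  defines "M \<equiv> moduli n d t"
    and "h \<equiv> hitchin_map n"
    and "N \<equiv> int n * t"
    and "PP \<equiv> proj_product {1..<n} (\<lambda>i. nat (map_degree n d t i))"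
    and "L \<equiv> taut_total {1..<n} (\<lambda>i. nat (map_degree n d t i)) (nat (map_degree n d t n + 1))"
    and "\<pi> \<equiv> taut_projection {1..<n} (\<lambda>i. nat (map_degree n d t i))"
  shows
    "(variety_morphism M (H0_variety N) h \<and>
      covering_over (eta n d t) (an M) (an (H0_variety N)) h (distinct_zeros N) \<and>
      (eta n d t > 1 \<longrightarrow> (\<forall>s \<in> repeated_zeros N. branches_over (eta n d t) (an M) h s)) \<and>
      (eta n d t = 1 \<longrightarrow> covering_over 1 (an M) (an (H0_variety N)) h (H0 N - {0})) \<and>
      variety_iso (subvariety M {C \<in> points M. h C = 0}) PP (moduli_projection n d t) \<and>
      {C \<in> points M. h C = 0} \<subseteq> an M closure_of {C \<in> points M. h C \<in> distinct_zeros N})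
     \<and>
     (\<exists>F. variety_iso M L F \<and> (\<forall>C \<in> points M. \<pi> (F C) = moduli_projection n d t C))"
proof -
  interpret quiver_moduli n d t
  proof
    show "\<phi> \<in> stable_reps n d t \<longleftrightarrow> \<phi> \<in> reps n d t \<and> (\<forall>i\<in>{1..<n}. \<phi> i \<noteq> 0)" for \<phi>
    proof (intro iffI conjI ballI)
      assume \<phi>: "\<phi> \<in> stable_reps n d t"
      then show "\<phi> \<in> reps n d t" unfolding stable_reps_def by blast
      show "\<phi> i \<noteq> 0" if "i \<in> {1..<n}" for i
        by (rule stable_reps_nonzero[OF nodes indexed \<phi> that])
    next
      \<comment> \<open>This direction is where coprimality enters.\<close>
      assume "\<phi> \<in> reps n d t \<and> (\<forall>i\<in>{1..<n}. \<phi> i \<noteq> 0)"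
      then show "\<phi> \<in> stable_reps n d t"
        by (intro nonzero_reps_stable[OF nodes coprime indexed]) blast+
    qed
  qed (use nodes map_degree_nonneg[OF nodes indexed stable] in auto)
  show ?thesis
    unfolding M_def h_def N_def PP_def L_def \<pi>_def
    using hitchin_morphism hitchin_covering hitchin_branches hitchin_covering_one nilpotent_cone_iso
      nilpotent_in_closure total_space_iso total_space_projection by blast
qed

end
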